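(* Let $\ket{\psi}=\sum_{j\in[d]}\alpha_j\ket{j}$ be a quantum state, $\alpha\in\mathbb{C}^d$ its vector of amplitudes, and $U$ a unitary with $U\ket{0}=\ket{\psi}$. Let $q\in[2,\infty]$ and $\varepsilon,\delta\in(0,1)$. Then $$O\Big(\min\Big\{\big(\tfrac3\varepsilon\big)^{\frac{1}{\frac12-\frac1q}},\ \frac{d^{\frac12+\frac1q}}{\varepsilon}\Big\}\log\frac d\delta\Big)$$ applications of controlled-$U$ and controlled-$U^\dagger$ suffice for a quantum algorithm to compute $\tilde\alpha\in\mathbb{C}^d$ with $\|\alpha-\tilde\alpha\|_q\le\varepsilon$, with success probability at least $1-\delta$.
   Context: $\|\cdot\|_q$ is the $\ell_q$-norm. Conventions: $1/\infty=0$, $1/0=\infty$; if a term in the minimum is infinite (e.g., the first term when $q=2$), the bound is the other term. *)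

theory Defs
  imports "HOL-Library.Extended_Real" "Jordan_Normal_Form.Matrix"
begin

definition cadj :: "complex mat \<Rightarrow> complex mat" where
  "cadj A = mat (dim_col A) (dim_row A) (\<lambda>(i,j). cnj (A $$ (j,i)))"

definition unitary_mat :: "nat \<Rightarrow> complex mat \<Rightarrow> bool" where
  "unitary_mat n U \<longleftrightarrow> U \<in> carrier_mat n n \<and> cadj U * U = 1\<^sub>m n \<and> U * cadj U = 1\<^sub>m n"

definition kron :: "complex mat \<Rightarrow> complex mat \<Rightarrow> complex mat" where
  "kron A B = mat (dim_row A * dim_row B) (dim_col A * dim_col B)
     (\<lambda>(i,j). A $$ (i div dim_row B, j div dim_col B) * B $$ (i mod dim_row B, j mod dim_col B))"

(* controlled-U on C^2 \<otimes> C^n: |0><0| \<otimes> I + |1><1| \<otimes> U *)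
definition ctrl :: "nat \<Rightarrow> complex mat \<Rightarrow> complex mat" where
  "ctrl n U = mat (2*n) (2*n) (\<lambda>(i,j).
      if i < n \<and> j < n then (if i = j then 1 else 0)
      else if n \<le> i \<and> n \<le> j then U $$ (i - n, j - n) else 0)"

(* A query algorithm: workspace C^2 \<otimes> C^d \<otimes> C^m (dimension 2*d*m), initial state |0>,
   unitaries V_0,...,V_T interleaved with T queries; query k is controlled-U (True)
   or controlled-U^dagger (False) acting on the first two registers; then a
   computational-basis measurement with outcome i, and classical output out i \<in> C^d.
   (Intermediate measurements can be deferred, so this is the general model.) *)
record qalg =
  anc :: nat
  Vs :: "complex mat list"
  qs :: "bool list"
  out :: "nat \<Rightarrow> nat \<Rightarrow> complex"

definition qdim :: "nat \<Rightarrow> qalg \<Rightarrow> nat" where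
  "qdim d A = 2 * d * anc A"

definition valid_qalg :: "nat \<Rightarrow> qalg \<Rightarrow> bool" where
  "valid_qalg d A \<longleftrightarrow> anc A \<ge> 1 \<and> length (Vs A) = length (qs A) + 1 \<and>
     (\<forall>V \<in> set (Vs A). unitary_mat (qdim d A) V)"

definition num_queries :: "qalg \<Rightarrow> nat" where
  "num_queries A = length (qs A)"

definition query_op :: "nat \<Rightarrow> nat \<Rightarrow> complex mat \<Rightarrow> bool \<Rightarrow> complex mat" where
  "query_op d m U b = kron (ctrl d (if b then U else cadj U)) (1\<^sub>m m)"

definition final_state :: "nat \<Rightarrow> qalg \<Rightarrow> complex mat \<Rightarrow> complex vec" where
  "final_state d A U =
     foldl (\<lambda>v (W, b). W *\<^sub>v (query_op d (anc A) U b *\<^sub>v v))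
       (hd (Vs A) *\<^sub>v unit_vec (qdim d A) 0) (zip (tl (Vs A)) (qs A))"

definition lq_norm :: "ereal \<Rightarrow> nat \<Rightarrow> (nat \<Rightarrow> complex) \<Rightarrow> real" where
  "lq_norm q d x = (if q = \<infinity> then Max (insert 0 ((\<lambda>j. cmod (x j)) ` {..<d}))
     else (\<Sum>j<d. cmod (x j) powr real_of_ereal q) powr (1 / real_of_ereal q))"

definition amps :: "nat \<Rightarrow> complex mat \<Rightarrow> nat \<Rightarrow> complex" where
  "amps d U j = (U *\<^sub>v unit_vec d 0) $ j"

definition success_prob :: "nat \<Rightarrow> ereal \<Rightarrow> real \<Rightarrow> qalg \<Rightarrow> complex mat \<Rightarrow> real" where
  "success_prob d q \<epsilon> A U =
     (\<Sum>i<qdim d A. if lq_norm q d (\<lambda>j. amps d U j - out A i j) \<le> \<epsilon>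
                    then (cmod (final_state d A U $ i))\<^sup>2 else 0)"

definition inv_q :: "ereal \<Rightarrow> real" where
  "inv_q q = (if q = \<infinity> then 0 else 1 / real_of_ereal q)"

(* min{(3/eps)^(1/(1/2-1/q)), d^(1/2+1/q)/eps} * log(d/delta); at q = 2 the first term is \<infinity> *)
definition query_bound :: "ereal \<Rightarrow> nat \<Rightarrow> real \<Rightarrow> real \<Rightarrow> real" where
  "query_bound q d \<epsilon> \<delta> =
     (if q = 2 then real d powr (1/2 + inv_q q) / \<epsilon>
      else min ((3 / \<epsilon>) powr (1 / (1/2 - inv_q q))) (real d powr (1/2 + inv_q q) / \<epsilon>))
     * ln (real d / \<delta>)"

end

theory Submission
  imports Defs "Jordan_Normal_Form.Determinant" "HOL-Probability.Hoeffding"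
begin

text \<open>
  Let \<open>\<alpha>\<close> be the unknown amplitude vector and \<open>a\<close> a known unit vector with \<open>\<parallel>a - \<alpha>\<parallel>\<^sub>\<infinity> \<le> s\<close>, so that
  \<open>\<parallel>a - \<alpha>\<parallel>\<^sub>2 \<le> s\<surd>d\<close>. A single controlled query turns \<open>(|0\<rangle>a + |1\<rangle>e\<^sub>0)/\<surd>2\<close> into \<open>(|0\<rangle>a + |1\<rangle>\<alpha>)/\<surd>2\<close>,
  whose component in which the control qubit is \<open>|-\<rangle>\<close> is \<open>(a - \<alpha>)/2\<close>; with \<open>k\<close> rounds of amplitude
  amplification it is multiplied by about \<open>2k + 1\<close>, as long as \<open>k s\<surd>d\<close> is small. In superposition with
  a reference amplitude the state is measured in a Fourier basis: every coordinate of the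
  amplified difference is then the mean of a bounded function of the outcome, so by Hoeffding
  \<open>O(ln (d/\<delta>)/t\<^sup>2)\<close> samples determine all coordinates up to \<open>t\<close>. Taking \<open>k \<approx> 1/(s\<surd>d)\<close> and \<open>t \<approx> 1/\<surd>d\<close>
  halves \<open>s\<close> at the cost of \<open>O(\<surd>d/s ln (d/\<delta>))\<close> queries; these costs form a geometric series, and accuracy
  \<open>s\<close> in the supremum norm costs \<open>O(min {1/s\<^sup>2, \<surd>d/s} ln (d/\<delta>))\<close>, where the first term is sampling
  without amplification. The \<open>\<ell>\<^sub>q\<close>-norm is controlled by the supremum norm, either directly
  or by interpolation with the \<open>\<ell>\<^sub>2\<close>-norm.
\<close>

unbundle no vec_syntax
hide_type (open) Finite_Cartesian_Product.vec
hide_const (open) Finite_Cartesian_Product.vec Finite_Cartesian_Product.mat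

section \<open>Unitary matrices\<close>

text \<open>The model admits one fixed circuit with a single final measurement, while the refinement
  is adaptive: each round reflects about a vector computed from earlier outcomes. Measurements are
  therefore deferred. Running one algorithm after another swaps the used query register into a
  record, and the second circuit depends on that record block by block. Its outcome distribution is
  the bind of the two distributions, so the analysis can take place in the \<open>pmf\<close> monad.
  Keeping a single logarithm is the second difficulty. All rounds must succeed, and an even split of
  \<delta> among them would cost the logarithm of their number. Instead the last round may fail with
  probability \<delta>/2, the one before it with \<delta>/4, and so on backwards: early rounds have
  the strictest budgets but are cheaper by powers of two, and the sum stays of order ln
  (4d/\<delta>). The third is a uniform constant: ln (d/\<delta>) has no positive lower bound for d
  = 1 and \<delta> near 1, and this corner has an argument of its own.\<close>

lemma mult_mat_index_sum:
  assumes "A \<in> carrier_mat n m" "B \<in> carrier_mat m k" "i < n" "j < k"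
  shows "(A * B) $$ (i,j) = (\<Sum>l<m. A $$ (i,l) * B $$ (l,j))"
  using assms by (auto simp: scalar_prod_def lessThan_atLeast0 intro!: sum.cong)

lemma mult_mat_vec_index_sum:
  assumes "A \<in> carrier_mat n m" "v \<in> carrier_vec m" "i < n"
  shows "(A *\<^sub>v v) $ i = (\<Sum>l<m. A $$ (i,l) * v $ l)"
  using assms by (auto simp: scalar_prod_def lessThan_atLeast0 intro!: sum.cong)

lemma cadj_carrier [simp]: "A \<in> carrier_mat n m \<Longrightarrow> cadj A \<in> carrier_mat m n"
  by (auto simp: cadj_def)

lemma cadj_dims [simp]: "dim_row (cadj A) = dim_col A" "dim_col (cadj A) = dim_row A"
  by (simp_all add: cadj_def)

lemma cadj_index [simp]:
  "A \<in> carrier_mat n m \<Longrightarrow> i < m \<Longrightarrow> j < n \<Longrightarrow> cadj A $$ (i,j) = cnj (A $$ (j,i))"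
  by (auto simp: cadj_def)

lemma cadj_cadj: "cadj (cadj A) = A"
  by (rule eq_matI) (auto simp: cadj_def)

lemma unitary_mat_carrier: "unitary_mat n U \<Longrightarrow> U \<in> carrier_mat n n"
  by (simp add: unitary_mat_def)

lemma unitary_mat_cadj: "unitary_mat n U \<Longrightarrow> unitary_mat n (cadj U)"
  by (auto simp: unitary_mat_def cadj_cadj)

lemma unitary_mat_one: "unitary_mat n (1\<^sub>m n)"
proof -
  have "cadj (1\<^sub>m n) = 1\<^sub>m n" by (rule eq_matI) (auto simp: cadj_def)
  then show ?thesis by (simp add: unitary_mat_def)
qed

text \<open>A left inverse of a square matrix is also a right inverse, so orthonormal columns are
  enough. The permutation, reflection, Fourier, block-diagonal and controlled matrices all pass
  through this criterion.\<close>

lemma unitary_matI: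
  assumes "A \<in> carrier_mat n n"
    and "\<And>i j. i < n \<Longrightarrow> j < n \<Longrightarrow> (\<Sum>k<n. cnj (A $$ (k,i)) * A $$ (k,j)) = (if i = j then 1 else 0)"
  shows "unitary_mat n A"
proof -
  have c: "cadj A \<in> carrier_mat n n" using assms(1) by simp
  have 1: "cadj A * A = 1\<^sub>m n"
  proof (rule eq_matI)
    fix i j assume "i < dim_row (1\<^sub>m n :: complex mat)" "j < dim_col (1\<^sub>m n :: complex mat)"
    then have ij: "i < n" "j < n" by auto
    have "(cadj A * A) $$ (i,j) = (\<Sum>l<n. cadj A $$ (i,l) * A $$ (l,j))"
      by (rule mult_mat_index_sum[OF c assms(1) ij])
    also have "\<dots> = (\<Sum>l<n. cnj (A $$ (l,i)) * A $$ (l,j))"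
      using assms(1) ij by (intro sum.cong) auto
    also have "\<dots> = (if i = j then 1 else 0)" using assms(2) ij by simp
    finally show "(cadj A * A) $$ (i,j) = 1\<^sub>m n $$ (i,j)" using ij by simp
  qed (use assms(1) c in auto)
  then show ?thesis
    using mat_mult_left_right_inverse[OF c assms(1) 1] assms(1) by (simp add: unitary_mat_def)
qed

lemma unitary_mat_columns:
  assumes "unitary_mat n A" "i < n" "j < n"
  shows "(\<Sum>k<n. cnj (A $$ (k,i)) * A $$ (k,j)) = (if i = j then 1 else 0)"
proof -
  have A: "A \<in> carrier_mat n n" using assms(1) by (rule unitary_mat_carrier)
  have "(\<Sum>k<n. cnj (A $$ (k,i)) * A $$ (k,j)) = (\<Sum>k<n. cadj A $$ (i,k) * A $$ (k,j))"
    using A assms by (intro sum.cong) auto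
  also have "\<dots> = (cadj A * A) $$ (i,j)"
    using mult_mat_index_sum[OF cadj_carrier[OF A] A assms(2,3)] by simp
  also have "\<dots> = (if i = j then 1 else 0)" using assms by (simp add: unitary_mat_def)
  finally show ?thesis .
qed

lemma unitary_mat_mult:
  assumes "unitary_mat n A" "unitary_mat n B"
  shows "unitary_mat n (A * B)"
proof -
  have c: "A \<in> carrier_mat n n" "B \<in> carrier_mat n n" "cadj A \<in> carrier_mat n n" "cadj B \<in> carrier_mat n n"
    using assms by (auto simp: unitary_mat_def)
  have adj: "cadj (A * B) = cadj B * cadj A"
  proof (rule eq_matI)
    fix i j assume "i < dim_row (cadj B * cadj A)" "j < dim_col (cadj B * cadj A)"
    then have ij: "i < n" "j < n" using c by auto
    have AB: "A * B \<in> carrier_mat n n" using c by simp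
    have "cadj (A * B) $$ (i,j) = cnj (\<Sum>l<n. A $$ (j,l) * B $$ (l,i))"
      using cadj_index[OF AB ij] mult_mat_index_sum[OF c(1,2) ij(2,1)] by simp
    also have "\<dots> = (\<Sum>l<n. cadj B $$ (i,l) * cadj A $$ (l,j))"
      using c ij by (auto simp: cnj_sum mult.commute intro!: sum.cong)
    also have "\<dots> = (cadj B * cadj A) $$ (i,j)"
      using mult_mat_index_sum[OF c(4,3) ij] by simp
    finally show "cadj (A * B) $$ (i,j) = (cadj B * cadj A) $$ (i,j)" .
  qed (use c in auto)
  have "cadj B * cadj A * (A * B) = cadj B * (cadj A * (A * B))"
    by (rule assoc_mult_mat[OF c(4) c(3)]) (use c in auto)
  also have "cadj A * (A * B) = cadj A * A * B"
    by (rule assoc_mult_mat[OF c(3) c(1) c(2), symmetric])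
  also have "cadj B * (cadj A * A * B) = 1\<^sub>m n" using assms c by (simp add: unitary_mat_def)
  finally have 1: "cadj (A * B) * (A * B) = 1\<^sub>m n" using adj by simp
  have "A * B * (cadj B * cadj A) = A * (B * (cadj B * cadj A))"
    by (rule assoc_mult_mat[OF c(1) c(2)]) (use c in auto)
  also have "B * (cadj B * cadj A) = B * cadj B * cadj A"
    by (rule assoc_mult_mat[OF c(2) c(4) c(3), symmetric])
  also have "A * (B * cadj B * cadj A) = 1\<^sub>m n" using assms c by (simp add: unitary_mat_def)
  finally have 2: "A * B * cadj (A * B) = 1\<^sub>m n" using adj by simp
  show ?thesis using 1 2 c by (simp add: unitary_mat_def)
qed

lemma unitary_mat_norm:
  assumes "unitary_mat n A" "v \<in> carrier_vec n"
  shows "(\<Sum>i<n. (cmod ((A *\<^sub>v v) $ i))\<^sup>2) = (\<Sum>i<n. (cmod (v $ i))\<^sup>2)"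
proof -
  have A: "A \<in> carrier_mat n n" using assms(1) by (rule unitary_mat_carrier)
  have "complex_of_real (\<Sum>i<n. (cmod ((A *\<^sub>v v) $ i))\<^sup>2)
      = (\<Sum>i<n. cnj (\<Sum>k<n. A $$ (i,k) * v $ k) * (\<Sum>l<n. A $$ (i,l) * v $ l))"
    using mult_mat_vec_index_sum[OF A assms(2)]
    by (auto simp: complex_norm_square mult.commute intro!: sum.cong simp del: of_real_power)
  also have "\<dots> = (\<Sum>i<n. \<Sum>k<n. \<Sum>l<n. cnj (v $ k) * v $ l * (cnj (A $$ (i,k)) * A $$ (i,l)))"
    unfolding cnj_sum sum_product by (intro sum.cong refl) simp
  also have "\<dots> = (\<Sum>k<n. \<Sum>l<n. cnj (v $ k) * v $ l * (\<Sum>i<n. cnj (A $$ (i,k)) * A $$ (i,l)))"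
    unfolding sum_distrib_left
    by (rule trans[OF sum.swap], rule sum.cong[OF refl], rule sum.swap)
  also have "\<dots> = (\<Sum>k<n. \<Sum>l<n. if k = l then cnj (v $ k) * v $ l else 0)"
    using unitary_mat_columns[OF assms(1)] by (intro sum.cong refl) auto
  also have "\<dots> = (\<Sum>k<n. cnj (v $ k) * v $ k)" by simp
  also have "\<dots> = complex_of_real (\<Sum>i<n. (cmod (v $ i))\<^sup>2)"
    by (auto simp: complex_norm_square mult.commute intro!: sum.cong simp del: of_real_power)
  finally show ?thesis using of_real_eq_iff by blast
qed

section \<open>Permutation, reflection and Fourier matrices\<close>

definition perm_mat :: "nat \<Rightarrow> (nat \<Rightarrow> nat) \<Rightarrow> complex mat" where
  "perm_mat n \<sigma> = mat n n (\<lambda>(i,j). if j = \<sigma> i then 1 else 0)"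

lemma perm_mat_mult_vec:
  assumes "v \<in> carrier_vec n" "i < n" "\<sigma> i < n"
  shows "(perm_mat n \<sigma> *\<^sub>v v) $ i = v $ \<sigma> i"
proof -
  have "(perm_mat n \<sigma> *\<^sub>v v) $ i = (\<Sum>l<n. (if l = \<sigma> i then 1 else 0) * v $ l)"
    using assms by (subst mult_mat_vec_index_sum[of _ n n]) (auto simp: perm_mat_def)
  also have "\<dots> = (\<Sum>l<n. if l = \<sigma> i then v $ l else 0)" by (intro sum.cong) auto
  finally show ?thesis using assms(3) by simp
qed

lemma unitary_perm_mat:
  assumes "\<And>i. i < n \<Longrightarrow> \<sigma> i < n" "\<And>i. i < n \<Longrightarrow> \<sigma> (\<sigma> i) = i"
  shows "unitary_mat n (perm_mat n \<sigma>)"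
proof (rule unitary_matI)
  fix i j assume ij: "i < n" "j < n"
  have eq: "(i = \<sigma> k) = (k = \<sigma> i)" if "k < n" for k using assms that ij by metis
  have "(\<Sum>k<n. cnj (perm_mat n \<sigma> $$ (k,i)) * perm_mat n \<sigma> $$ (k,j))
     = (\<Sum>k<n. if k = \<sigma> i then (if j = \<sigma> k then 1 else 0) else 0)"
    using ij by (intro sum.cong) (auto simp: perm_mat_def eq)
  also have "\<dots> = (if i = j then 1 else 0)" using assms ij by auto
  finally show "(\<Sum>k<n. cnj (perm_mat n \<sigma> $$ (k,i)) * perm_mat n \<sigma> $$ (k,j)) = (if i = j then 1 else 0)" .
qed (simp add: perm_mat_def)

text \<open>The reflection \<open>2 |w><w| / <w|w> - I\<close> about the line of \<open>w\<close>.
  Dividing by the squared norm spares the callers a normalisation, which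
  \<open>refl_mat_prepares\<close> exploits.\<close>

definition refl_mat :: "nat \<Rightarrow> (nat \<Rightarrow> complex) \<Rightarrow> complex mat" where
  "refl_mat n w = mat n n (\<lambda>(i,j). 2 * w i * cnj (w j) / (\<Sum>k<n. w k * cnj (w k)) - (if i = j then 1 else 0))"

lemma refl_mat_mult_vec:
  assumes "v \<in> carrier_vec n" "i < n"
  shows "(refl_mat n w *\<^sub>v v) $ i
    = 2 * w i * (\<Sum>l<n. cnj (w l) * v $ l) / (\<Sum>k<n. w k * cnj (w k)) - v $ i"
proof -
  let ?S = "\<Sum>k<n. w k * cnj (w k)"
  have "(refl_mat n w *\<^sub>v v) $ i = (\<Sum>l<n. (2 * w i * cnj (w l) / ?S - (if i = l then 1 else 0)) * v $ l)"
    using assms by (subst mult_mat_vec_index_sum[of _ n n]) (auto simp: refl_mat_def)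
  also have "\<dots> = (\<Sum>l<n. 2 * w i / ?S * (cnj (w l) * v $ l) - (if i = l then v $ l else 0))"
    by (intro sum.cong) (auto simp: algebra_simps)
  also have "\<dots> = 2 * w i / ?S * (\<Sum>l<n. cnj (w l) * v $ l) - v $ i"
    using assms by (simp add: sum_subtractf sum_distrib_left)
  finally show ?thesis by (simp add: field_simps)
qed

lemma unitary_refl_mat:
  assumes "\<exists>k<n. w k \<noteq> 0"
  shows "unitary_mat n (refl_mat n w)"
proof (rule unitary_matI)
  define S where "S = (\<Sum>k<n. w k * cnj (w k))"
  have S: "S = complex_of_real (\<Sum>k<n. (cmod (w k))\<^sup>2)"
    by (simp add: S_def complex_norm_square del: of_real_power)
  have "(\<Sum>k<n. (cmod (w k))\<^sup>2) \<noteq> 0" using assms by (subst sum_nonneg_eq_0_iff) auto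
  then have S0: "S \<noteq> 0" unfolding S of_real_eq_0_iff .
  have cS: "cnj S = S" by (simp add: S_def cnj_sum mult.commute)
  fix i j assume ij: "i < n" "j < n"
  have "(\<Sum>k<n. cnj (refl_mat n w $$ (k,i)) * refl_mat n w $$ (k,j))
     = (\<Sum>k<n. (2 * cnj (w k) * w i / S - (if k = i then 1 else 0)) * (2 * w k * cnj (w j) / S - (if k = j then 1 else 0)))"
    using ij by (intro sum.cong refl) (auto simp: refl_mat_def cS S_def[symmetric])
  also have "\<dots> = (\<Sum>k<n. 4 * w i * cnj (w j) / S^2 * (w k * cnj (w k))
      - (if k = i then 2 * w k * cnj (w j) / S else 0) - (if k = j then 2 * cnj (w k) * w i / S else 0)
      + (if k = i then (if i = j then 1 else 0) else 0))"
    by (intro sum.cong refl) (auto simp: algebra_simps power2_eq_square)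
  also have "\<dots> = 4 * w i * cnj (w j) / S^2 * S - 2 * w i * cnj (w j) / S - 2 * cnj (w j) * w i / S
      + (if i = j then 1 else 0)"
    unfolding sum.distrib sum_subtractf sum_distrib_left[symmetric] S_def[symmetric] using ij by simp
  also have "\<dots> = (if i = j then 1 else 0)"
    using S0 by (simp add: power2_eq_square field_simps)
  finally show "(\<Sum>k<n. cnj (refl_mat n w $$ (k,i)) * refl_mat n w $$ (k,j)) = (if i = j then 1 else 0)" .
qed (simp add: refl_mat_def)

definition root1 :: "nat \<Rightarrow> nat \<Rightarrow> complex" where
  "root1 n k = cis (2 * pi * real k / real n)"

definition dft_mat :: "nat \<Rightarrow> complex mat" where
  "dft_mat n = mat n n (\<lambda>(i,j). root1 n (i * j) / sqrt n)"

lemma root1_add: "root1 n (j + k) = root1 n j * root1 n k"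
  by (simp add: root1_def cis_mult add_divide_distrib distrib_left)

lemma root1_mult: "root1 n (j * k) = root1 n j ^ k"
  by (simp add: root1_def Complex.DeMoivre mult_ac)

lemma norm_root1 [simp]: "cmod (root1 n k) = 1"
  by (simp add: root1_def)

lemma root1_cnj: "root1 n k * cnj (root1 n k) = 1"
  by (simp add: complex_norm_square[symmetric])

lemma root1_eq_iff:
  assumes "0 < n"
  shows "root1 n j = root1 n k \<longleftrightarrow> j mod n = k mod n"
proof -
  have "root1 n i = exp (2 * of_real pi * \<i> * of_nat i / of_nat n)" for i
    unfolding root1_def cis_conv_exp by (simp add: mult_ac)
  then show ?thesis
    using complex_root_unity_eq[of n j k] assms by (simp add: cong_def)
qed

text \<open>Orthogonality of the characters of the cyclic group of order \<open>n\<close>: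
  \<open>z\<close> is the root of unity attached to the difference of \<open>j\<close> and
  \<open>k\<close>, and the geometric sum of its powers vanishes unless
  \<open>z = 1\<close>.\<close>

lemma sum_root1:
  assumes "0 < n"
  shows "(\<Sum>m<n. root1 n (m * j) * cnj (root1 n (m * k))) = (if j mod n = k mod n then of_nat n else 0)"
proof -
  define z where "z = root1 n j * cnj (root1 n k)"
  have nn: "root1 n (n * j) = 1" for j
    using root1_eq_iff[OF assms, of "n * j" 0] by (simp add: root1_def)
  have zn: "z ^ n = 1"
  proof -
    have "z ^ n = root1 n (j * n) * cnj (root1 n (k * n))"
      by (simp add: z_def power_mult_distrib root1_mult)
    then show ?thesis using nn by (simp add: mult.commute)
  qed
  have z1: "z = 1 \<longleftrightarrow> root1 n j = root1 n k"
    using root1_cnj[of n k] by (metis z_def mult.commute mult_cancel_right2 mult.assoc mult.left_neutral mult.right_neutral)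
  have "(\<Sum>m<n. root1 n (m * j) * cnj (root1 n (m * k))) = (\<Sum>m<n. z ^ m)"
    by (intro sum.cong) (simp_all add: z_def power_mult_distrib root1_mult mult.commute[of _ j] mult.commute[of _ k])
  also have "\<dots> = (if z = 1 then of_nat n else 0)"
    using zn by (auto simp: sum_gp_strict)
  finally show ?thesis using z1 root1_eq_iff[OF assms] by simp
qed

lemma unitary_dft_mat:
  assumes "0 < n" shows "unitary_mat n (dft_mat n)"
proof (rule unitary_matI)
  fix i j assume ij: "i < n" "j < n"
  have ss: "complex_of_real (sqrt n) * complex_of_real (sqrt n) = of_nat n"
    by (simp flip: of_real_mult)
  have "(\<Sum>k<n. cnj (dft_mat n $$ (k,i)) * dft_mat n $$ (k,j)) = (\<Sum>k<n. root1 n (k * j) * cnj (root1 n (k * i)) / of_nat n)"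
    using ij by (intro sum.cong) (auto simp: dft_mat_def ss mult.commute)
  also have "\<dots> = (if j mod n = i mod n then of_nat n else 0) / of_nat n"
    by (simp add: sum_divide_distrib[symmetric] sum_root1[OF assms])
  finally show "(\<Sum>k<n. cnj (dft_mat n $$ (k,i)) * dft_mat n $$ (k,j)) = (if i = j then 1 else 0)"
    using ij assms by simp
qed (simp add: dft_mat_def)

section \<open>Block-diagonal operators\<close>

text \<open>
  \<open>\<kappa> p\<close> and \<open>\<iota> p\<close> are the two coordinates of the basis label \<open>p\<close> in a factorisation
  \<open>\<complex>\<^sup>N = \<complex>\<^sup>n \<otimes> \<complex>\<^sup>m\<close>; \<open>bdiag\<close> acts by \<open>V i\<close> on the copy of \<open>\<complex>\<^sup>n\<close> labelled \<open>i\<close>.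
\<close>

definition split_index :: "nat \<Rightarrow> nat \<Rightarrow> nat \<Rightarrow> (nat \<Rightarrow> nat) \<Rightarrow> (nat \<Rightarrow> nat) \<Rightarrow> bool" where
  "split_index N n m \<kappa> \<iota> \<longleftrightarrow> bij_betw (\<lambda>p. (\<kappa> p, \<iota> p)) {..<N} ({..<n} \<times> {..<m})"

definition bdiag :: "nat \<Rightarrow> (nat \<Rightarrow> nat) \<Rightarrow> (nat \<Rightarrow> nat) \<Rightarrow> (nat \<Rightarrow> complex mat) \<Rightarrow> complex mat" where
  "bdiag N \<kappa> \<iota> V = mat N N (\<lambda>(p,p'). if \<iota> p = \<iota> p' then V (\<iota> p) $$ (\<kappa> p, \<kappa> p') else 0)"

definition bvec :: "nat \<Rightarrow> (nat \<Rightarrow> nat) \<Rightarrow> (nat \<Rightarrow> nat) \<Rightarrow> (nat \<Rightarrow> complex vec) \<Rightarrow> complex vec" where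
  "bvec N \<kappa> \<iota> g = vec N (\<lambda>p. g (\<iota> p) $ \<kappa> p)"

lemma split_index_bounds:
  assumes "split_index N n m \<kappa> \<iota>" "p < N"
  shows "\<kappa> p < n" "\<iota> p < m"
  using assms by (auto simp: split_index_def bij_betw_def)

lemma split_index_inj:
  assumes "split_index N n m \<kappa> \<iota>" "p < N" "p' < N" "\<kappa> p = \<kappa> p'" "\<iota> p = \<iota> p'"
  shows "p = p'"
  using assms by (auto simp: split_index_def bij_betw_def inj_on_def)

lemma split_index_sum:
  fixes f :: "nat \<Rightarrow> nat \<Rightarrow> 'a::comm_monoid_add"
  assumes "split_index N n m \<kappa> \<iota>"
  shows "(\<Sum>p<N. f (\<kappa> p) (\<iota> p)) = (\<Sum>i<m. \<Sum>k<n. f k i)"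
proof -
  have "(\<Sum>p<N. f (\<kappa> p) (\<iota> p)) = (\<Sum>x\<in>{..<n}\<times>{..<m}. f (fst x) (snd x))"
    using sum.reindex_bij_betw[OF assms[unfolded split_index_def], of "\<lambda>x. f (fst x) (snd x)"] by simp
  also have "\<dots> = (\<Sum>k<n. \<Sum>i<m. f k i)" by (simp add: sum.cartesian_product case_prod_beta)
  finally show ?thesis by (subst sum.swap)
qed

lemma split_index_fiber_sum:
  fixes f :: "nat \<Rightarrow> 'a::comm_monoid_add"
  assumes "split_index N n m \<kappa> \<iota>" "i < m"
  shows "(\<Sum>p<N. if i = \<iota> p then f (\<kappa> p) else 0) = (\<Sum>k<n. f k)"
proof -
  have "(\<Sum>p<N. if i = \<iota> p then f (\<kappa> p) else 0) = (\<Sum>j<m. \<Sum>k<n. if i = j then f k else 0)"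
    by (rule split_index_sum[OF assms(1), of "\<lambda>k j. if i = j then f k else 0"])
  also have "\<dots> = (\<Sum>j<m. if i = j then (\<Sum>k<n. f k) else 0)" by (intro sum.cong) auto
  finally show ?thesis using assms(2) by simp
qed

lemma bdiag_carrier [simp]: "bdiag N \<kappa> \<iota> V \<in> carrier_mat N N"
  by (simp add: bdiag_def)

lemma bvec_carrier [simp]: "bvec N \<kappa> \<iota> g \<in> carrier_vec N"
  by (simp add: bvec_def)

lemma bvec_index [simp]: "p < N \<Longrightarrow> bvec N \<kappa> \<iota> g $ p = g (\<iota> p) $ \<kappa> p"
  by (simp add: bvec_def)

lemma bdiag_mult_bvec:
  assumes s: "split_index N n m \<kappa> \<iota>"
    and V: "\<And>i. i < m \<Longrightarrow> V i \<in> carrier_mat n n" and g: "\<And>i. i < m \<Longrightarrow> g i \<in> carrier_vec n"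
  shows "bdiag N \<kappa> \<iota> V *\<^sub>v bvec N \<kappa> \<iota> g = bvec N \<kappa> \<iota> (\<lambda>i. V i *\<^sub>v g i)"
proof (rule eq_vecI)
  fix p assume "p < dim_vec (bvec N \<kappa> \<iota> (\<lambda>i. V i *\<^sub>v g i))"
  then have p: "p < N" by (simp add: bvec_def)
  note b = split_index_bounds[OF s p]
  have "(bdiag N \<kappa> \<iota> V *\<^sub>v bvec N \<kappa> \<iota> g) $ p
      = (\<Sum>p'<N. if \<iota> p = \<iota> p' then V (\<iota> p) $$ (\<kappa> p, \<kappa> p') * g (\<iota> p) $ \<kappa> p' else 0)"
    using p by (subst mult_mat_vec_index_sum[of _ N N]) (auto simp: bdiag_def intro!: sum.cong)
  also have "\<dots> = (\<Sum>k<n. V (\<iota> p) $$ (\<kappa> p, k) * g (\<iota> p) $ k)"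
    by (rule split_index_fiber_sum[OF s b(2)])
  also have "\<dots> = (V (\<iota> p) *\<^sub>v g (\<iota> p)) $ \<kappa> p"
    using mult_mat_vec_index_sum[OF V[OF b(2)] g[OF b(2)] b(1)] by simp
  finally show "(bdiag N \<kappa> \<iota> V *\<^sub>v bvec N \<kappa> \<iota> g) $ p = bvec N \<kappa> \<iota> (\<lambda>i. V i *\<^sub>v g i) $ p"
    using p by simp
qed (simp add: bvec_def bdiag_def)

lemma unitary_bdiag:
  assumes s: "split_index N n m \<kappa> \<iota>" and V: "\<And>i. i < m \<Longrightarrow> unitary_mat n (V i)"
  shows "unitary_mat N (bdiag N \<kappa> \<iota> V)"
proof (rule unitary_matI)
  fix p q assume pq: "p < N" "q < N"
  note b = split_index_bounds[OF s pq(1)] split_index_bounds[OF s pq(2)]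
  have "(\<Sum>k<N. cnj (bdiag N \<kappa> \<iota> V $$ (k,p)) * bdiag N \<kappa> \<iota> V $$ (k,q))
     = (\<Sum>k<N. if \<iota> p = \<iota> k then (if \<iota> p = \<iota> q then cnj (V (\<iota> p) $$ (\<kappa> k, \<kappa> p)) * V (\<iota> p) $$ (\<kappa> k, \<kappa> q) else 0) else 0)"
    using pq by (intro sum.cong) (auto simp: bdiag_def)
  also have "\<dots> = (\<Sum>k<n. if \<iota> p = \<iota> q then cnj (V (\<iota> p) $$ (k, \<kappa> p)) * V (\<iota> p) $$ (k, \<kappa> q) else 0)"
    by (rule split_index_fiber_sum[OF s b(2)])
  also have "\<dots> = (if \<iota> p = \<iota> q then (if \<kappa> p = \<kappa> q then 1 else 0) else 0)"
  proof (cases "\<iota> p = \<iota> q")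
    case True
    show ?thesis unfolding if_P[OF True] by (rule unitary_mat_columns[OF V[OF b(2)] b(1) b(3)])
  qed simp
  also have "\<dots> = (if p = q then 1 else 0)" using split_index_inj[OF s pq] by auto
  finally show "(\<Sum>k<N. cnj (bdiag N \<kappa> \<iota> V $$ (k,p)) * bdiag N \<kappa> \<iota> V $$ (k,q)) = (if p = q then 1 else 0)" .
qed (simp add: bdiag_def)

section \<open>Controlled unitaries and queries as block-diagonal operators\<close>

lemma ctrl_carrier [simp]: "ctrl d U \<in> carrier_mat (2*d) (2*d)"
  by (simp add: ctrl_def)

lemma split_sum_double:
  fixes f :: "nat \<Rightarrow> 'a::comm_monoid_add"
  shows "(\<Sum>i<2*n. f i) = (\<Sum>i<n. f i) + (\<Sum>i<n. f (n + i))"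
proof -
  have "{..<2*n} = {..<n} \<union> (+) n ` {..<n}"
    by (auto simp: image_iff) (metis add_diff_inverse_nat less_diff_conv2 mult_2 not_less add.commute lessThan_iff)
  moreover have "{..<n} \<inter> (+) n ` {..<n} = {}" by auto
  ultimately have "sum f {..<2*n} = sum f {..<n} + sum f ((+) n ` {..<n})"
    by (simp add: sum.union_disjoint)
  then show ?thesis by (simp add: sum.reindex)
qed

lemma unitary_ctrl:
  assumes "unitary_mat d U"
  shows "unitary_mat (2*d) (ctrl d U)"
proof (rule unitary_matI)
  have U: "U \<in> carrier_mat d d" using assms by (rule unitary_mat_carrier)
  fix i j assume ij: "i < 2*d" "j < 2*d"
  have c: "(i - d = j - d) = (i = j)" if "d \<le> i" "d \<le> j" using that by auto
  have "(\<Sum>k<2*d. cnj (ctrl d U $$ (k,i)) * ctrl d U $$ (k,j))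
      = (\<Sum>k<d. if i = k then (if i = j then 1 else 0) else 0)
        + (\<Sum>k<d. if d \<le> i \<and> d \<le> j then cnj (U $$ (k,i-d)) * U $$ (k,j-d) else 0)"
    unfolding split_sum_double using ij by (intro arg_cong2[where f = "(+)"] sum.cong) (auto simp: ctrl_def)
  also have "\<dots> = (if i = j then 1 else 0)"
  proof (cases "d \<le> i \<and> d \<le> j")
    case True
    then show ?thesis using ij unitary_mat_columns[OF assms, of "i-d" "j-d"] c by auto
  next
    case False
    then have "i = j \<Longrightarrow> i < d" by auto
    then show ?thesis using False by auto
  qed
  finally show "(\<Sum>k<2*d. cnj (ctrl d U $$ (k,i)) * ctrl d U $$ (k,j)) = (if i = j then 1 else 0)" .
qed simp

lemma query_op_carrier [simp]: "query_op d m U b \<in> carrier_mat (2*d*m) (2*d*m)"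
  by (auto simp: query_op_def kron_def ctrl_def)

lemma query_op_index:
  assumes "p < 2*d*m" "q < 2*d*m"
  shows "query_op d m U b $$ (p,q)
    = (if p mod m = q mod m then ctrl d (if b then U else cadj U) $$ (p div m, q div m) else 0)"
proof -
  have "0 < m" using assms by (cases m) auto
  then show ?thesis using assms
    by (auto simp: query_op_def kron_def less_mult_imp_div_less ctrl_def)
qed

lemma query_op_bdiag:
  assumes s: "split_index (2*d*m) (2*d*a) c \<kappa> \<iota>"
    and 1: "\<And>p. p < 2*d*m \<Longrightarrow> \<kappa> p div a = p div m"
    and 2: "\<And>p q. p < 2*d*m \<Longrightarrow> q < 2*d*m \<Longrightarrow> p mod m = q mod m \<longleftrightarrow> \<iota> p = \<iota> q \<and> \<kappa> p mod a = \<kappa> q mod a"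
  shows "query_op d m U b = bdiag (2*d*m) \<kappa> \<iota> (\<lambda>_. query_op d a U b)"
proof (rule eq_matI)
  fix p q assume "p < dim_row (bdiag (2*d*m) \<kappa> \<iota> (\<lambda>_. query_op d a U b))"
    "q < dim_col (bdiag (2*d*m) \<kappa> \<iota> (\<lambda>_. query_op d a U b))"
  then have pq: "p < 2*d*m" "q < 2*d*m" by (auto simp: bdiag_def)
  note b = split_index_bounds(1)[OF s pq(1)] split_index_bounds(1)[OF s pq(2)]
  show "query_op d m U b $$ (p,q) = bdiag (2*d*m) \<kappa> \<iota> (\<lambda>_. query_op d a U b) $$ (p,q)"
    using pq by (simp add: query_op_index[OF pq] query_op_index[OF b] bdiag_def 1 2)
qed (auto simp: bdiag_def query_op_def kron_def ctrl_def)

lemma mult_add_less: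
  fixes k :: nat assumes "k < n" "i < m" shows "k * m + i < n * m"
proof -
  have "k * m + i < (k + 1) * m" using assms by simp
  also have "\<dots> \<le> n * m" using assms(1) by (intro mult_right_mono) auto
  finally show ?thesis .
qed

lemma div_mod_split_index:
  "split_index (n * m) n m (\<lambda>p. p div m) (\<lambda>p. p mod m)"
proof (cases "m = 0")
  case False
  show ?thesis unfolding split_index_def
  proof (rule bij_betw_byWitness[where f' = "\<lambda>(k,i). k * m + i"])
    show "\<forall>x\<in>{..<n} \<times> {..<m}. (((case x of (k, i) \<Rightarrow> k * m + i) div m), (case x of (k, i) \<Rightarrow> k * m + i) mod m) = x"
      by auto
    show "(\<lambda>p. (p div m, p mod m)) ` {..<n * m} \<subseteq> {..<n} \<times> {..<m}"
      using False by (auto simp: less_mult_imp_div_less)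
    show "(\<lambda>(k, i). k * m + i) ` ({..<n} \<times> {..<m}) \<subseteq> {..<n * m}"
      by (auto intro: mult_add_less)
  qed auto
qed (simp add: split_index_def bij_betw_def)

text \<open>The label \<open>(e c + y) a + z\<close>, with \<open>z < a\<close> and \<open>y < c\<close>, is split into \<open>(e a + z, y)\<close>.\<close>

lemma middle_split_index:
  assumes "0 < a" "0 < c"
  shows "split_index (n * (c * a)) (n * a) c (\<lambda>p. p div (c * a) * a + p mod a) (\<lambda>p. p div a mod c)"
  unfolding split_index_def
proof (rule bij_betw_byWitness[where f' = "\<lambda>(k,y). (k div a * c + y) * a + k mod a"])
  show "\<forall>p\<in>{..<n * (c * a)}. (case (p div (c * a) * a + p mod a, p div a mod c) of (k, y) \<Rightarrow> (k div a * c + y) * a + k mod a) = p"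
  proof clarsimp
    fix p
    have "p div (c * a) = p div a div c" by (simp add: div_mult2_eq mult.commute)
    then have "p div (c * a) * c + p div a mod c = p div a" by simp
    then show "(((p div (c * a) * a + p mod a) div a) * c + p div a mod c) * a + p mod a = p"
      using assms by simp
  qed
  show "\<forall>x\<in>{..<n * a} \<times> {..<c}. ((case x of (k, y) \<Rightarrow> (k div a * c + y) * a + k mod a) div (c * a) * a + (case x of (k, y) \<Rightarrow> (k div a * c + y) * a + k mod a) mod a,
      (case x of (k, y) \<Rightarrow> (k div a * c + y) * a + k mod a) div a mod c) = x"
  proof clarsimp
    fix k y assume y: "y < c"
    let ?p = "(k div a * c + y) * a + k mod a"
    have 1: "?p div a = k div a * c + y" using assms by simp
    have "?p div (c * a) = ?p div a div c" by (simp add: div_mult2_eq mult.commute)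
    also have "\<dots> = k div a" unfolding 1 using y by simp
    finally show "?p div (c * a) * a + k mod a = k \<and> ?p div a mod c = y"
      unfolding 1 using y by simp
  qed
  show "(\<lambda>p. (p div (c * a) * a + p mod a, p div a mod c)) ` {..<n * (c * a)} \<subseteq> {..<n * a} \<times> {..<c}"
    using assms by (auto simp: less_mult_imp_div_less intro!: mult_add_less)
  show "(\<lambda>(k, y). (k div a * c + y) * a + k mod a) ` ({..<n * a} \<times> {..<c}) \<subseteq> {..<n * (c * a)}"
  proof clarsimp
    fix k y assume "k < n * a" "y < c"
    then have "(k div a * c + y) * a + k mod a < n * c * a"
      using assms by (intro mult_add_less) (auto simp: less_mult_imp_div_less)
    then show "(k div a * c + y) * a + k mod a < n * (c * a)" by (simp add: mult.assoc)
  qed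
qed

lemma query_op_div_mod:
  assumes "0 < a" "0 < c"
  shows "query_op d (a * c) U b = bdiag (2*d*(a*c)) (\<lambda>p. p div c) (\<lambda>p. p mod c) (\<lambda>_. query_op d a U b)"
proof (rule query_op_bdiag)
  show "split_index (2*d*(a*c)) (2*d*a) c (\<lambda>p. p div c) (\<lambda>p. p mod c)"
    using div_mod_split_index[of "2*d*a" c] by (simp add: mult.assoc)
  show "p div c div a = p div (a * c)" for p
    using div_mult2_eq[of p c a] by (simp add: mult.commute)
  have m: "p mod (a * c) = (p div c mod a) * c + p mod c" for p
    using mod_mult2_eq[of p c a] by (simp add: mult.commute)
  show "p mod (a * c) = q mod (a * c) \<longleftrightarrow> p mod c = q mod c \<and> p div c mod a = q div c mod a" for p q
  proof
    assume *: "p mod (a * c) = q mod (a * c)"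
    have "p mod c = q mod c" "p div c mod a = q div c mod a"
      using arg_cong[OF *, of "\<lambda>x. x mod c"] arg_cong[OF *, of "\<lambda>x. x div c"] assms unfolding m by auto
    then show "p mod c = q mod c \<and> p div c mod a = q div c mod a" by simp
  qed (simp add: m)
qed

lemma query_op_middle:
  assumes "0 < a" "0 < c"
  shows "query_op d (c * a) U b
    = bdiag (2*d*(c*a)) (\<lambda>p. p div (c * a) * a + p mod a) (\<lambda>p. p div a mod c) (\<lambda>_. query_op d a U b)"
proof (rule query_op_bdiag)
  show "split_index (2*d*(c*a)) (2*d*a) c (\<lambda>p. p div (c * a) * a + p mod a) (\<lambda>p. p div a mod c)"
    by (rule middle_split_index[OF assms])
  show "(p div (c * a) * a + p mod a) div a = p div (c * a)" for p using assms by simp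
  have m: "p mod (c * a) = (p div a mod c) * a + p mod a" for p
    using mod_mult2_eq[of p a c] by (simp add: mult.commute)
  show "p mod (c * a) = q mod (c * a) \<longleftrightarrow> p div a mod c = q div a mod c \<and>
      (p div (c * a) * a + p mod a) mod a = (q div (c * a) * a + q mod a) mod a" for p q
  proof
    assume *: "p mod (c * a) = q mod (c * a)"
    have "p mod a = q mod a" "p div a mod c = q div a mod c"
      using arg_cong[OF *, of "\<lambda>x. x mod a"] arg_cong[OF *, of "\<lambda>x. x div a"] assms unfolding m by auto
    then show "p div a mod c = q div a mod c \<and>
      (p div (c * a) * a + p mod a) mod a = (q div (c * a) * a + q mod a) mod a" by simp
  qed (simp add: m)
qed

lemma mult_add_div_mod:
  fixes i n k :: nat assumes "i < n" shows "(k * n + i) div n = k" "(k * n + i) mod n = i"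
  using assms by auto

section \<open>Sequential composition of query algorithms\<close>

text \<open>The fold in \<open>final_state\<close> with start vector and list of steps left free, so
  that runs can be cut in two and started from the components of a superposition.\<close>

definition alg_run :: "nat \<Rightarrow> nat \<Rightarrow> complex mat \<Rightarrow> complex Matrix.vec \<Rightarrow> (complex mat \<times> bool) list \<Rightarrow> complex Matrix.vec" where
  "alg_run d m U = foldl (\<lambda>v (W, b). W *\<^sub>v (query_op d m U b *\<^sub>v v))"

lemma final_state_alg_run:
  "final_state d A U = alg_run d (anc A) U (hd (Vs A) *\<^sub>v unit_vec (qdim d A) 0) (zip (tl (Vs A)) (qs A))"
  by (simp add: final_state_def alg_run_def)

lemma alg_run_carrier:
  assumes "v \<in> carrier_vec (2*d*m)" "\<forall>x\<in>set l. fst x \<in> carrier_mat (2*d*m) (2*d*m)"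
  shows "alg_run d m U v l \<in> carrier_vec (2*d*m)"
  using assms
proof (induction l arbitrary: v)
  case (Cons x l)
  obtain W b where x: "x = (W, b)" by force
  have W: "W \<in> carrier_mat (2*d*m) (2*d*m)" using Cons.prems(2) x by simp
  have "W *\<^sub>v (query_op d m U b *\<^sub>v v) \<in> carrier_vec (2*d*m)"
    using mult_mat_vec_carrier[OF W mult_mat_vec_carrier[OF query_op_carrier Cons.prems(1)]] .
  from Cons.IH[OF this] Cons.prems(2) show ?case by (simp add: alg_run_def x)
qed (simp add: alg_run_def)

lemma alg_run_smult:
  assumes "v \<in> carrier_vec (2*d*m)" "\<forall>x\<in>set l. fst x \<in> carrier_mat (2*d*m) (2*d*m)"
  shows "alg_run d m U (c \<cdot>\<^sub>v v) l = c \<cdot>\<^sub>v alg_run d m U v l"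
  using assms
proof (induction l arbitrary: v)
  case (Cons x l)
  obtain W b where x: "x = (W, b)" by force
  have W: "W \<in> carrier_mat (2*d*m) (2*d*m)" using Cons.prems(2) x by simp
  have q: "query_op d m U b *\<^sub>v v \<in> carrier_vec (2*d*m)"
    using mult_mat_vec_carrier[OF query_op_carrier Cons.prems(1)] .
  have "W *\<^sub>v (query_op d m U b *\<^sub>v v) \<in> carrier_vec (2*d*m)"
    using mult_mat_vec_carrier[OF W q] .
  from Cons.IH[OF this] Cons.prems(2) show ?case
    by (simp add: alg_run_def x mult_mat_vec[OF query_op_carrier Cons.prems(1)] mult_mat_vec[OF W q])
qed (simp add: alg_run_def)

lemma bvec_cong:
  assumes "split_index N n m \<kappa> \<iota>" "\<And>i. i < m \<Longrightarrow> f i = g i"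
  shows "bvec N \<kappa> \<iota> f = bvec N \<kappa> \<iota> g"
  using split_index_bounds(2)[OF assms(1)] assms(2) by (intro eq_vecI) (auto simp: bvec_def)

text \<open>Queries and interleaved unitaries respect the same splitting, so the copies evolve
  separately. The unitaries \<open>F i\<close> may differ from copy to copy while the query pattern
  \<open>ql\<close> is common; in this way a circuit branches on a recorded outcome without
  measuring it.\<close>

lemma alg_run_bdiag:
  assumes s: "split_index (2*d*M) (2*d*a) m \<kappa> \<iota>"
    and q: "\<And>b. query_op d M U b = bdiag (2*d*M) \<kappa> \<iota> (\<lambda>_. query_op d a U b)"
    and l: "length Fs = length ql"
    and F: "\<And>F i. F \<in> set Fs \<Longrightarrow> i < m \<Longrightarrow> F i \<in> carrier_mat (2*d*a) (2*d*a)"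
    and g: "\<And>i. i < m \<Longrightarrow> g i \<in> carrier_vec (2*d*a)"
  shows "alg_run d M U (bvec (2*d*M) \<kappa> \<iota> g) (zip (map (bdiag (2*d*M) \<kappa> \<iota>) Fs) ql)
    = bvec (2*d*M) \<kappa> \<iota> (\<lambda>i. alg_run d a U (g i) (zip (map (\<lambda>F. F i) Fs) ql))"
  using l F g
proof (induction Fs ql arbitrary: g rule: list_induct2)
  case (Cons F Fs b ql)
  have F: "\<And>i. i < m \<Longrightarrow> F i \<in> carrier_mat (2*d*a) (2*d*a)" using Cons.prems(1) by simp
  have c: "\<And>i. i < m \<Longrightarrow> query_op d a U b *\<^sub>v g i \<in> carrier_vec (2*d*a)"
    using mult_mat_vec_carrier[OF query_op_carrier Cons.prems(2)] .
  have "bdiag (2*d*M) \<kappa> \<iota> F *\<^sub>v (query_op d M U b *\<^sub>v bvec (2*d*M) \<kappa> \<iota> g)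
      = bvec (2*d*M) \<kappa> \<iota> (\<lambda>i. F i *\<^sub>v (query_op d a U b *\<^sub>v g i))"
    unfolding q by (simp add: bdiag_mult_bvec[OF s] Cons.prems(2) c F)
  moreover have "\<And>i. i < m \<Longrightarrow> F i *\<^sub>v (query_op d a U b *\<^sub>v g i) \<in> carrier_vec (2*d*a)"
    using mult_mat_vec_carrier[OF F c] .
  ultimately show ?case
    using Cons.IH[of "\<lambda>i. F i *\<^sub>v (query_op d a U b *\<^sub>v g i)"] Cons.prems(1)
    by (simp add: alg_run_def)
qed (simp add: alg_run_def)

lemma unitary_query_op:
  assumes "unitary_mat d U"
  shows "unitary_mat (2*d*m) (query_op d m U b)"
proof -
  let ?X = "if b then U else cadj U"
  have "query_op d m U b = bdiag (2*d*m) (\<lambda>p. p div m) (\<lambda>p. p mod m) (\<lambda>_. ctrl d ?X)"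
    by (rule eq_matI) (simp_all add: query_op_index bdiag_def carrier_matD[OF query_op_carrier])
  moreover have "unitary_mat d ?X" using assms unitary_mat_cadj by simp
  ultimately show ?thesis
    using unitary_bdiag[OF div_mod_split_index[of "2*d" m], of "\<lambda>_. ctrl d ?X"] unitary_ctrl by simp
qed

lemma alg_run_norm:
  assumes "v \<in> carrier_vec (2*d*m)" "unitary_mat d U" "\<forall>x\<in>set l. unitary_mat (2*d*m) (fst x)"
  shows "(\<Sum>i<2*d*m. (cmod (alg_run d m U v l $ i))\<^sup>2) = (\<Sum>i<2*d*m. (cmod (v $ i))\<^sup>2)"
  using assms
proof (induction l arbitrary: v)
  case (Cons x l)
  obtain W b where x: "x = (W, b)" by force
  have W: "unitary_mat (2*d*m) W" using Cons.prems(3) x by simp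
  have q: "query_op d m U b *\<^sub>v v \<in> carrier_vec (2*d*m)"
    using mult_mat_vec_carrier[OF query_op_carrier Cons.prems(1)] .
  have w: "W *\<^sub>v (query_op d m U b *\<^sub>v v) \<in> carrier_vec (2*d*m)"
    using mult_mat_vec_carrier[OF unitary_mat_carrier[OF W] q] .
  have "(\<Sum>i<2*d*m. (cmod (alg_run d m U v (x # l) $ i))\<^sup>2)
      = (\<Sum>i<2*d*m. (cmod ((W *\<^sub>v (query_op d m U b *\<^sub>v v)) $ i))\<^sup>2)"
    using Cons.IH[OF w assms(2)] Cons.prems(3) by (simp add: alg_run_def x)
  also have "\<dots> = (\<Sum>i<2*d*m. (cmod (v $ i))\<^sup>2)"
    using unitary_mat_norm[OF W q] unitary_mat_norm[OF unitary_query_op[OF assms(2)] Cons.prems(1)] by simp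
  finally show ?case .
qed (simp add: alg_run_def)

section \<open>Validity, normalisation and outcome distributions\<close>

lemma valid_qalgD:
  assumes "valid_qalg d A"
  shows "hd (Vs A) \<in> set (Vs A)" "length (tl (Vs A)) = length (qs A)" "Vs A = hd (Vs A) # tl (Vs A)"
    "\<And>W. W \<in> set (Vs A) \<Longrightarrow> unitary_mat (2*d*anc A) W" "0 < anc A"
    "\<forall>x\<in>set (zip (tl (Vs A)) (qs A)). unitary_mat (2*d*anc A) (fst x)"
    "\<forall>x\<in>set (zip (tl (Vs A)) (qs A)). fst x \<in> carrier_mat (2*d*anc A) (2*d*anc A)"
proof -
  have l: "length (Vs A) = length (qs A) + 1" using assms by (simp add: valid_qalg_def)
  then have ne: "Vs A \<noteq> []" by auto
  then show 1: "hd (Vs A) \<in> set (Vs A)" "length (tl (Vs A)) = length (qs A)" "Vs A = hd (Vs A) # tl (Vs A)"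
    using l by auto
  show 2: "\<And>W. W \<in> set (Vs A) \<Longrightarrow> unitary_mat (2*d*anc A) W" "0 < anc A"
    using assms by (auto simp: valid_qalg_def qdim_def)
  show 3: "\<forall>x\<in>set (zip (tl (Vs A)) (qs A)). unitary_mat (2*d*anc A) (fst x)"
    using 2(1) ne by (metis list.set_sel(2) set_zip_leftD prod.collapse)
  show "\<forall>x\<in>set (zip (tl (Vs A)) (qs A)). fst x \<in> carrier_mat (2*d*anc A) (2*d*anc A)"
    using unitary_mat_carrier 3 by blast
qed

lemma final_state_carrier:
  assumes "valid_qalg d A"
  shows "final_state d A U \<in> carrier_vec (2*d*anc A)"
  unfolding final_state_alg_run
  by (rule alg_run_carrier[OF mult_mat_vec_carrier[OF unitary_mat_carrier[OF valid_qalgD(4)[OF assms valid_qalgD(1)[OF assms]]]]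
        valid_qalgD(7)[OF assms]]) (auto simp: qdim_def)

lemma final_state_norm:
  assumes "valid_qalg d A" "unitary_mat d U" "0 < d"
  shows "(\<Sum>i<2*d*anc A. (cmod (final_state d A U $ i))\<^sup>2) = 1"
proof -
  note V = valid_qalgD[OF assms(1)]
  have h: "unitary_mat (2*d*anc A) (hd (Vs A))" using V(4)[OF V(1)] .
  have u: "unit_vec (qdim d A) 0 \<in> carrier_vec (2*d*anc A)" by (simp add: qdim_def)
  have "(\<Sum>i<2*d*anc A. (cmod (final_state d A U $ i))\<^sup>2) = (\<Sum>i<2*d*anc A. (cmod (unit_vec (qdim d A) 0 $ i))\<^sup>2)"
    unfolding final_state_alg_run
    by (subst alg_run_norm[OF mult_mat_vec_carrier[OF unitary_mat_carrier[OF h] u] assms(2) V(6)])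
      (auto simp: unitary_mat_norm[OF h u])
  also have "\<dots> = (\<Sum>i<2*d*anc A. if i = 0 then 1 else 0)"
    by (intro sum.cong) (auto simp: qdim_def unit_vec_def)
  finally show ?thesis using V(5) assms(3) by simp
qed

text \<open>As a \<open>pmf\<close> the measured label can be fed into the probability monad. That
  the weights add up to \<open>1\<close> rests on the unitarity of all steps, hence the hypotheses
  of \<open>pmf_outcome_pmf\<close>.\<close>

definition outcome_pmf :: "nat \<Rightarrow> qalg \<Rightarrow> complex mat \<Rightarrow> nat pmf" where
  "outcome_pmf d A U = embed_pmf (\<lambda>i. if i < qdim d A then (cmod (final_state d A U $ i))\<^sup>2 else 0)"

lemma pmf_outcome_pmf:
  assumes "valid_qalg d A" "unitary_mat d U" "0 < d"
  shows "pmf (outcome_pmf d A U) i = (if i < 2*d*anc A then (cmod (final_state d A U $ i))\<^sup>2 else 0)"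
proof -
  let ?f = "\<lambda>i. if i < qdim d A then (cmod (final_state d A U $ i))\<^sup>2 else 0"
  have "(\<integral>\<^sup>+ x. ennreal (?f x) \<partial>count_space UNIV) = (\<Sum>i<qdim d A. ennreal (?f i))"
    by (rule nn_integral_count_space'[where A = "{..<qdim d A}"]) auto
  also have "\<dots> = ennreal (\<Sum>i<qdim d A. ?f i)" by (rule sum_ennreal) auto
  also have "\<dots> = 1" using final_state_norm[OF assms] by (simp add: qdim_def)
  finally show ?thesis unfolding outcome_pmf_def
    by (subst pmf_embed_pmf) (auto simp: qdim_def)
qed

lemma set_outcome_pmf:
  assumes "valid_qalg d A" "unitary_mat d U" "0 < d"
  shows "set_pmf (outcome_pmf d A U) \<subseteq> {..<2*d*anc A}"
  using pmf_outcome_pmf[OF assms] by (auto simp: set_pmf_iff split: if_splits)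

lemma success_prob_outcome_pmf:
  assumes "valid_qalg d A" "unitary_mat d U" "0 < d"
  shows "success_prob d q \<epsilon> A U
    = measure_pmf.prob (outcome_pmf d A U) {i. lq_norm q d (\<lambda>j. amps d U j - out A i j) \<le> \<epsilon>}"
proof -
  let ?G = "{i. lq_norm q d (\<lambda>j. amps d U j - out A i j) \<le> \<epsilon>}"
  have "measure_pmf.prob (outcome_pmf d A U) ?G = measure_pmf.prob (outcome_pmf d A U) (?G \<inter> {..<2*d*anc A})"
    using set_outcome_pmf[OF assms] by (intro measure_prob_cong_0) (auto simp: set_pmf_iff)
  also have "\<dots> = (\<Sum>i\<in>?G \<inter> {..<2*d*anc A}. pmf (outcome_pmf d A U) i)"
    by (rule measure_measure_pmf_finite) simp
  also have "\<dots> = (\<Sum>i\<in>{..<2*d*anc A}. if i \<in> ?G then pmf (outcome_pmf d A U) i else 0)"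
    by (subst sum.inter_restrict[symmetric]) (auto simp: Int_commute)
  also have "\<dots> = success_prob d q \<epsilon> A U"
    unfolding success_prob_def by (auto simp: qdim_def pmf_outcome_pmf[OF assms] intro!: sum.cong)
  finally show ?thesis by simp
qed

text \<open>
  The label \<open>((e b + y) D + e') a + z\<close> lists the digits of the query register \<open>e\<close>, the fresh
  ancilla \<open>y\<close>, the record \<open>e'\<close> and the old ancilla \<open>z\<close>; \<open>swap_digits\<close> exchanges \<open>e\<close> and \<open>e'\<close>.
\<close>

definition swap_digits :: "nat \<Rightarrow> nat \<Rightarrow> nat \<Rightarrow> nat \<Rightarrow> nat" where
  "swap_digits D a b p = (((p div a mod D) * b + p div (D * a) mod b) * D + p div (b * (D * a))) * a + p mod a"

lemma swap_digits_encode: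
  assumes "y < b" "e' < D" "z < a"
  shows "swap_digits D a b (((e * b + y) * D + e') * a + z) = ((e' * b + y) * D + e) * a + z"
proof -
  let ?p = "((e * b + y) * D + e') * a + z"
  have 1: "?p div a = (e * b + y) * D + e'" "?p mod a = z" using assms by auto
  have 2: "?p div (D * a) = e * b + y"
    using div_mult2_eq[of ?p a D] 1 assms by (simp add: mult.commute)
  have 3: "?p div (b * (D * a)) = e"
    using div_mult2_eq[of ?p "D * a" b] 2 assms by (simp add: mult.commute)
  show ?thesis unfolding swap_digits_def 1 2 3 using assms by simp
qed

lemma digits_exist:
  fixes p D a b :: nat
  assumes "p < D * (b * (D * a))"
  obtains e y e' z where "e < D" "y < b" "e' < D" "z < a" "p = ((e * b + y) * D + e') * a + z"
proof (rule that[of "p div a div D div b" "p div a div D mod b" "p div a mod D" "p mod a"])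
  have "D * (b * (D * a)) \<noteq> 0" using assms by linarith
  then have pos: "0 < D" "0 < b" "0 < a" by auto
  show "p div a mod D < D" "p mod a < a" "p div a div D mod b < b" using pos by auto
  have "p < D * b * D * a" using assms by (simp add: mult.assoc)
  then show "p div a div D div b < D" by (intro less_mult_imp_div_less)
  show "p = ((p div a div D div b * b + p div a div D mod b) * D + p div a mod D) * a + p mod a" by simp
qed

lemma swap_digits_bounds:
  assumes "p < D * (b * (D * a))"
  shows "swap_digits D a b p < D * (b * (D * a))" "swap_digits D a b (swap_digits D a b p) = p"
proof -
  from digits_exist[OF assms] obtain e y e' z
    where p: "e < D" "y < b" "e' < D" "z < a" "p = ((e * b + y) * D + e') * a + z" .
  have "((e' * b + y) * D + e) * a + z < D * b * D * a"
    using p by (intro mult_add_less)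
  then show "swap_digits D a b p < D * (b * (D * a))"
    unfolding p(5) swap_digits_encode[OF p(2,3,4)] by (simp add: mult.assoc)
  show "swap_digits D a b (swap_digits D a b p) = p"
    unfolding p(5) swap_digits_encode[OF p(2,3,4)] swap_digits_encode[OF p(2,1,4)] ..
qed

text \<open>Seen through the swap, a state with \<open>y = e' = 0\<close> becomes a state with
  \<open>e = y = 0\<close> whose digits \<open>(e', z)\<close> hold the old label. The two tests
  agree because \<open>y * D + e\<close> and \<open>e * b + y\<close> vanish together, namely when
  both digits do.\<close>

lemma swap_digits_record:
  assumes "f \<in> carrier_vec (D * a)" "p < D * (b * (D * a))"
  shows "(let s = swap_digits D a b p in
       if s div a mod (b * D) = 0 then f $ (s div (b * D * a) * a + s mod a) else 0)
    = (if p div (D * a) = 0 then f $ (p mod (D * a)) else 0)"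
proof -
  from digits_exist[OF assms(2)] obtain e y e' z
    where p: "e < D" "y < b" "e' < D" "z < a" "p = ((e * b + y) * D + e') * a + z" .
  let ?s = "((e' * b + y) * D + e) * a + z"
  have 1: "?s div a = (e' * b + y) * D + e" "?s mod a = z" using p by auto
  have s1: "?s div a = e' * (b * D) + (y * D + e)" unfolding 1 by (simp add: algebra_simps)
  have yl: "y * D + e < b * D" using p by (intro mult_add_less)
  have 2: "?s div a mod (b * D) = y * D + e" unfolding s1 using yl by simp
  have 3: "?s div (b * D * a) = e'"
  proof -
    have "?s div (b * D * a) = ?s div a div (b * D)"
      using div_mult2_eq[of ?s a "b * D"] by (simp add: mult.commute)
    moreover have "0 < b" "0 < D" using p by auto
    ultimately show ?thesis unfolding s1 using yl by simp
  qed
  have p1: "p = (e * b + y) * (D * a) + (e' * a + z)" unfolding p(5) by (simp add: algebra_simps)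
  have zl: "e' * a + z < D * a" using p by (intro mult_add_less)
  have 4: "p div (D * a) = e * b + y" "p mod (D * a) = e' * a + z" unfolding p1 using zl p by auto
  have 5: "y * D + e = 0 \<longleftrightarrow> e * b + y = 0" using p by auto
  show ?thesis
    unfolding Let_def p(5) swap_digits_encode[OF p(2,3,4)] unfolding p(5)[symmetric]
    unfolding 2 3 4 1(2) 5 ..
qed


text \<open>Deferred measurement: \<open>FA\<close> runs \<open>A\<close> on the digits
  \<open>(e, z)\<close>, the permutation moves the query register into the record, and block
  \<open>i\<close> of \<open>FB\<close> runs \<open>B i\<close> on \<open>(e, y)\<close>, where
  \<open>i\<close> is the label left behind in \<open>(e', z)\<close>. No query separates the end of
  \<open>A\<close> from the start of \<open>B i\<close>, so the adjacent unitaries and the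
  permutation are multiplied into one. Outputs are decoded elsewhere, so \<open>out\<close> is a
  placeholder.\<close>

definition seq_alg :: "nat \<Rightarrow> qalg \<Rightarrow> nat \<Rightarrow> bool list \<Rightarrow> (nat \<Rightarrow> qalg) \<Rightarrow> qalg" where
  "seq_alg d A b ql B = (let D = 2 * d; a = anc A; N = D * (b * (D * a));
     FA = map (\<lambda>V. bdiag N (\<lambda>p. p div (b * D * a) * a + p mod a) (\<lambda>p. p div a mod (b * D)) (\<lambda>_. V)) (Vs A);
     FB = map (\<lambda>t. bdiag N (\<lambda>p. p div (D * a)) (\<lambda>p. p mod (D * a)) (\<lambda>i. Vs (B i) ! t)) [0..<length ql + 1]
   in \<lparr>anc = b * (D * a),
       Vs = butlast FA @ [hd FB * (perm_mat N (swap_digits D a b) * last FA)] @ tl FB,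
       qs = qs A @ ql, out = \<lambda>_ _. 0\<rparr>)"

lemma alg_run_append: "alg_run d m U v (l @ l') = alg_run d m U (alg_run d m U v l) l'"
  by (simp add: alg_run_def)

lemma alg_run_last_mult:
  assumes "length L = length ql + 1" "\<forall>W\<in>set L. W \<in> carrier_mat (2*d*m) (2*d*m)"
    "X \<in> carrier_mat (2*d*m) (2*d*m)" "v \<in> carrier_vec (2*d*m)"
  shows "alg_run d m U (hd (butlast L @ [X * last L]) *\<^sub>v v) (zip (tl (butlast L @ [X * last L])) ql)
    = X *\<^sub>v alg_run d m U (hd L *\<^sub>v v) (zip (tl L) ql)"
proof (cases ql rule: rev_cases)
  case Nil
  then obtain W where "L = [W]" using assms(1) by (cases L) auto
  then show ?thesis using assms Nil by (simp add: alg_run_def assoc_mult_mat_vec)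
next
  case (snoc ql' q)
  from assms(1) snoc obtain V0 L' W where L: "L = V0 # L' @ [W]" "length L' = length ql'"
    by (cases L; cases "tl L" rule: rev_cases) auto
  have c: "V0 *\<^sub>v v \<in> carrier_vec (2*d*m)"
    using assms L by (intro mult_mat_vec_carrier[of _ _ "2*d*m"]) auto
  have "alg_run d m U (V0 *\<^sub>v v) (zip L' ql') \<in> carrier_vec (2*d*m)"
    using assms(2) L by (intro alg_run_carrier[OF c]) (auto dest: set_zip_leftD)
  then have "query_op d m U q *\<^sub>v alg_run d m U (V0 *\<^sub>v v) (zip L' ql') \<in> carrier_vec (2*d*m)"
    using mult_mat_vec_carrier[OF query_op_carrier] by blast
  then show ?thesis using assms L snoc
    by (simp add: alg_run_append butlast_append) (simp add: alg_run_def assoc_mult_mat_vec[of X "2*d*m" "2*d*m" W "2*d*m"])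
qed

context
  fixes d b :: nat and A :: qalg and ql :: "bool list" and B :: "nat \<Rightarrow> qalg"
  assumes d: "0 < d" and A: "valid_qalg d A"
    and B: "\<And>i. valid_qalg d (B i)" "\<And>i. anc (B i) = b" "\<And>i. qs (B i) = ql"
begin

private definition "a = anc A"
private definition "D = 2 * d"
private definition "N = D * (b * (D * a))"
private definition "\<kappa>A = (\<lambda>p. p div (b * D * a) * a + p mod a)"
private definition "\<iota>A = (\<lambda>p. p div a mod (b * D))"
private definition "\<kappa>B = (\<lambda>p. p div (D * a))"
private definition "\<iota>B = (\<lambda>p. p mod (D * a))"
private definition "FA = map (\<lambda>V. bdiag N \<kappa>A \<iota>A (\<lambda>_. V)) (Vs A)"
private definition "FB = map (\<lambda>t. bdiag N \<kappa>B \<iota>B (\<lambda>i. Vs (B i) ! t)) [0..<length ql + 1]"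
private definition "P = perm_mat N (swap_digits D a b)"

private lemma seq_alg_unfold:
  "seq_alg d A b ql B = \<lparr>anc = b * (D * a), Vs = butlast FA @ [hd FB * (P * last FA)] @ tl FB,
     qs = qs A @ ql, out = \<lambda>_ _. 0\<rparr>"
  by (simp add: seq_alg_def Let_def a_def D_def N_def \<kappa>A_def \<iota>A_def \<kappa>B_def \<iota>B_def FA_def FB_def P_def)

private lemma pos: "0 < a" "0 < b" "0 < D"
  using valid_qalgD(5)[OF A] valid_qalgD(5)[OF B(1)[of 0]] B(2) d by (auto simp: a_def D_def)

private lemma sA: "split_index N (D * a) (b * D) \<kappa>A \<iota>A"
  using middle_split_index[of a "b * D" D] pos by (simp add: N_def \<kappa>A_def \<iota>A_def mult.assoc)

private lemma sB: "split_index N (D * b) (D * a) \<kappa>B \<iota>B"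
  using div_mod_split_index[of "D * b" "D * a"] by (simp add: N_def \<kappa>B_def \<iota>B_def mult.assoc)

private lemma qA: "query_op d (b * (D * a)) U c = bdiag N \<kappa>A \<iota>A (\<lambda>_. query_op d a U c)"
  using query_op_middle[of a "b * D" d U c] pos by (simp add: N_def \<kappa>A_def \<iota>A_def D_def mult.assoc)

private lemma qB: "query_op d (b * (D * a)) U c = bdiag N \<kappa>B \<iota>B (\<lambda>_. query_op d b U c)"
  using query_op_div_mod[of b "D * a" d U c] pos by (simp add: N_def \<kappa>B_def \<iota>B_def D_def mult.assoc)

private lemma VsA: "length (Vs A) = length (qs A) + 1" "\<And>V. V \<in> set (Vs A) \<Longrightarrow> unitary_mat (D * a) V"
  using A by (auto simp: valid_qalg_def D_def a_def qdim_def)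

private lemma VsB: "length (Vs (B i)) = length ql + 1"
  "\<And>V. V \<in> set (Vs (B i)) \<Longrightarrow> unitary_mat (D * b) V"
  using B(1)[of i] B(2,3)[of i] by (auto simp: valid_qalg_def D_def qdim_def)

private lemma uFA: "W \<in> set FA \<Longrightarrow> unitary_mat N W"
  using unitary_bdiag[OF sA] VsA(2) by (auto simp: FA_def)

private lemma uFB: "W \<in> set FB \<Longrightarrow> unitary_mat N W"
  unfolding FB_def using VsB(1) by (auto intro!: unitary_bdiag[OF sB] VsB(2) nth_mem)

private lemma uP: "unitary_mat N P"
  unfolding P_def using swap_digits_bounds by (intro unitary_perm_mat) (auto simp: N_def)

private lemma lens: "length FA = length (qs A) + 1" "FA \<noteq> []" "length FB = length ql + 1" "FB \<noteq> []"
  using VsA(1) by (auto simp: FA_def FB_def)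

lemma seq_alg_valid: "valid_qalg d (seq_alg d A b ql B)"
proof -
  have 1: "set (butlast FA) \<subseteq> set FA" by (auto dest: in_set_butlastD)
  have 2: "set (tl FB) \<subseteq> set FB" using lens(4) by (simp add: list.set_sel(2) subsetI)
  have "unitary_mat N (hd FB * (P * last FA))"
    using uFA uFB uP lens by (intro unitary_mat_mult) auto
  then show ?thesis using pos lens uFA uFB 1 2
    unfolding valid_qalg_def seq_alg_unfold qdim_def by (auto simp: N_def D_def)
qed

lemma seq_alg_anc: "anc (seq_alg d A b ql B) = b * (2 * d * anc A)"
  by (simp add: seq_alg_unfold a_def D_def)

lemma seq_alg_qs: "qs (seq_alg d A b ql B) = qs A @ ql"
  by (simp add: seq_alg_unfold)

private lemma runA:
  "alg_run d (b * (D * a)) U (hd FA *\<^sub>v unit_vec N 0) (zip (tl FA) (qs A))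
    = bvec N \<kappa>A \<iota>A (\<lambda>i. (if i = 0 then 1 else 0) \<cdot>\<^sub>v final_state d A U)"
proof -
  note V = valid_qalgD[OF A, folded a_def D_def]
  have h: "hd (Vs A) \<in> carrier_mat (D * a) (D * a)" using unitary_mat_carrier[OF VsA(2)[OF V(1)]] .
  have NN: "2 * d * (b * (D * a)) = N" "2 * d * a = D * a" by (simp_all add: N_def D_def)
  have un: "unit_vec N 0 = bvec N \<kappa>A \<iota>A (\<lambda>i. (if i = 0 then 1 else 0) \<cdot>\<^sub>v unit_vec (D * a) 0)"
  proof (rule eq_vecI)
    fix p assume "p < dim_vec (bvec N \<kappa>A \<iota>A (\<lambda>i. (if i = 0 then 1 else 0) \<cdot>\<^sub>v unit_vec (D * a) 0 :: complex Matrix.vec))"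
    then have p: "p < N" by (simp add: bvec_def)
    then have N0: "0 < N" by simp
    have "\<kappa>A 0 = 0" "\<iota>A 0 = 0" by (auto simp: \<kappa>A_def \<iota>A_def)
    then have "p = 0 \<longleftrightarrow> \<kappa>A p = 0 \<and> \<iota>A p = 0"
      using split_index_inj[OF sA p N0] by auto
    then show "unit_vec N 0 $ p = bvec N \<kappa>A \<iota>A (\<lambda>i. (if i = 0 then 1 else 0) \<cdot>\<^sub>v unit_vec (D * a) 0) $ p"
      using p N0 split_index_bounds[OF sA p] pos by auto
  qed (simp add: bvec_def)
  have hFA: "hd FA = bdiag N \<kappa>A \<iota>A (\<lambda>_. hd (Vs A))"
    using lens(2) by (simp add: FA_def hd_map)
  have tFA: "tl FA = map (bdiag N \<kappa>A \<iota>A) (map (\<lambda>V _. V) (tl (Vs A)))"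
    by (simp add: FA_def map_tl o_def)
  have tlc: "\<forall>x\<in>set (zip (tl (Vs A)) (qs A)). fst x \<in> carrier_mat (2*d*a) (2*d*a)"
    using V(7) by (simp add: D_def)
  have tlc': "W \<in> carrier_mat (D * a) (D * a)" if "W \<in> set (tl (Vs A))" for W
    using that unitary_mat_carrier[OF VsA(2)] V(3) by (metis list.set_intros(2))
  have uc: "hd (Vs A) *\<^sub>v unit_vec (D * a) 0 \<in> carrier_vec (2*d*a)"
    using mult_mat_vec_carrier[OF h] by (simp add: D_def)
  have "hd FA *\<^sub>v unit_vec N 0 = bvec N \<kappa>A \<iota>A (\<lambda>i. (if i = 0 then 1 else 0) \<cdot>\<^sub>v (hd (Vs A) *\<^sub>v unit_vec (D * a) 0))"
    unfolding hFA un using h by (simp add: bdiag_mult_bvec[OF sA] mult_mat_vec[OF h])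
  then have "alg_run d (b * (D * a)) U (hd FA *\<^sub>v unit_vec N 0) (zip (tl FA) (qs A))
    = bvec N \<kappa>A \<iota>A (\<lambda>i. alg_run d a U ((if i = 0 then 1 else 0) \<cdot>\<^sub>v (hd (Vs A) *\<^sub>v unit_vec (D * a) 0))
        (zip (map (\<lambda>F. F i) (map (\<lambda>V _. V) (tl (Vs A)))) (qs A)))"
    unfolding tFA
    using alg_run_bdiag[of d "b * (D * a)" a "b * D" \<kappa>A \<iota>A U "map (\<lambda>V _. V) (tl (Vs A))" "qs A"
        "\<lambda>i. (if i = 0 then 1 else 0) \<cdot>\<^sub>v (hd (Vs A) *\<^sub>v unit_vec (D * a) 0)"] sA qA V(2) tlc' uc
    unfolding NN by auto
  also have "\<dots> = bvec N \<kappa>A \<iota>A (\<lambda>i. (if i = 0 then 1 else 0) \<cdot>\<^sub>v final_state d A U)"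
    using alg_run_smult[OF uc tlc]
    by (simp add: o_def final_state_alg_run a_def[symmetric] qdim_def D_def[symmetric])
  finally show ?thesis .
qed

private lemma swap_run:
  assumes f: "f \<in> carrier_vec (D * a)"
  shows "P *\<^sub>v bvec N \<kappa>A \<iota>A (\<lambda>i. (if i = 0 then 1 else 0) \<cdot>\<^sub>v f)
    = bvec N \<kappa>B \<iota>B (\<lambda>i. f $ i \<cdot>\<^sub>v unit_vec (D * b) 0)"
proof (rule eq_vecI)
  fix p assume "p < dim_vec (bvec N \<kappa>B \<iota>B (\<lambda>i. f $ i \<cdot>\<^sub>v unit_vec (D * b) 0))"
  then have p: "p < N" by (simp add: bvec_def)
  let ?s = "swap_digits D a b p"
  have s: "?s < N" using swap_digits_bounds p by (simp add: N_def)
  have "(P *\<^sub>v bvec N \<kappa>A \<iota>A (\<lambda>i. (if i = 0 then 1 else 0) \<cdot>\<^sub>v f)) $ p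
      = (if \<iota>A ?s = 0 then f $ \<kappa>A ?s else 0)"
    unfolding P_def using perm_mat_mult_vec[where \<sigma> = "swap_digits D a b", OF bvec_carrier p s] s f split_index_bounds[OF sA s] by simp
  also have "\<dots> = (if p div (D * a) = 0 then f $ (p mod (D * a)) else 0)"
    using swap_digits_record[OF f p[unfolded N_def]] unfolding \<iota>A_def \<kappa>A_def Let_def .
  also have "\<dots> = bvec N \<kappa>B \<iota>B (\<lambda>i. f $ i \<cdot>\<^sub>v unit_vec (D * b) 0) $ p"
    using p split_index_bounds[OF sB p] pos by (simp add: \<kappa>B_def \<iota>B_def)
  finally show "(P *\<^sub>v bvec N \<kappa>A \<iota>A (\<lambda>i. (if i = 0 then 1 else 0) \<cdot>\<^sub>v f)) $ p
      = bvec N \<kappa>B \<iota>B (\<lambda>i. f $ i \<cdot>\<^sub>v unit_vec (D * b) 0) $ p" .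
qed (simp add: bvec_def P_def perm_mat_def)

private lemma runB:
  "alg_run d (b * (D * a)) U (hd FB *\<^sub>v bvec N \<kappa>B \<iota>B (\<lambda>i. c i \<cdot>\<^sub>v unit_vec (D * b) 0)) (zip (tl FB) ql)
    = bvec N \<kappa>B \<iota>B (\<lambda>i. c i \<cdot>\<^sub>v final_state d (B i) U)"
proof -
  note V = valid_qalgD[OF B(1), unfolded B(2,3), folded D_def]
  have NN: "2 * d * (b * (D * a)) = N" "2 * d * b = D * b" by (simp_all add: N_def D_def)
  have h: "hd (Vs (B i)) \<in> carrier_mat (D * b) (D * b)" for i using unitary_mat_carrier[OF VsB(2)[OF V(1)]] .
  have uc: "hd (Vs (B i)) *\<^sub>v unit_vec (D * b) 0 \<in> carrier_vec (2*d*b)" for i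
    using mult_mat_vec_carrier[OF h] by (simp add: D_def)
  have hFB: "hd FB = bdiag N \<kappa>B \<iota>B (\<lambda>i. hd (Vs (B i)))"
    using V(3) by (simp add: FB_def hd_map hd_conv_nth del: upt_Suc) (metis hd_conv_nth list.distinct(1))
  have nth_tl': "Vs (B i) ! Suc t = tl (Vs (B i)) ! t" for i t using V(3)[of i] by (metis nth_Cons_Suc)
  have tFB: "tl FB = map (bdiag N \<kappa>B \<iota>B) (map (\<lambda>t i. tl (Vs (B i)) ! t) [0..<length ql])"
    by (rule nth_equalityI) (simp_all add: FB_def nth_tl nth_tl' del: upt_Suc)
  have tlc: "\<forall>x\<in>set (zip (tl (Vs (B i))) ql). fst x \<in> carrier_mat (2*d*b) (2*d*b)" for i
    using V(7) by (simp add: D_def)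
  have tlc': "W \<in> carrier_mat (D * b) (D * b)" if "W \<in> set (tl (Vs (B i)))" for W i
    using that unitary_mat_carrier[OF VsB(2)] V(3) by (metis list.set_intros(2))
  have tlF: "F i \<in> carrier_mat (D * b) (D * b)"
    if "F \<in> set (map (\<lambda>t i. tl (Vs (B i)) ! t) [0..<length ql])" for F i
    using that V(2)[of i] by (auto intro!: tlc' nth_mem)
  have uc': "c i \<cdot>\<^sub>v (hd (Vs (B i)) *\<^sub>v unit_vec (D * b) 0) \<in> carrier_vec (D * b)" for c i
    using uc[of i] unfolding NN by simp
  have zipB: "map (\<lambda>F. F i) (map (\<lambda>t i. tl (Vs (B i)) ! t) [0..<length ql]) = tl (Vs (B i))" for i
    using V(2)[of i] by (intro nth_equalityI) auto
  have "hd FB *\<^sub>v bvec N \<kappa>B \<iota>B (\<lambda>i. c i \<cdot>\<^sub>v unit_vec (D * b) 0)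
      = bvec N \<kappa>B \<iota>B (\<lambda>i. c i \<cdot>\<^sub>v (hd (Vs (B i)) *\<^sub>v unit_vec (D * b) 0))"
    unfolding hFB using h by (simp add: bdiag_mult_bvec[OF sB] mult_mat_vec[OF h])
  then have "alg_run d (b * (D * a)) U (hd FB *\<^sub>v bvec N \<kappa>B \<iota>B (\<lambda>i. c i \<cdot>\<^sub>v unit_vec (D * b) 0)) (zip (tl FB) ql)
    = alg_run d (b * (D * a)) U (bvec N \<kappa>B \<iota>B (\<lambda>i. c i \<cdot>\<^sub>v (hd (Vs (B i)) *\<^sub>v unit_vec (D * b) 0)))
        (zip (map (bdiag N \<kappa>B \<iota>B) (map (\<lambda>t i. tl (Vs (B i)) ! t) [0..<length ql])) ql)"
    unfolding tFB by simp
  also have "\<dots> = bvec N \<kappa>B \<iota>B (\<lambda>i. alg_run d b U (c i \<cdot>\<^sub>v (hd (Vs (B i)) *\<^sub>v unit_vec (D * b) 0))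
        (zip (map (\<lambda>F. F i) (map (\<lambda>t i. tl (Vs (B i)) ! t) [0..<length ql])) ql))"
    by (rule alg_run_bdiag[of d "b * (D * a)" b "D * a" \<kappa>B \<iota>B U "map (\<lambda>t i. tl (Vs (B i)) ! t) [0..<length ql]" ql
        "\<lambda>i. c i \<cdot>\<^sub>v (hd (Vs (B i)) *\<^sub>v unit_vec (D * b) 0)", unfolded NN, OF sB qB])
      (simp, rule tlF, assumption, rule uc')
  also have "\<dots> = bvec N \<kappa>B \<iota>B (\<lambda>i. c i \<cdot>\<^sub>v final_state d (B i) U)"
    unfolding zipB using alg_run_smult[OF uc tlc]
    by (simp add: final_state_alg_run B(2,3) qdim_def D_def[symmetric])
  finally show ?thesis .
qed

lemma seq_alg_final_state:
  assumes "p < 2 * d * (b * (2 * d * anc A))"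
  shows "final_state d (seq_alg d A b ql B) U $ p
    = final_state d A U $ (p mod (2 * d * anc A)) * final_state d (B (p mod (2 * d * anc A))) U $ (p div (2 * d * anc A))"
proof -
  let ?m = "b * (D * a)"
  have NN: "2 * d * ?m = N" by (simp add: N_def D_def)
  have cP: "P \<in> carrier_mat N N" using unitary_mat_carrier[OF uP] .
  have cA: "\<forall>W\<in>set FA. W \<in> carrier_mat N N" using unitary_mat_carrier uFA by blast
  have cB: "hd FB \<in> carrier_mat N N" using unitary_mat_carrier uFB lens(4) by auto
  have l: "last FA \<in> carrier_mat N N" using cA lens(2) by simp
  \<comment> \<open>Reassociated so that everything after \<open>last FA\<close> is a single left
    factor, as \<open>alg_run_last_mult\<close> expects.\<close>
  have X: "hd FB * (P * last FA) = (hd FB * P) * last FA"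
    using assoc_mult_mat[OF cB cP l] by simp
  let ?L = "butlast FA @ [(hd FB * P) * last FA]"
  have lL: "length (tl ?L) = length (qs A)" "?L \<noteq> []" using lens by auto
  have "final_state d (seq_alg d A b ql B) U
    = alg_run d ?m U (hd (?L @ tl FB) *\<^sub>v unit_vec N 0) (zip (tl (?L @ tl FB)) (qs A @ ql))"
    unfolding final_state_alg_run seq_alg_unfold X by (simp add: qdim_def N_def D_def)
  also have "\<dots> = alg_run d ?m U (alg_run d ?m U (hd ?L *\<^sub>v unit_vec N 0) (zip (tl ?L) (qs A))) (zip (tl FB) ql)"
    unfolding hd_append2[OF lL(2)] tl_append2[OF lL(2)] zip_append[OF lL(1)] alg_run_append ..
  also have "alg_run d ?m U (hd ?L *\<^sub>v unit_vec N 0) (zip (tl ?L) (qs A))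
    = (hd FB * P) *\<^sub>v alg_run d ?m U (hd FA *\<^sub>v unit_vec N 0) (zip (tl FA) (qs A))"
    by (rule alg_run_last_mult) (use lens cA cB cP in \<open>auto simp: NN\<close>)
  also have "\<dots> = hd FB *\<^sub>v (P *\<^sub>v bvec N \<kappa>A \<iota>A (\<lambda>i. (if i = 0 then 1 else 0) \<cdot>\<^sub>v final_state d A U))"
    unfolding runA using assoc_mult_mat_vec[OF cB cP bvec_carrier] .
  also have "\<dots> = hd FB *\<^sub>v bvec N \<kappa>B \<iota>B (\<lambda>i. final_state d A U $ i \<cdot>\<^sub>v unit_vec (D * b) 0)"
    using swap_run final_state_carrier[OF A] by (simp add: D_def a_def)
  finally have "final_state d (seq_alg d A b ql B) U
      = bvec N \<kappa>B \<iota>B (\<lambda>i. final_state d A U $ i \<cdot>\<^sub>v final_state d (B i) U)"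
    unfolding runB .
  moreover have p: "p < N" using assms by (simp add: N_def D_def a_def)
  moreover have "\<kappa>B p < dim_vec (final_state d (B (\<iota>B p)) U)"
    using final_state_carrier[OF B(1), of "\<iota>B p" U] B(2) split_index_bounds(1)[OF sB p] by (simp add: D_def)
  ultimately show ?thesis by (simp add: \<kappa>B_def \<iota>B_def D_def a_def)
qed

text \<open>By \<open>seq_alg_final_state\<close> each amplitude is an amplitude of \<open>A\<close>
  times an amplitude of the selected \<open>B i\<close>. The squared moduli multiply to the
  probability of outcome \<open>i\<close> followed by outcome \<open>k\<close>, exactly as if
  \<open>A\<close> had been measured before \<open>B i\<close> was chosen.\<close>

lemma seq_alg_outcome_pmf:
  assumes U: "unitary_mat d U"
  shows "map_pmf (\<lambda>p. (p mod (2 * d * anc A), p div (2 * d * anc A))) (outcome_pmf d (seq_alg d A b ql B) U)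
    = outcome_pmf d A U \<bind> (\<lambda>i. map_pmf (Pair i) (outcome_pmf d (B i) U))"
proof (rule pmf_eqI)
  fix x :: "nat \<times> nat"
  obtain i k where x: "x = (i, k)" by force
  let ?n = "2 * d * anc A" and ?C = "outcome_pmf d (seq_alg d A b ql B) U"
  have n: "0 < ?n" using pos by (simp add: D_def a_def)
  note pC = pmf_outcome_pmf[OF seq_alg_valid U d]
  note pA = pmf_outcome_pmf[OF A U d]
  note pB = pmf_outcome_pmf[OF B(1) U d]
  have "pmf (outcome_pmf d A U \<bind> (\<lambda>i. map_pmf (Pair i) (outcome_pmf d (B i) U))) (i, k)
     = (\<integral>j. pmf (map_pmf (Pair j) (outcome_pmf d (B j) U)) (i, k) \<partial>measure_pmf (outcome_pmf d A U))"
    by (rule pmf_bind)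
  also have "\<dots> = (\<Sum>j\<in>{i}. pmf (outcome_pmf d A U) j *\<^sub>R pmf (map_pmf (Pair j) (outcome_pmf d (B j) U)) (i, k))"
  proof (rule integral_measure_pmf)
    fix j assume "pmf (map_pmf (Pair j) (outcome_pmf d (B j) U)) (i, k) \<noteq> 0"
    then show "j \<in> {i}" by (auto simp: pmf_eq_0_set_pmf)
  qed simp
  also have "\<dots> = pmf (outcome_pmf d A U) i * pmf (outcome_pmf d (B i) U) k"
    by (simp add: pmf_map_inj'[of "Pair i"] inj_def)
  finally have rhs: "pmf (outcome_pmf d A U \<bind> (\<lambda>i. map_pmf (Pair i) (outcome_pmf d (B i) U))) x
     = pmf (outcome_pmf d A U) i * pmf (outcome_pmf d (B i) U) k" unfolding x .
  have inj: "inj (\<lambda>p. (p mod ?n, p div ?n))"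
    by (intro injI) (metis div_mult_mod_eq prod.inject)
  show "pmf (map_pmf (\<lambda>p. (p mod ?n, p div ?n)) ?C) x
     = pmf (outcome_pmf d A U \<bind> (\<lambda>i. map_pmf (Pair i) (outcome_pmf d (B i) U))) x"
  proof (cases "i < ?n")
    case True
    let ?p = "k * ?n + i"
    have pm: "?p mod ?n = i" "?p div ?n = k" using mult_add_div_mod[OF True] by auto
    have "pmf (map_pmf (\<lambda>p. (p mod ?n, p div ?n)) ?C) x = pmf ?C ?p"
      using pmf_map_inj'[OF inj, of ?C ?p] pm x by simp
    also have "\<dots> = pmf (outcome_pmf d A U) i * pmf (outcome_pmf d (B i) U) k"
    proof (cases "k < 2 * d * b")
      case k: True
      have p: "?p < 2 * d * (b * ?n)" using mult_add_less[OF k True] by (simp add: mult.assoc)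
      show ?thesis unfolding pC pA pB seq_alg_anc B(2)
        using p True k seq_alg_final_state[OF p] pm by (simp add: norm_mult power_mult_distrib)
    next
      case False
      then have "2 * d * b * ?n \<le> k * ?n" by (intro mult_right_mono) auto
      then have "\<not> ?p < 2 * d * (b * ?n)" unfolding mult.assoc[of "2 * d" b ?n] by linarith
      then show ?thesis unfolding pC pA pB seq_alg_anc B(2) using False by simp
    qed
    finally show ?thesis using rhs by simp
  next
    case False
    have "x \<notin> set_pmf (map_pmf (\<lambda>p. (p mod ?n, p div ?n)) ?C)"
    proof -
      have "p mod ?n \<noteq> i" for p using mod_less_divisor[OF n, of p] False by linarith
      then show ?thesis using x by auto
    qed
    then have "pmf (map_pmf (\<lambda>p. (p mod ?n, p div ?n)) ?C) x = 0" unfolding pmf_eq_0_set_pmf .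
    moreover have "pmf (outcome_pmf d A U) i = 0" unfolding pA using False by simp
    ultimately show ?thesis using rhs by simp
  qed
qed

end

text \<open>
  The ancilla dimension and the query pattern are part of the predicate because a composed
  algorithm, branching on an earlier outcome, must use the same ones in every branch.
\<close>

definition achievable :: "nat \<Rightarrow> nat \<Rightarrow> bool list \<Rightarrow> (complex mat \<Rightarrow> 'a pmf) \<Rightarrow> bool" where
  "achievable d m ql P \<longleftrightarrow> (\<exists>A h. valid_qalg d A \<and> anc A = m \<and> qs A = ql \<and>
     (\<forall>U. unitary_mat d U \<longrightarrow> P U = map_pmf h (outcome_pmf d A U)))"

lemma achievable_bind:
  assumes d: "0 < d" and P: "achievable d a ql P" and Q: "\<And>x. achievable d b ql' (Q x)"
  shows "achievable d (b * (2 * d * a)) (ql @ ql') (\<lambda>U. P U \<bind> (\<lambda>x. Q x U))"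
proof -
  from P obtain A h where A: "valid_qalg d A" "anc A = a" "qs A = ql"
    and h: "\<And>U. unitary_mat d U \<Longrightarrow> P U = map_pmf h (outcome_pmf d A U)"
    unfolding achievable_def by auto
  from Q obtain B g where B: "\<And>x. valid_qalg d (B x)" "\<And>x. anc (B x) = b" "\<And>x. qs (B x) = ql'"
    and g: "\<And>x U. unitary_mat d U \<Longrightarrow> Q x U = map_pmf (g x) (outcome_pmf d (B x) U)"
    unfolding achievable_def by metis
  let ?C = "seq_alg d A b ql' (\<lambda>i. B (h i))"
  let ?n = "2 * d * anc A"
  have "P U \<bind> (\<lambda>x. Q x U) = map_pmf (\<lambda>p. g (h (p mod ?n)) (p div ?n)) (outcome_pmf d ?C U)"
    if U: "unitary_mat d U" for U
  proof -
    have "map_pmf (\<lambda>p. g (h (p mod ?n)) (p div ?n)) (outcome_pmf d ?C U)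
      = map_pmf (\<lambda>(i,k). g (h i) k) (map_pmf (\<lambda>p. (p mod ?n, p div ?n)) (outcome_pmf d ?C U))"
      by (simp add: pmf.map_comp o_def)
    also have "\<dots> = P U \<bind> (\<lambda>x. Q x U)"
      using seq_alg_outcome_pmf[OF d A(1), of "\<lambda>i. B (h i)", OF B U] h[OF U] g[OF U]
      by (simp add: map_bind_pmf bind_map_pmf pmf.map_comp o_def)
    finally show ?thesis ..
  qed
  then show ?thesis
    unfolding achievable_def
    using seq_alg_valid[OF d A(1), of "\<lambda>i. B (h i)", OF B] seq_alg_anc[OF d A(1), of "\<lambda>i. B (h i)", OF B]
      seq_alg_qs[OF d A(1), of "\<lambda>i. B (h i)", OF B] A by metis
qed

lemma achievable_map:
  assumes "achievable d m ql P"
  shows "achievable d m ql (\<lambda>U. map_pmf f (P U))"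
proof -
  from assms obtain A h where "valid_qalg d A" "anc A = m" "qs A = ql"
    and "\<And>U. unitary_mat d U \<Longrightarrow> P U = map_pmf h (outcome_pmf d A U)"
    unfolding achievable_def by auto
  then show ?thesis unfolding achievable_def
    by (intro exI[of _ A] exI[of _ "f \<circ> h"]) (simp add: pmf.map_comp)
qed

lemma achievable_qalg:
  fixes P :: "complex mat \<Rightarrow> (nat \<Rightarrow> complex) pmf"
  assumes "0 < d" "achievable d m ql P"
  shows "\<exists>A. valid_qalg d A \<and> num_queries A = length ql \<and>
    (\<forall>U. unitary_mat d U \<longrightarrow>
       success_prob d q \<epsilon> A U = measure_pmf.prob (P U) {x. lq_norm q d (\<lambda>j. amps d U j - x j) \<le> \<epsilon>})"
proof -
  from assms(2) obtain A h where A: "valid_qalg d A" "anc A = m" "qs A = ql"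
    and h: "\<And>U. unitary_mat d U \<Longrightarrow> P U = map_pmf h (outcome_pmf d A U)"
    unfolding achievable_def by auto
  \<comment> \<open>The decoder becomes the output function; the evolution, and with it the outcome
    distribution, stays the same.\<close>
  let ?A = "A\<lparr>out := h\<rparr>"
  have v: "valid_qalg d ?A" using A(1) by (simp add: valid_qalg_def qdim_def)
  have o: "outcome_pmf d ?A U = outcome_pmf d A U" for U
  proof -
    have "final_state d ?A U = final_state d A U" by (simp add: final_state_def qdim_def)
    then show ?thesis by (simp add: outcome_pmf_def qdim_def cong: if_cong)
  qed
  show ?thesis
  proof (intro exI[of _ ?A] conjI allI impI)
    fix U assume U: "unitary_mat d U"
    show "success_prob d q \<epsilon> ?A U = measure_pmf.prob (P U) {x. lq_norm q d (\<lambda>j. amps d U j - x j) \<le> \<epsilon>}"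
      unfolding success_prob_outcome_pmf[OF v U assms(1)] o h[OF U] by (simp add: vimage_def)
  qed (use v A in \<open>auto simp: num_queries_def\<close>)
qed

section \<open>The amplified sampling experiment\<close>

text \<open>For a unit vector \<open>v\<close> with real overlap \<open>r \<ge> 0\<close> with the
  first basis vector, the sum of the two bisects them and has squared norm \<open>2 + 2 * r\<close>,
  twice its own entry at \<open>0\<close>. Reflecting about it therefore exchanges them;
  \<open>r \<ge> 0\<close> keeps the sum nonzero.\<close>

lemma refl_mat_prepares:
  assumes v: "v \<in> carrier_vec n" and nv: "(\<Sum>i<n. (cmod (v $ i))\<^sup>2) = 1"
    and v0: "v $ 0 = complex_of_real r" "0 \<le> r" and n: "0 < n"
  defines "W \<equiv> refl_mat n (\<lambda>i. (if i = 0 then 1 else 0) + v $ i)"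
  shows "unitary_mat n W" "W *\<^sub>v unit_vec n 0 = v"
proof -
  let ?w = "\<lambda>i. (if i = 0 then 1 else 0) + v $ i"
  have w0: "?w 0 = complex_of_real (1 + r)" using v0 by simp
  have gen: "2 * x * y / (2 * y) = x" if "y \<noteq> 0" for x y :: complex using that by simp
  have w0n: "?w 0 \<noteq> 0" unfolding w0 of_real_eq_0_iff using v0 by simp
  show "unitary_mat n W" unfolding W_def by (rule unitary_refl_mat) (use n w0n in blast)
  have S: "(\<Sum>k<n. ?w k * cnj (?w k)) = 2 * ?w 0"
  proof -
    have "(\<Sum>k<n. ?w k * cnj (?w k))
       = (\<Sum>k<n. complex_of_real ((cmod (v $ k))\<^sup>2) + (if k = 0 then complex_of_real (1 + 2 * r) else 0))"
      using v0 by (intro sum.cong) (auto simp: complex_norm_square algebra_simps simp del: of_real_power)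
    also have "\<dots> = complex_of_real 1 + complex_of_real (1 + 2 * r)"
      using n nv by (simp add: sum.distrib flip: of_real_sum del: of_real_power)
    finally show ?thesis unfolding w0 by simp
  qed
  show "W *\<^sub>v unit_vec n 0 = v"
  proof (rule eq_vecI)
    fix i assume "i < dim_vec v"
    then have i: "i < n" using v by simp
    have "(\<Sum>l<n. cnj (?w l) * unit_vec n 0 $ l) = (\<Sum>l<n. if l = 0 then cnj (?w 0) else 0)"
      using n by (intro sum.cong) auto
    also have "\<dots> = ?w 0" using n v0 by simp
    finally have e: "(\<Sum>l<n. cnj (?w l) * unit_vec n 0 $ l) = ?w 0" .
    have "(W *\<^sub>v unit_vec n 0) $ i = 2 * ?w i * ?w 0 / (2 * ?w 0) - unit_vec n 0 $ i"
      unfolding W_def using refl_mat_mult_vec[OF unit_vec_carrier i, of ?w 0] unfolding S e by simp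
    also have "2 * ?w i * ?w 0 / (2 * ?w 0) = ?w i" by (rule gen[OF w0n])
    finally show "(W *\<^sub>v unit_vec n 0) $ i = v $ i" using i n by auto
  qed (use v in \<open>auto simp: W_def refl_mat_def\<close>)
qed

section \<open>Amplitude vectors and the action of a unitary on them\<close>

definition unit_amp :: "nat \<Rightarrow> (nat \<Rightarrow> complex) \<Rightarrow> bool" where
  "unit_amp d a \<longleftrightarrow> (\<Sum>j<d. (cmod (a j))\<^sup>2) = 1"

definition mat_app :: "nat \<Rightarrow> complex mat \<Rightarrow> (nat \<Rightarrow> complex) \<Rightarrow> nat \<Rightarrow> complex" where
  "mat_app d U v j = (\<Sum>l<d. U $$ (j,l) * v l)"

definition delta0 :: "nat \<Rightarrow> complex" where
  "delta0 j = (if j = 0 then 1 else 0)"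

lemma mat_app_delta0:
  assumes "unitary_mat d U" "j < d"
  shows "mat_app d U delta0 j = amps d U j"
proof -
  have "amps d U j = (\<Sum>l<d. U $$ (j,l) * unit_vec d 0 $ l)"
    unfolding amps_def using mult_mat_vec_index_sum[OF unitary_mat_carrier[OF assms(1)] unit_vec_carrier assms(2)] .
  also have "\<dots> = mat_app d U delta0 j"
    unfolding mat_app_def using assms(2) by (intro sum.cong) (auto simp: delta0_def)
  finally show ?thesis ..
qed

lemma unit_amp_amps:
  assumes "unitary_mat d U" "0 < d"
  shows "unit_amp d (amps d U)"
proof -
  have "(\<Sum>j<d. (cmod (amps d U j))\<^sup>2) = (\<Sum>j<d. (cmod ((unit_vec d 0 :: complex Matrix.vec) $ j))\<^sup>2)"
    unfolding amps_def by (rule unitary_mat_norm[OF assms(1) unit_vec_carrier])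
  also have "\<dots> = (\<Sum>j<d. if j = 0 then 1 else 0)" using assms(2) by (intro sum.cong) auto
  finally show ?thesis using assms(2) by (simp add: unit_amp_def)
qed

lemma mat_app_cadj_cancel:
  assumes "unitary_mat d U" "j < d"
  shows "mat_app d (cadj U) (mat_app d U v) j = v j"
proof -
  have U: "U \<in> carrier_mat d d" using assms(1) by (rule unitary_mat_carrier)
  have "mat_app d (cadj U) (mat_app d U v) j = (\<Sum>l<d. \<Sum>i<d. v i * (cnj (U $$ (l,j)) * U $$ (l,i)))"
    unfolding mat_app_def using U assms(2) by (intro sum.cong) (auto simp: sum_distrib_left mult_ac)
  also have "\<dots> = (\<Sum>i<d. v i * (\<Sum>l<d. cnj (U $$ (l,j)) * U $$ (l,i)))"
    by (subst sum.swap) (simp add: sum_distrib_left)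
  also have "\<dots> = (\<Sum>i<d. if i = j then v i else 0)"
    using unitary_mat_columns[OF assms(1,2)] by (intro sum.cong) auto
  finally show ?thesis using assms(2) by simp
qed

lemma mat_app_cancel_cadj:
  assumes "unitary_mat d U" "j < d"
  shows "mat_app d U (mat_app d (cadj U) v) j = v j"
  using mat_app_cadj_cancel[OF unitary_mat_cadj[OF assms(1)] assms(2)] by (simp add: cadj_cadj)

lemma mat_app_adjoint:
  assumes "unitary_mat d U"
  shows "(\<Sum>j<d. cnj (mat_app d U u j) * v j) = (\<Sum>j<d. cnj (u j) * mat_app d (cadj U) v j)"
proof -
  have U: "U \<in> carrier_mat d d" using assms by (rule unitary_mat_carrier)
  have "(\<Sum>j<d. cnj (mat_app d U u j) * v j) = (\<Sum>j<d. \<Sum>l<d. cnj (u l) * (cnj (U $$ (j,l)) * v j))"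
    unfolding mat_app_def cnj_sum sum_distrib_right by (intro sum.cong) auto
  also have "\<dots> = (\<Sum>l<d. \<Sum>j<d. cnj (u l) * (cnj (U $$ (j,l)) * v j))" by (rule sum.swap)
  also have "\<dots> = (\<Sum>l<d. cnj (u l) * mat_app d (cadj U) v l)"
    unfolding mat_app_def sum_distrib_left using U by (intro sum.cong) auto
  finally show ?thesis .
qed

lemma mat_app_lincomb:
  "mat_app d U (\<lambda>j. (x * u j + y * v j) / s) j = (x * mat_app d U u j + y * mat_app d U v j) / s"
  by (simp add: mat_app_def sum_distrib_left sum.distrib sum_divide_distrib algebra_simps add_divide_distrib)

text \<open>\<open>pair_vec d u v = |0\<rangle> u + |1\<rangle> v\<close>, the control qubit being the leading digit.\<close>

definition pair_vec :: "nat \<Rightarrow> (nat \<Rightarrow> complex) \<Rightarrow> (nat \<Rightarrow> complex) \<Rightarrow> complex Matrix.vec" where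
  "pair_vec d u v = vec (2*d) (\<lambda>i. if i < d then u i else v (i - d))"

lemma pair_vec_carrier [simp]: "pair_vec d u v \<in> carrier_vec (2*d)"
  by (simp add: pair_vec_def)

lemma pair_vec_cong:
  assumes "\<And>j. j < d \<Longrightarrow> u j = u' j" "\<And>j. j < d \<Longrightarrow> v j = v' j"
  shows "pair_vec d u v = pair_vec d u' v'"
  by (rule eq_vecI) (auto simp: pair_vec_def assms)

lemma ctrl_pair_vec: "ctrl d U *\<^sub>v pair_vec d u v = pair_vec d u (mat_app d U v)"
proof (rule eq_vecI)
  fix i assume "i < dim_vec (pair_vec d u (mat_app d U v))"
  then have i: "i < 2 * d" by (simp add: pair_vec_def)
  have "(ctrl d U *\<^sub>v pair_vec d u v) $ i = (\<Sum>l<d. ctrl d U $$ (i,l) * u l) + (\<Sum>l<d. ctrl d U $$ (i,d+l) * v l)"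
    unfolding mult_mat_vec_index_sum[OF ctrl_carrier pair_vec_carrier i] split_sum_double
    by (intro arg_cong2[where f = "(+)"] sum.cong) (auto simp: pair_vec_def)
  also have "(\<Sum>l<d. ctrl d U $$ (i,l) * u l) = (\<Sum>l<d. if l = i then u l else 0)"
    using i by (intro sum.cong) (auto simp: ctrl_def)
  also have "(\<Sum>l<d. ctrl d U $$ (i,d+l) * v l) = (if i < d then 0 else mat_app d U v (i - d))"
    using i by (auto simp: ctrl_def mat_app_def intro!: sum.neutral sum.cong)
  also have "(\<Sum>l<d. if l = i then u l else 0) + \<dots> = pair_vec d u (mat_app d U v) $ i"
    using i by (auto simp: pair_vec_def)
  finally show "(ctrl d U *\<^sub>v pair_vec d u v) $ i = pair_vec d u (mat_app d U v) $ i" .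
qed (simp add: pair_vec_def ctrl_def)

definition flip_mat :: "nat \<Rightarrow> complex mat" where
  "flip_mat d = perm_mat (2*d) (\<lambda>i. if i < d then i + d else i - d)"

lemma unitary_flip_mat: "unitary_mat (2*d) (flip_mat d)"
  unfolding flip_mat_def by (rule unitary_perm_mat) auto

lemma flip_pair_vec: "flip_mat d *\<^sub>v pair_vec d u v = pair_vec d v u"
proof (rule eq_vecI)
  fix i assume "i < dim_vec (pair_vec d v u)"
  then have i: "i < 2 * d" by (simp add: pair_vec_def)
  then show "(flip_mat d *\<^sub>v pair_vec d u v) $ i = pair_vec d v u $ i"
    unfolding flip_mat_def by (subst perm_mat_mult_vec[OF pair_vec_carrier i]) (auto simp: pair_vec_def)
qed (simp add: pair_vec_def flip_mat_def perm_mat_def)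

section \<open>The plane of amplitude amplification\<close>

definition psi0 :: "nat \<Rightarrow> (nat \<Rightarrow> complex) \<Rightarrow> complex Matrix.vec" where
  "psi0 d a = pair_vec d (\<lambda>j. a j / sqrt 2) (\<lambda>j. delta0 j / sqrt 2)"

definition psi0_refl :: "nat \<Rightarrow> (nat \<Rightarrow> complex) \<Rightarrow> complex mat" where
  "psi0_refl d a = refl_mat (2*d) (\<lambda>i. psi0 d a $ i)"

definition overlap :: "nat \<Rightarrow> (nat \<Rightarrow> complex) \<Rightarrow> (nat \<Rightarrow> complex) \<Rightarrow> real" where
  "overlap d a b = (\<Sum>j<d. Re (cnj (a j) * b j))"

text \<open>
  With \<open>\<psi>\<^sub>0 = (|0\<rangle>a + |1\<rangle>e\<^sub>0)/\<surd>2\<close>, \<open>Q\<close> the controlled unitary and \<open>X\<close> the flip of the control qubit,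
  \<open>amp_state\<close> is \<open>x \<psi>\<^sub>0 + y Q\<^sup>\<dagger>XQ \<psi>\<^sub>0\<close>; amplitude amplification stays in this plane.
\<close>

definition amp_state :: "nat \<Rightarrow> complex mat \<Rightarrow> (nat \<Rightarrow> complex) \<Rightarrow> real \<times> real \<Rightarrow> complex Matrix.vec" where
  "amp_state d U a xy = pair_vec d
     (\<lambda>j. (of_real (fst xy) * a j + of_real (snd xy) * amps d U j) / sqrt 2)
     (\<lambda>j. (of_real (fst xy) * delta0 j + of_real (snd xy) * mat_app d (cadj U) a j) / sqrt 2)"

text \<open>The image of \<open>amp_state\<close> under the controlled unitary. Its two halves
  differ by \<open>(x - y) * (a - \<alpha>) / sqrt 2\<close>, so \<open>x - y\<close> is the factor
  by which the difference is amplified; \<open>amp_gain\<close> records it.\<close>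

definition amp_out :: "nat \<Rightarrow> complex mat \<Rightarrow> (nat \<Rightarrow> complex) \<Rightarrow> real \<times> real \<Rightarrow> complex Matrix.vec" where
  "amp_out d U a xy = pair_vec d
     (\<lambda>j. (of_real (fst xy) * a j + of_real (snd xy) * amps d U j) / sqrt 2)
     (\<lambda>j. (of_real (fst xy) * amps d U j + of_real (snd xy) * a j) / sqrt 2)"

definition amp_step :: "real \<Rightarrow> real \<times> real \<Rightarrow> real \<times> real" where
  "amp_step \<tau> xy = (2 * \<tau> * fst xy + snd xy, - fst xy)"

lemma ctrl_amp_state:
  assumes "unitary_mat d U"
  shows "ctrl d U *\<^sub>v amp_state d U a xy = amp_out d U a xy"
  unfolding amp_state_def amp_out_def ctrl_pair_vec mat_app_lincomb
  by (rule pair_vec_cong) (simp_all add: mat_app_delta0[OF assms] mat_app_cancel_cadj[OF assms])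

text \<open>Together with the preceding controlled query this is \<open>Q\<^sup>\<dagger>XQ\<close>,
  an involution exchanging the two spanning vectors, so it merely swaps the coefficients.\<close>

lemma ctrl_cadj_flip_amp_out:
  assumes "unitary_mat d U"
  shows "ctrl d (cadj U) *\<^sub>v (flip_mat d *\<^sub>v amp_out d U a xy) = amp_state d U a (snd xy, fst xy)"
proof -
  have "mat_app d (cadj U) (amps d U) j = delta0 j" if "j < d" for j
  proof -
    have "mat_app d (cadj U) (amps d U) j = mat_app d (cadj U) (mat_app d U delta0) j"
      unfolding mat_app_def[of d "cadj U"] using mat_app_delta0[OF assms] by (intro sum.cong) auto
    then show ?thesis using mat_app_cadj_cancel[OF assms that] by simp
  qed
  then show ?thesis
    unfolding amp_state_def amp_out_def flip_pair_vec ctrl_pair_vec mat_app_lincomb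
    by (intro pair_vec_cong) (simp_all add: add.commute)
qed

lemma sqrt2_square: "complex_of_real (sqrt 2) * complex_of_real (sqrt 2) = 2"
  by (simp flip: of_real_mult)

lemma cnj_mult_self: "cnj z * z = complex_of_real ((cmod z)\<^sup>2)"
  by (simp add: complex_norm_square mult.commute del: of_real_power)

text \<open>The two spanning vectors have a real inner product, the real part of
  \<open><a|\<alpha>>\<close>: the control halves contribute half of \<open><a|\<alpha>>\<close> and
  half of its conjugate. Reflecting about \<open>psi0 d a\<close> thus keeps the coefficients real,
  and \<open>amp_step\<close> is the resulting linear map.\<close>

lemma refl_amp_state:
  assumes U: "unitary_mat d U" and a: "unit_amp d a" and d: "0 < d"
  shows "psi0_refl d a *\<^sub>v amp_state d U a (snd xy, fst xy) = amp_state d U a (amp_step (overlap d a (amps d U)) xy)"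
proof -
  define x y where "x = fst xy" and "y = snd xy"
  let ?\<alpha> = "amps d U" and ?v = "mat_app d (cadj U) a"
  let ?\<tau> = "overlap d a ?\<alpha>"
  have aa: "(\<Sum>j<d. cnj (a j) * a j) = 1"
    using a by (simp add: cnj_mult_self unit_amp_def flip: of_real_sum del: of_real_power)
  have ee: "(\<Sum>j<d. cnj (delta0 j) * f j) = f 0" for f :: "nat \<Rightarrow> complex"
  proof -
    have "(\<Sum>j<d. cnj (delta0 j) * f j) = (\<Sum>j<d. if j = 0 then f j else 0)"
      by (intro sum.cong) (auto simp: delta0_def)
    then show ?thesis using d by simp
  qed
  have ev: "?v 0 = (\<Sum>j<d. cnj (?\<alpha> j) * a j)"
  proof -
    have "?v 0 = (\<Sum>j<d. cnj (mat_app d U delta0 j) * a j)"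
      using mat_app_adjoint[OF U, of delta0 a] ee by simp
    then show ?thesis using mat_app_delta0[OF U] by simp
  qed
  have av: "(\<Sum>j<d. cnj (a j) * ?\<alpha> j) + ?v 0 = 2 * of_real ?\<tau>"
  proof -
    have "(\<Sum>j<d. cnj (a j) * ?\<alpha> j) + ?v 0 = (\<Sum>j<d. of_real (2 * Re (cnj (a j) * ?\<alpha> j)))"
      unfolding ev sum.distrib[symmetric] by (intro sum.cong) (auto simp: complex_eq_iff)
    also have "\<dots> = 2 * of_real ?\<tau>" by (simp add: overlap_def sum_distrib_left)
    finally show ?thesis .
  qed
  have S: "(\<Sum>k<2*d. psi0 d a $ k * cnj (psi0 d a $ k)) = 1"
  proof -
    have "(\<Sum>k<2*d. psi0 d a $ k * cnj (psi0 d a $ k))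
       = (\<Sum>j<d. cnj (a j) * a j / 2) + (\<Sum>j<d. cnj (delta0 j) * delta0 j / 2)"
      unfolding split_sum_double
      by (intro arg_cong2[where f = "(+)"] sum.cong) (auto simp: psi0_def pair_vec_def sqrt2_square mult.commute)
    also have "\<dots> = 1" unfolding sum_divide_distrib[symmetric] aa ee by (simp add: delta0_def)
    finally show ?thesis .
  qed
  have I: "(\<Sum>l<2*d. cnj (psi0 d a $ l) * amp_state d U a (y, x) $ l) = of_real (y + \<tau>' * x)" if "\<tau>' = ?\<tau>" for \<tau>'
  proof -
    have "(\<Sum>l<2*d. cnj (psi0 d a $ l) * amp_state d U a (y, x) $ l)
      = (\<Sum>j<d. y / 2 * (cnj (a j) * a j) + x / 2 * (cnj (a j) * ?\<alpha> j))
        + (\<Sum>j<d. y / 2 * (cnj (delta0 j) * delta0 j) + x / 2 * (cnj (delta0 j) * ?v j))"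
      unfolding split_sum_double
      by (intro arg_cong2[where f = "(+)"] sum.cong)
        (auto simp: psi0_def amp_state_def pair_vec_def sqrt2_square field_simps)
    also have "\<dots> = y / 2 + x / 2 * (\<Sum>j<d. cnj (a j) * ?\<alpha> j) + (y / 2 + x / 2 * ?v 0)"
      unfolding sum.distrib sum_distrib_left[symmetric] aa ee by (simp add: delta0_def)
    also have "\<dots> = y + x / 2 * ((\<Sum>j<d. cnj (a j) * ?\<alpha> j) + ?v 0)" by (simp add: field_simps)
    also have "\<dots> = of_real (y + \<tau>' * x)" unfolding av that by simp
    finally show ?thesis .
  qed
  show ?thesis unfolding x_def[symmetric] y_def[symmetric]
  proof (rule eq_vecI)
    fix i assume "i < dim_vec (amp_state d U a (amp_step ?\<tau> xy))"
    then have i: "i < 2 * d" by (simp add: amp_state_def pair_vec_def)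
    have c: "amp_state d U a (y, x) \<in> carrier_vec (2*d)" by (simp add: amp_state_def)
    have "(psi0_refl d a *\<^sub>v amp_state d U a (y, x)) $ i
        = 2 * psi0 d a $ i * of_real (y + ?\<tau> * x) - amp_state d U a (y, x) $ i"
      unfolding psi0_refl_def refl_mat_mult_vec[OF c i] S I[OF refl] by simp
    also have "\<dots> = amp_state d U a (amp_step ?\<tau> xy) $ i"
      using i by (auto simp: psi0_def amp_state_def pair_vec_def amp_step_def x_def y_def field_simps)
    finally show "(psi0_refl d a *\<^sub>v amp_state d U a (y, x)) $ i = amp_state d U a (amp_step ?\<tau> xy) $ i" .
  qed (auto simp: amp_state_def pair_vec_def psi0_refl_def refl_mat_def)
qed

section \<open>The gain after k rounds\<close>

definition amp_coeff :: "real \<Rightarrow> nat \<Rightarrow> real \<times> real" where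
  "amp_coeff \<tau> k = (amp_step \<tau> ^^ k) (1, 0)"

definition amp_gain :: "real \<Rightarrow> nat \<Rightarrow> real" where
  "amp_gain \<tau> k = fst (amp_coeff \<tau> k) - snd (amp_coeff \<tau> k)"

text \<open>The coefficients are the Chebyshev values \<open>U_k(\<tau>)\<close> and
  \<open>- U_(k-1)(\<tau>)\<close> of the second kind; for \<open>\<tau> = cos \<theta>\<close> the
  gain is \<open>sin ((2 * k + 1) * \<theta> / 2) / sin (\<theta> / 2)\<close>. Trigonometry is
  avoided: for \<open>\<rho> = 1 - \<tau>\<close> the sum and the difference of the coefficients
  obey recursions whose only defect is the term \<open>2 * (\<rho> * x)\<close>, and the four bounds
  together close under induction.\<close>

lemma amp_coeff_bounds:
  assumes "0 \<le> \<rho>" "\<rho> * (real k)\<^sup>2 \<le> 1/2"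
  shows "fst (amp_coeff (1 - \<rho>) k) + snd (amp_coeff (1 - \<rho>) k) \<le> 1 \<and>
    1 - \<rho> * k * (k + 1) \<le> fst (amp_coeff (1 - \<rho>) k) + snd (amp_coeff (1 - \<rho>) k) \<and>
    amp_gain (1 - \<rho>) k \<le> 2 * k + 1 \<and> 2 * k + 1 - 2 * \<rho> * k ^ 3 \<le> amp_gain (1 - \<rho>) k"
  using assms(2)
proof (induction k)
  case (Suc k)
  define x y where "x = fst (amp_coeff (1 - \<rho>) k)" and "y = snd (amp_coeff (1 - \<rho>) k)"
  have c: "fst (amp_coeff (1 - \<rho>) (Suc k)) = 2 * (1 - \<rho>) * x + y" "snd (amp_coeff (1 - \<rho>) (Suc k)) = - x"
    by (simp_all add: amp_coeff_def amp_step_def x_def y_def)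
  have k1: "\<rho> * (real k + 1)\<^sup>2 \<le> 1/2" using Suc.prems by (simp add: add.commute)
  have "\<rho> * (real k)\<^sup>2 \<le> \<rho> * (real k + 1)\<^sup>2"
    using assms(1) by (intro mult_left_mono) (auto simp: power2_eq_square algebra_simps)
  then have kk: "\<rho> * (real k)\<^sup>2 \<le> 1/2" using k1 by linarith
  from Suc.IH[OF kk] have IH: "x + y \<le> 1" "1 - \<rho> * k * (k + 1) \<le> x + y" "x - y \<le> 2 * k + 1"
    "2 * k + 1 - 2 * \<rho> * k ^ 3 \<le> x - y"
    unfolding amp_gain_def x_def y_def by (simp_all add: add.commute)
  have r1: "\<rho> * k * (k + 1) \<le> 1"
  proof -
    have "\<rho> * k * (k + 1) \<le> \<rho> * (real k + 1)\<^sup>2"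
      using assms(1) by (auto simp: power2_eq_square algebra_simps)
    then show ?thesis using k1 by linarith
  qed
  have r2: "2 * \<rho> * k ^ 3 \<le> k"
  proof -
    have "2 * \<rho> * k ^ 3 = 2 * (\<rho> * (real k)\<^sup>2) * k" by (simp add: power2_eq_square power3_eq_cube)
    also have "\<dots> \<le> 2 * (1/2) * k" using kk by (intro mult_right_mono) auto
    finally show ?thesis by simp
  qed
  \<comment> \<open>\<open>2 * x\<close> is the sum of the two tracked quantities, whose lower
    bounds are nonnegative by \<open>r1\<close> and \<open>r2\<close>.\<close>
  have x0: "0 \<le> x" using IH r1 r2 by linarith
  have x1: "2 * x \<le> 2 * k + 2" using IH by linarith
  have px: "0 \<le> \<rho> * x" using x0 assms(1) by simp
  have px1: "2 * (\<rho> * x) \<le> \<rho> * (2 * k + 2)" using mult_left_mono[OF x1 assms(1)] by simp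
  have g: "amp_gain (1 - \<rho>) (Suc k) = (x - y) + 2 * (x + y) - 2 * (\<rho> * x)"
    unfolding amp_gain_def c by (simp add: algebra_simps)
  have s: "fst (amp_coeff (1 - \<rho>) (Suc k)) + snd (amp_coeff (1 - \<rho>) (Suc k)) = (x + y) - 2 * (\<rho> * x)"
    unfolding c by (simp add: algebra_simps)
  have e1: "\<rho> * k * (k + 1) + \<rho> * (2 * k + 2) = \<rho> * Suc k * (Suc k + 1)"
    by (simp add: algebra_simps)
  have e2: "2 * \<rho> * k ^ 3 + 2 * (\<rho> * k * (k + 1)) + \<rho> * (2 * k + 2) \<le> 2 * \<rho> * (Suc k) ^ 3"
    using assms(1) by (simp add: algebra_simps power3_eq_cube)
  show ?case unfolding s g using IH px px1 e1 e2 by (auto simp: algebra_simps)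
qed (simp_all add: amp_coeff_def amp_gain_def)

lemma amp_gain_bound:
  assumes "0 \<le> \<rho>" "\<rho> * (real k)\<^sup>2 \<le> 1/2"
  shows "\<bar>1 - amp_gain (1 - \<rho>) k / (2 * k + 1)\<bar> \<le> \<rho> * (real k)\<^sup>2"
proof -
  note b = amp_coeff_bounds[OF assms]
  have "0 \<le> 1 - amp_gain (1 - \<rho>) k / (2 * k + 1)" using b by simp
  moreover have "1 - amp_gain (1 - \<rho>) k / (2 * k + 1) \<le> 2 * \<rho> * k ^ 3 / (2 * k + 1)"
  proof -
    have "1 - amp_gain (1 - \<rho>) k / (2 * k + 1) = (2 * k + 1 - amp_gain (1 - \<rho>) k) / (2 * k + 1)"
      by (simp add: diff_divide_distrib add_pos_nonneg)
    also have "\<dots> \<le> 2 * \<rho> * k ^ 3 / (2 * k + 1)" using b by (intro divide_right_mono) auto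
    finally show ?thesis .
  qed
  moreover have "2 * \<rho> * k ^ 3 / (2 * k + 1) \<le> \<rho> * (real k)\<^sup>2"
    using assms(1) by (simp add: divide_simps algebra_simps power2_eq_square power3_eq_cube)
  ultimately show ?thesis by linarith
qed

section \<open>The sampling experiment as a query algorithm\<close>

definition amp_queries :: "nat \<Rightarrow> bool list" where
  "amp_queries k = concat (replicate k [True, False]) @ [True]"

lemma length_amp_queries: "length (amp_queries k) = 2 * k + 1"
  by (induction k) (simp_all add: amp_queries_def)

text \<open>Acting on ancilla level \<open>1\<close> alone leaves the reference at level
  \<open>0\<close> in place between queries.\<close>

definition branch :: "nat \<Rightarrow> complex mat \<Rightarrow> nat \<Rightarrow> complex mat" where
  "branch d W i = (if i = 1 then W else 1\<^sub>m (2*d))"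

definition amp_blocks :: "nat \<Rightarrow> (nat \<Rightarrow> complex) \<Rightarrow> nat \<Rightarrow> (nat \<Rightarrow> complex mat) list" where
  "amp_blocks d a k = concat (replicate k [branch d (flip_mat d), branch d (psi0_refl d a)])"

text \<open>
  The ancilla is a qutrit: level \<open>0\<close> carries a reference amplitude \<open>1/\<surd>2\<close> at label \<open>0\<close>, level \<open>1\<close>
  carries the amplified state, and level \<open>2\<close> stays empty, so that a difference of occupied labels
  is \<open>1\<close> modulo \<open>3\<close> only if it is taken from an amplified label to the reference.
\<close>

definition exp_vec :: "nat \<Rightarrow> complex Matrix.vec \<Rightarrow> complex Matrix.vec" where
  "exp_vec d \<chi> = bvec (2*d*3) (\<lambda>p. p div 3) (\<lambda>p. p mod 3)
     (\<lambda>i. (1 / complex_of_real (sqrt 2)) \<cdot>\<^sub>v (if i = 0 then unit_vec (2*d) 0 else if i = 1 then \<chi> else 0\<^sub>v (2*d)))"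

definition exp_alg :: "nat \<Rightarrow> (nat \<Rightarrow> complex) \<Rightarrow> nat \<Rightarrow> qalg" where
  "exp_alg d a k = \<lparr>anc = 3,
     Vs = refl_mat (2*d*3) (\<lambda>i. (if i = 0 then 1 else 0) + exp_vec d (psi0 d a) $ i)
       # map (bdiag (2*d*3) (\<lambda>p. p div 3) (\<lambda>p. p mod 3)) (amp_blocks d a k) @ [dft_mat (2*d*3)],
     qs = amp_queries k, out = \<lambda>_ _. 0\<rparr>"

lemma split_index_3: "split_index (2*d*3) (2*d) 3 (\<lambda>p. p div 3) (\<lambda>p. p mod 3)"
  by (rule div_mod_split_index)

lemma query_op_1: "query_op d 1 U b = ctrl d (if b then U else cadj U)"
  by (rule eq_matI) (simp_all add: query_op_index carrier_matD[OF query_op_carrier] carrier_matD[OF ctrl_carrier])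

lemma query_op_3:
  "query_op d 3 U b = bdiag (2*d*3) (\<lambda>p. p div 3) (\<lambda>p. p mod 3) (\<lambda>_. query_op d 1 U b)"
  using query_op_div_mod[of 1 3 d U b] by simp

lemma psi0_carrier [simp]: "psi0 d a \<in> carrier_vec (2*d)"
  by (simp add: psi0_def)

lemma psi0_norm:
  assumes "unit_amp d a" "0 < d"
  shows "(\<Sum>i<2*d. (cmod (psi0 d a $ i))\<^sup>2) = 1"
proof -
  have e: "(\<Sum>j<d. (cmod (delta0 j))\<^sup>2) = 1"
  proof -
    have "(\<Sum>j<d. (cmod (delta0 j))\<^sup>2) = (\<Sum>j<d. if j = 0 then 1 else 0)"
      by (intro sum.cong) (auto simp: delta0_def)
    then show ?thesis using assms(2) by simp
  qed
  have "(\<Sum>i<2*d. (cmod (psi0 d a $ i))\<^sup>2) = (\<Sum>j<d. (cmod (a j))\<^sup>2 / 2) + (\<Sum>j<d. (cmod (delta0 j))\<^sup>2 / 2)"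
    unfolding split_sum_double
    by (intro arg_cong2[where f = "(+)"] sum.cong) (auto simp: psi0_def pair_vec_def norm_divide power_divide)
  also have "\<dots> = 1" using assms e by (simp add: unit_amp_def flip: sum_divide_distrib)
  finally show ?thesis .
qed

lemma unitary_psi0_refl:
  assumes "unit_amp d a" "0 < d" shows "unitary_mat (2*d) (psi0_refl d a)"
  unfolding psi0_refl_def
proof (rule unitary_refl_mat, rule ccontr)
  assume "\<not> (\<exists>k<2*d. psi0 d a $ k \<noteq> 0)"
  then have "(\<Sum>i<2*d. (cmod (psi0 d a $ i))\<^sup>2) = 0" by (intro sum.neutral) auto
  then show False using psi0_norm[OF assms] by simp
qed

lemma exp_vec_carrier [simp]: "exp_vec d \<chi> \<in> carrier_vec (2*d*3)"
  by (simp add: exp_vec_def)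

lemma exp_vec_index:
  assumes "\<chi> \<in> carrier_vec (2*d)" "p < 2*d*3"
  shows "exp_vec d \<chi> $ p = (if p = 0 then 1 / sqrt 2 else if p mod 3 = 1 then \<chi> $ (p div 3) / sqrt 2 else 0)"
proof -
  note b = split_index_bounds[OF split_index_3 assms(2)]
  consider "p mod 3 = 0" | "p mod 3 = 1" | "p mod 3 = 2" using b(2) by linarith
  then show ?thesis
  proof cases
    case 1
    moreover have "p div 3 = 0 \<longleftrightarrow> p = 0" using 1 by auto
    ultimately show ?thesis using assms b by (auto simp: exp_vec_def)
  qed (use assms b in \<open>auto simp: exp_vec_def\<close>)
qed

lemma exp_vec_norm:
  assumes "\<chi> \<in> carrier_vec (2*d)" "(\<Sum>i<2*d. (cmod (\<chi> $ i))\<^sup>2) = 1" "0 < d"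
  shows "(\<Sum>i<2*d*3. (cmod (exp_vec d \<chi> $ i))\<^sup>2) = 1"
proof -
  let ?g = "\<lambda>i::nat. (1 / complex_of_real (sqrt 2)) \<cdot>\<^sub>v (if i = 0 then unit_vec (2*d) 0 else if i = 1 then \<chi> else 0\<^sub>v (2*d))"
  have sum3: "(\<Sum>i<3. h i) = h 0 + h 1 + h 2" for h :: "nat \<Rightarrow> real"
    by (simp add: numeral_3_eq_3 numeral_2_eq_2)
  have "(\<Sum>i<2*d*3. (cmod (exp_vec d \<chi> $ i))\<^sup>2) = (\<Sum>p<2*d*3. (cmod (?g (p mod 3) $ (p div 3)))\<^sup>2)"
    unfolding exp_vec_def by (intro sum.cong) auto
  also have "\<dots> = (\<Sum>i<3. \<Sum>k<2*d. (cmod (?g i $ k))\<^sup>2)"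
    by (rule split_index_sum[OF split_index_3, of "\<lambda>k i. (cmod (?g i $ k))\<^sup>2"])
  also have "\<dots> = (\<Sum>k<2*d. (cmod (?g 0 $ k))\<^sup>2) + (\<Sum>k<2*d. (cmod (?g 1 $ k))\<^sup>2) + (\<Sum>k<2*d. (cmod (?g 2 $ k))\<^sup>2)"
    by (rule sum3)
  also have "(\<Sum>k<2*d. (cmod (?g 0 $ k))\<^sup>2) = (\<Sum>k<2*d. if k = 0 then 1/2 else 0)"
    by (intro sum.cong) (auto simp: norm_divide power_divide)
  also have "(\<Sum>k<2*d. (cmod (?g 1 $ k))\<^sup>2) = (\<Sum>k<2*d. (cmod (\<chi> $ k))\<^sup>2 / 2)"
    using assms(1) by (intro sum.cong) (auto simp: norm_divide norm_mult power_divide)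
  also have "(\<Sum>k<2*d. (cmod (?g 2 $ k))\<^sup>2) = 0" by (intro sum.neutral) auto
  also have "(\<Sum>k<2*d. if k = 0 then 1/2 else 0) + (\<Sum>k<2*d. (cmod (\<chi> $ k))\<^sup>2 / 2) + 0 = (1::real)"
    using assms(2,3) by (simp flip: sum_divide_distrib)
  finally show ?thesis .
qed

lemma exp_alg_prepares:
  assumes "unit_amp d a" "0 < d"
  defines "W \<equiv> refl_mat (2*d*3) (\<lambda>i. (if i = 0 then 1 else 0) + exp_vec d (psi0 d a) $ i)"
  shows "unitary_mat (2*d*3) W" "W *\<^sub>v unit_vec (2*d*3) 0 = exp_vec d (psi0 d a)"
  unfolding W_def
  by (rule refl_mat_prepares[OF exp_vec_carrier exp_vec_norm[OF psi0_carrier psi0_norm[OF assms(1,2)] assms(2)], of "1 / sqrt 2"];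
      use assms(2) in \<open>simp add: exp_vec_index\<close>)+

lemma length_amp_blocks: "length (amp_blocks d a k) = 2 * k"
  by (induction k) (simp_all add: amp_blocks_def)

lemma set_amp_blocks:
  "F \<in> set (amp_blocks d a k) \<Longrightarrow> F = branch d (flip_mat d) \<or> F = branch d (psi0_refl d a)"
  by (induction k) (auto simp: amp_blocks_def)

lemma unitary_branch: "unitary_mat (2*d) W \<Longrightarrow> unitary_mat (2*d) (branch d W i)"
  by (simp add: branch_def unitary_mat_one)

lemma unitary_amp_blocks:
  assumes "unit_amp d a" "0 < d" "F \<in> set (amp_blocks d a k)"
  shows "unitary_mat (2*d) (F i)"
  using set_amp_blocks[OF assms(3)] unitary_branch unitary_flip_mat unitary_psi0_refl[OF assms(1,2)] by auto

lemma exp_alg_valid: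
  assumes "unit_amp d a" "0 < d"
  shows "valid_qalg d (exp_alg d a k)"
proof -
  have "unitary_mat (2*d*3) (dft_mat (2*d*3))" using assms(2) by (intro unitary_dft_mat) simp
  moreover have "unitary_mat (2*d*3) (bdiag (2*d*3) (\<lambda>p. p div 3) (\<lambda>p. p mod 3) F)"
    if "F \<in> set (amp_blocks d a k)" for F
    using unitary_bdiag[OF split_index_3] unitary_amp_blocks[OF assms that] by blast
  ultimately show ?thesis
    using exp_alg_prepares(1)[OF assms]
    unfolding valid_qalg_def exp_alg_def qdim_def
    by (auto simp: length_amp_blocks length_amp_queries)
qed

text \<open>The reference label has control qubit \<open>0\<close>, which every controlled query
  fixes, and \<open>branch\<close> is the identity off level \<open>1\<close>; amplitude and phase
  of the reference thus survive all rounds.\<close>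

lemma run_reference:
  "alg_run d 1 U (unit_vec (2*d) 0) (zip (map (\<lambda>F. F i) (amp_blocks d a k)) (concat (replicate k [True, False])))
    = unit_vec (2*d) 0" if "i \<noteq> 1"
proof -
  have e: "unit_vec (2*d) 0 = pair_vec d delta0 (\<lambda>_. 0)"
    by (rule eq_vecI) (auto simp: pair_vec_def delta0_def)
  have c: "ctrl d X *\<^sub>v unit_vec (2*d) 0 = unit_vec (2*d) 0" for X
    unfolding e ctrl_pair_vec by (rule pair_vec_cong) (simp_all add: mat_app_def)
  show ?thesis using that
    by (induction k) (simp_all add: amp_blocks_def alg_run_def branch_def query_op_1[unfolded One_nat_def] c)
qed

lemma run_amplified:
  assumes "unitary_mat d U" "unit_amp d a" "0 < d"
  shows "alg_run d 1 U (amp_state d U a xy) (zip (map (\<lambda>F. F 1) (amp_blocks d a k)) (concat (replicate k [True, False])))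
    = amp_state d U a ((amp_step (overlap d a (amps d U)) ^^ k) xy)"
proof (induction k arbitrary: xy)
  case (Suc k)
  have "psi0_refl d a *\<^sub>v (ctrl d (cadj U) *\<^sub>v (flip_mat d *\<^sub>v (ctrl d U *\<^sub>v amp_state d U a xy)))
      = amp_state d U a (amp_step (overlap d a (amps d U)) xy)"
    unfolding ctrl_amp_state[OF assms(1)] ctrl_cadj_flip_amp_out[OF assms(1)] by (rule refl_amp_state[OF assms])
  then show ?case using Suc.IH[of "amp_step (overlap d a (amps d U)) xy"]
    by (simp add: amp_blocks_def alg_run_def branch_def query_op_1[unfolded One_nat_def] funpow_swap1)
qed (simp add: amp_blocks_def alg_run_def)

lemma psi0_amp_state: "psi0 d a = amp_state d U a (1, 0)"
  unfolding psi0_def amp_state_def by simp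

lemma run_exp_vec:
  assumes "unitary_mat d U" "unit_amp d a" "0 < d"
  shows "alg_run d 3 U (exp_vec d (psi0 d a))
      (zip (map (bdiag (2*d*3) (\<lambda>p. p div 3) (\<lambda>p. p mod 3)) (amp_blocks d a k)) (concat (replicate k [True, False])))
    = exp_vec d (amp_state d U a (amp_coeff (overlap d a (amps d U)) k))"
proof -
  let ?g = "\<lambda>i::nat. if i = 0 then unit_vec (2*d) 0 else if i = 1 then psi0 d a else 0\<^sub>v (2*d)"
  let ?c = "1 / complex_of_real (sqrt 2)"
  let ?Q = "concat (replicate k [True, False])"
  have l: "length (amp_blocks d a k) = length ?Q"
    unfolding length_amp_blocks by (induction k) simp_all
  have gc: "?g i \<in> carrier_vec (2*d*1)" for i by simp
  have cF: "F i \<in> carrier_mat (2*d*1) (2*d*1)" if "F \<in> set (amp_blocks d a k)" for F i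
    using unitary_mat_carrier[OF unitary_amp_blocks[OF assms(2,3) that]] by simp
  have cz: "\<forall>x\<in>set (zip (map (\<lambda>F. F i) (amp_blocks d a k)) ?Q). fst x \<in> carrier_mat (2*d*1) (2*d*1)" for i
    using cF by (auto dest!: set_zip_leftD)
  have "alg_run d 3 U (exp_vec d (psi0 d a))
      (zip (map (bdiag (2*d*3) (\<lambda>p. p div 3) (\<lambda>p. p mod 3)) (amp_blocks d a k)) ?Q)
    = bvec (2*d*3) (\<lambda>p. p div 3) (\<lambda>p. p mod 3)
      (\<lambda>i. alg_run d 1 U (?c \<cdot>\<^sub>v ?g i) (zip (map (\<lambda>F. F i) (amp_blocks d a k)) ?Q))"
    unfolding exp_vec_def
  proof (rule alg_run_bdiag)
    show "split_index (2*d*3) (2*d*1) 3 (\<lambda>p. p div 3) (\<lambda>p. p mod 3)" using split_index_3 by simp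
    show "query_op d 3 U b = bdiag (2*d*3) (\<lambda>p. p div 3) (\<lambda>p. p mod 3) (\<lambda>_. query_op d 1 U b)" for b
      by (rule query_op_3)
  qed (use l cF gc in auto)
  also have "\<dots> = bvec (2*d*3) (\<lambda>p. p div 3) (\<lambda>p. p mod 3)
      (\<lambda>i. ?c \<cdot>\<^sub>v alg_run d 1 U (?g i) (zip (map (\<lambda>F. F i) (amp_blocks d a k)) ?Q))"
    using alg_run_smult[OF gc cz] by simp
  also have "\<dots> = exp_vec d (amp_state d U a (amp_coeff (overlap d a (amps d U)) k))"
    unfolding exp_vec_def
  proof (rule bvec_cong[OF split_index_3])
    fix i :: nat assume "i < 3"
    then consider "i = 0" | "i = 1" | "i = 2" by linarith
    then show "?c \<cdot>\<^sub>v alg_run d 1 U (?g i) (zip (map (\<lambda>F. F i) (amp_blocks d a k)) ?Q)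
      = ?c \<cdot>\<^sub>v (if i = 0 then unit_vec (2*d) 0
          else if i = 1 then amp_state d U a (amp_coeff (overlap d a (amps d U)) k) else 0\<^sub>v (2*d))"
    proof cases
      case 2
      then show ?thesis using run_amplified[OF assms, of "(1,0)" k]
        by (simp add: psi0_amp_state[symmetric] amp_coeff_def)
    next
      case 3
      \<comment> \<open>The empty level is zero times the reference vector, so
        \<open>run_reference\<close> and linearity cover it as well.\<close>
      have z: "0\<^sub>v (2*d) = (0::complex) \<cdot>\<^sub>v unit_vec (2*d) 0" by auto
      have "alg_run d 1 U (0\<^sub>v (2*d)) (zip (map (\<lambda>F. F i) (amp_blocks d a k)) ?Q) = 0\<^sub>v (2*d)"
        unfolding z using alg_run_smult[OF _ cz, of "unit_vec (2*d) 0" U 0 i] run_reference[where i = i] 3 by simp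
      then show ?thesis using 3 by simp
    qed (use run_reference in auto)
  qed
  finally show ?thesis .
qed

lemma exp_alg_final_state:
  assumes "unitary_mat d U" "unit_amp d a" "0 < d"
  shows "final_state d (exp_alg d a k) U
    = dft_mat (2*d*3) *\<^sub>v exp_vec d (amp_out d U a (amp_coeff (overlap d a (amps d U)) k))"
proof -
  let ?xy = "amp_coeff (overlap d a (amps d U)) k"
  let ?L = "map (bdiag (2*d*3) (\<lambda>p. p div 3) (\<lambda>p. p mod 3)) (amp_blocks d a k)"
  have l: "length ?L = length (concat (replicate k [True, False]))"
    unfolding length_map length_amp_blocks by (induction k) simp_all
  have cs: "amp_state d U a ?xy \<in> carrier_vec (2*d)" by (simp add: amp_state_def)
  have e: "unit_vec (2*d) 0 = pair_vec d delta0 (\<lambda>_. 0)"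
    by (rule eq_vecI) (auto simp: pair_vec_def delta0_def)
  have c: "ctrl d U *\<^sub>v unit_vec (2*d) 0 = unit_vec (2*d) 0"
    unfolding e ctrl_pair_vec by (rule pair_vec_cong) (simp_all add: mat_app_def)
  have z: "ctrl d U *\<^sub>v 0\<^sub>v (2*d) = 0\<^sub>v (2*d)" by (rule eq_vecI) (auto simp: ctrl_def)
  have q: "query_op d 3 U True *\<^sub>v exp_vec d (amp_state d U a ?xy) = exp_vec d (amp_out d U a ?xy)"
    unfolding exp_vec_def query_op_3 query_op_1
  proof (subst bdiag_mult_bvec[OF split_index_3])
    fix i :: nat
    let ?h = "\<lambda>\<chi>. if i = 0 then unit_vec (2*d) 0 else if i = 1 then \<chi> else 0\<^sub>v (2*d)"
    show "(1 / complex_of_real (sqrt 2)) \<cdot>\<^sub>v ?h (amp_state d U a ?xy) \<in> carrier_vec (2*d)" using cs by simp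
  next
    show "bvec (2*d*3) (\<lambda>p. p div 3) (\<lambda>p. p mod 3) (\<lambda>i. ctrl d (if True then U else cadj U) *\<^sub>v
        ((1 / complex_of_real (sqrt 2)) \<cdot>\<^sub>v (if i = 0 then unit_vec (2*d) 0 else if i = 1 then amp_state d U a ?xy else 0\<^sub>v (2*d))))
      = bvec (2*d*3) (\<lambda>p. p div 3) (\<lambda>p. p mod 3) (\<lambda>i. (1 / complex_of_real (sqrt 2)) \<cdot>\<^sub>v
         (if i = 0 then unit_vec (2*d) 0 else if i = 1 then amp_out d U a ?xy else 0\<^sub>v (2*d)))"
      by (rule bvec_cong[OF split_index_3])
        (use cs in \<open>simp add: mult_mat_vec[OF ctrl_carrier] c z ctrl_amp_state[OF assms(1)]\<close>)
  qed simp
  have "final_state d (exp_alg d a k) U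
      = alg_run d 3 U (exp_vec d (psi0 d a)) (zip ?L (concat (replicate k [True, False])) @ [(dft_mat (2*d*3), True)])"
    unfolding final_state_alg_run exp_alg_def amp_queries_def
    using exp_alg_prepares(2)[OF assms(2,3)] l by (simp add: qdim_def)
  then show ?thesis
    unfolding alg_run_append run_exp_vec[OF assms] by (simp add: alg_run_def q)
qed

section \<open>Amplitudes as means over Fourier outcomes\<close>

lemma dft_mult_vec:
  assumes "f \<in> carrier_vec M" "m < M"
  shows "(dft_mat M *\<^sub>v f) $ m = (\<Sum>p<M. root1 M (m * p) * f $ p) / sqrt M"
  using assms by (subst mult_mat_vec_index_sum[of _ M M])
    (auto simp: dft_mat_def sum_divide_distrib intro!: sum.cong)

text \<open>The discrete Wiener-Khinchin identity: the Fourier coefficients of the outcome weights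
  are the cyclic autocorrelations of \<open>f\<close>. Expanding the square and applying
  \<open>sum_root1\<close> leaves the pairs of labels that differ by \<open>p0\<close>.\<close>

lemma dft_autocorrelation:
  assumes f: "f \<in> carrier_vec M" and M: "0 < M"
  shows "(\<Sum>m<M. of_real ((cmod ((dft_mat M *\<^sub>v f) $ m))\<^sup>2) * cnj (root1 M (m * p0)))
    = (\<Sum>p<M. \<Sum>p'<M. if p mod M = (p' + p0) mod M then f $ p * cnj (f $ p') else 0)"
proof -
  have sM: "complex_of_real (sqrt M) * complex_of_real (sqrt M) = of_nat M"
    by (simp flip: of_real_mult)
  have prod_eq: "(\<Sum>p<M. root1 M (m * p) * f $ p) * (\<Sum>p'<M. cnj (root1 M (m * p') * f $ p'))
    = (\<Sum>p<M. \<Sum>p'<M. root1 M (m * p) * f $ p * cnj (root1 M (m * p') * f $ p'))" for m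
    by (rule sum_product)
  have "(\<Sum>m<M. of_real ((cmod ((dft_mat M *\<^sub>v f) $ m))\<^sup>2) * cnj (root1 M (m * p0)))
    = (\<Sum>m<M. \<Sum>p<M. \<Sum>p'<M. f $ p * cnj (f $ p') / of_nat M * (root1 M (m * p) * cnj (root1 M (m * (p' + p0)))))"
  proof (intro sum.cong refl)
    fix m assume "m \<in> {..<M}"
    then have m: "m < M" by simp
    have "of_real ((cmod ((dft_mat M *\<^sub>v f) $ m))\<^sup>2) * cnj (root1 M (m * p0))
      = (\<Sum>p<M. root1 M (m * p) * f $ p) * (\<Sum>p'<M. cnj (root1 M (m * p') * f $ p')) / of_nat M * cnj (root1 M (m * p0))"
      unfolding dft_mult_vec[OF f m] by (simp add: complex_norm_square cnj_sum sM del: of_real_power)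
    also have "\<dots> = (\<Sum>p<M. \<Sum>p'<M. root1 M (m * p) * f $ p * cnj (root1 M (m * p') * f $ p') / of_nat M * cnj (root1 M (m * p0)))"
      unfolding prod_eq unfolding sum_divide_distrib sum_distrib_right ..
    also have "\<dots> = (\<Sum>p<M. \<Sum>p'<M. f $ p * cnj (f $ p') / of_nat M * (root1 M (m * p) * cnj (root1 M (m * (p' + p0)))))"
      by (intro sum.cong refl) (simp add: distrib_left root1_add)
    finally show "of_real ((cmod ((dft_mat M *\<^sub>v f) $ m))\<^sup>2) * cnj (root1 M (m * p0)) = \<dots>" .
  qed
  also have "\<dots> = (\<Sum>p<M. \<Sum>p'<M. \<Sum>m<M. f $ p * cnj (f $ p') / of_nat M * (root1 M (m * p) * cnj (root1 M (m * (p' + p0)))))"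
    by (rule trans[OF sum.swap], rule sum.cong[OF refl], rule sum.swap)
  also have "\<dots> = (\<Sum>p<M. \<Sum>p'<M. if p mod M = (p' + p0) mod M then f $ p * cnj (f $ p') else 0)"
    unfolding sum_distrib_left[symmetric] sum_root1[OF M] using M by (intro sum.cong refl) auto
  finally show ?thesis .
qed

text \<open>A shift \<open>p0\<close> of residue \<open>1\<close> modulo \<open>3\<close> connects
  two occupied labels only by leading from the reference to \<open>p0\<close>: from an amplified
  label it leads to residue \<open>2\<close>, which is empty, and wraparound keeps residues since
  \<open>3\<close> divides the modulus. The surviving product is linear in \<open>\<chi>\<close>, so
  phases are not lost.\<close>

lemma exp_vec_autocorrelation:
  assumes \<chi>: "\<chi> \<in> carrier_vec (2*d)" and p0: "p0 < 2*d*3" "p0 mod 3 = 1"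
  shows "(\<Sum>m<2*d*3. of_real ((cmod ((dft_mat (2*d*3) *\<^sub>v exp_vec d \<chi>) $ m))\<^sup>2) * cnj (root1 (2*d*3) (m * p0)))
    = \<chi> $ (p0 div 3) / 2"
proof -
  let ?M = "2*d*3" and ?f = "exp_vec d \<chi>"
  have M: "0 < ?M" using p0 by linarith
  have p00: "p0 \<noteq> 0" using p0 by auto
  have z: "?f $ p = 0" if "p < ?M" "p \<noteq> 0" "p mod 3 \<noteq> 1" for p
    using exp_vec_index[OF \<chi> that(1)] that by simp
  have eq: "(if p mod ?M = (p' + p0) mod ?M then ?f $ p * cnj (?f $ p') else 0)
      = (if p = p0 then (if p' = 0 then ?f $ p0 * cnj (?f $ 0) else 0) else 0)"
    if p: "p < ?M" "p' < ?M" for p p'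
  proof -
    define E where "E \<longleftrightarrow> p mod ?M = (p' + p0) mod ?M"
    have 1: "E \<longleftrightarrow> p = p0" if "p' = 0"
      unfolding E_def that add_0 mod_less[OF p(1)] mod_less[OF p0(1)] ..
    have 2: "?f $ p = 0" if "p' mod 3 = 1" E
    proof (rule z[OF p(1)])
      have d3: "3 dvd ?M" by (rule dvd_triv_right)
      have "p mod 3 = p mod ?M mod 3" by (rule mod_mod_cancel[OF d3, symmetric])
      also have "\<dots> = (p' + p0) mod ?M mod 3" using \<open>E\<close> unfolding E_def by (rule arg_cong)
      also have "\<dots> = (p' + p0) mod 3" by (rule mod_mod_cancel[OF d3])
      also have "\<dots> = (p' mod 3 + p0 mod 3) mod 3" by (rule mod_add_eq[symmetric])
      finally have "p mod 3 = 2" unfolding that(1) p0(2) by simp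
      then show "p \<noteq> 0" "p mod 3 \<noteq> 1" by auto
    qed
    show ?thesis unfolding E_def[symmetric]
      using 1 2 z[OF p(2)] by (cases "p' = 0"; cases "p' mod 3 = 1"; cases E) simp_all
  qed
  have "(\<Sum>m<?M. of_real ((cmod ((dft_mat ?M *\<^sub>v ?f) $ m))\<^sup>2) * cnj (root1 ?M (m * p0)))
     = (\<Sum>p<?M. \<Sum>p'<?M. if p = p0 then (if p' = 0 then ?f $ p0 * cnj (?f $ 0) else 0) else 0)"
    unfolding dft_autocorrelation[OF exp_vec_carrier M] using eq by (intro sum.cong refl) auto
  also have "\<dots> = (\<Sum>p<?M. if p = p0 then ?f $ p0 * cnj (?f $ 0) else 0)"
    using M by (intro sum.cong refl) auto
  also have "\<dots> = ?f $ p0 * cnj (?f $ 0)" using p0 by simp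
  also have "\<dots> = \<chi> $ (p0 div 3) / 2"
    using exp_vec_index[OF \<chi> p0(1)] exp_vec_index[OF \<chi> M] p0 p00 by (simp add: sqrt2_square)
  finally show ?thesis .
qed

definition exp_pmf :: "nat \<Rightarrow> (nat \<Rightarrow> complex) \<Rightarrow> nat \<Rightarrow> complex mat \<Rightarrow> nat pmf" where
  "exp_pmf d a k U = outcome_pmf d (exp_alg d a k) U"

text \<open>The labels \<open>3 * j + 1\<close> and \<open>3 * (d + j) + 1\<close> are entry
  \<open>j\<close> of the two control halves at ancilla level \<open>1\<close>. The prefactor
  \<open>2 * sqrt 2\<close> undoes the \<open>1/2\<close> of the superposition with the reference
  and the \<open>1 / sqrt 2\<close> inside \<open>amp_out\<close>.\<close>

definition amp_est :: "nat \<Rightarrow> nat \<Rightarrow> nat \<Rightarrow> complex" where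
  "amp_est d j m = of_real (2 * sqrt 2) * (cnj (root1 (2*d*3) (m * (3 * j + 1))) - cnj (root1 (2*d*3) (m * (3 * (d + j) + 1))))"

text \<open>Since \<open>4 * sqrt 2 \<le> 6\<close>. This \<open>6\<close> is the source of the
  \<open>72 = 2 * 6\<^sup>2\<close> in the later exponents.\<close>

lemma norm_amp_est: "cmod (amp_est d j m) \<le> 6"
proof -
  have "cmod (amp_est d j m) \<le> 2 * sqrt 2 * (1 + 1)"
    unfolding amp_est_def norm_mult
    by (intro mult_mono order_trans[OF norm_triangle_ineq4]) (auto simp: abs_mult)
  also have "\<dots> \<le> 2 * (3/2) * (1 + 1)"
    by (intro mult_right_mono mult_left_mono real_le_lsqrt) (auto simp: power2_eq_square)
  finally show ?thesis by simp
qed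

lemma exp_achievable:
  assumes "unit_amp d a" "0 < d"
  shows "achievable d 3 (amp_queries k) (exp_pmf d a k)"
  unfolding achievable_def
  by (intro exI[of _ "exp_alg d a k"] exI[of _ id])
    (use exp_alg_valid[OF assms] in \<open>auto simp: exp_alg_def exp_pmf_def\<close>)

lemma finite_set_exp_pmf:
  assumes "unitary_mat d U" "unit_amp d a" "0 < d"
  shows "finite (set_pmf (exp_pmf d a k U))"
  using set_outcome_pmf[OF exp_alg_valid[OF assms(2,3)] assms(1,3)] finite_subset unfolding exp_pmf_def by blast

lemma expectation_amp_est:
  assumes "unitary_mat d U" "unit_amp d a" "0 < d" "j < d"
  shows "measure_pmf.expectation (exp_pmf d a k U) (amp_est d j)
    = of_real (amp_gain (overlap d a (amps d U)) k) * (a j - amps d U j)"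
proof -
  let ?xy = "amp_coeff (overlap d a (amps d U)) k"
  let ?M = "2*d*3" and ?\<chi> = "amp_out d U a (amp_coeff (overlap d a (amps d U)) k)"
  let ?p1 = "3 * j + 1" and ?p2 = "3 * (d + j) + 1"
  note v = exp_alg_valid[OF assms(2,3), of k]
  have a3: "anc (exp_alg d a k) = 3" by (simp add: exp_alg_def)
  have \<chi>: "?\<chi> \<in> carrier_vec (2*d)" by (simp add: amp_out_def)
  have "measure_pmf.expectation (exp_pmf d a k U) (amp_est d j)
    = (\<Sum>m<?M. pmf (exp_pmf d a k U) m *\<^sub>R amp_est d j m)"
    using set_outcome_pmf[OF v assms(1,3)] unfolding exp_pmf_def a3
    by (intro integral_measure_pmf) auto
  also have "\<dots> = (\<Sum>m<?M. of_real (2 * sqrt 2) * (of_real ((cmod ((dft_mat ?M *\<^sub>v exp_vec d ?\<chi>) $ m))\<^sup>2) * cnj (root1 ?M (m * ?p1)))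
      - of_real (2 * sqrt 2) * (of_real ((cmod ((dft_mat ?M *\<^sub>v exp_vec d ?\<chi>) $ m))\<^sup>2) * cnj (root1 ?M (m * ?p2))))"
    unfolding exp_pmf_def pmf_outcome_pmf[OF v assms(1,3)] a3 exp_alg_final_state[OF assms(1-3)] amp_est_def
    by (intro sum.cong refl) (simp add: scaleR_conv_of_real algebra_simps del: of_real_power)
  also have "\<dots> = of_real (2 * sqrt 2) * (?\<chi> $ (?p1 div 3) / 2) - of_real (2 * sqrt 2) * (?\<chi> $ (?p2 div 3) / 2)"
    unfolding sum_subtractf sum_distrib_left[symmetric]
    by (subst (1 2) exp_vec_autocorrelation[OF \<chi>]) (use assms(4) in \<open>auto simp: mod_Suc\<close>)
  also have "\<dots> = of_real (amp_gain (overlap d a (amps d U)) k) * (a j - amps d U j)"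
  proof -
    have i: "?p1 div 3 = j" "?p2 div 3 = d + j" by simp_all
    have v: "?\<chi> $ j = (of_real (fst ?xy) * a j + of_real (snd ?xy) * amps d U j) / sqrt 2"
      "?\<chi> $ (d + j) = (of_real (fst ?xy) * amps d U j + of_real (snd ?xy) * a j) / sqrt 2"
      using assms(4) by (simp_all add: amp_out_def pair_vec_def)
    have e: "of_real (2 * r) * (u / of_real r / 2) - of_real (2 * r) * (v / of_real r / 2) = u - v"
      if "r \<noteq> 0" for r :: real and u v :: complex
      using that by simp
    have r0: "sqrt 2 \<noteq> 0" by simp
    show ?thesis
      unfolding i v e[OF r0] by (simp add: amp_gain_def algebra_simps)
  qed
  finally show ?thesis .
qed

section \<open>Averages of independent samples\<close>

lemma nn_integral_replicate_pmf:
  assumes "(\<integral>\<^sup>+ x. e x \<partial>measure_pmf p) \<le> c"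
  shows "(\<integral>\<^sup>+ xs. (\<Prod>x\<leftarrow>xs. e x) \<partial>measure_pmf (replicate_pmf n p)) \<le> c ^ n"
proof (induction n)
  case (Suc n)
  have "(\<integral>\<^sup>+ xs. (\<Prod>x\<leftarrow>xs. e x) \<partial>measure_pmf (replicate_pmf (Suc n) p))
      = (\<integral>\<^sup>+ x. e x * (\<integral>\<^sup>+ xs. (\<Prod>x\<leftarrow>xs. e x) \<partial>measure_pmf (replicate_pmf n p)) \<partial>measure_pmf p)"
    by (simp add: nn_integral_cmult)
  also have "\<dots> \<le> (\<integral>\<^sup>+ x. e x * c ^ n \<partial>measure_pmf p)"
    using Suc.IH by (intro nn_integral_mono mult_left_mono) auto
  also have "\<dots> = (\<integral>\<^sup>+ x. e x \<partial>measure_pmf p) * c ^ n" by (simp add: nn_integral_multc)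
  also have "\<dots> \<le> c * c ^ n" using assms by (intro mult_right_mono) auto
  finally show ?case by simp
qed simp

text \<open>The Chernoff method: Markov's inequality for the exponential moment, which factors over
  the list, with Hoeffding's lemma for each factor.\<close>

lemma replicate_pmf_tail:
  fixes f :: "'a \<Rightarrow> real" and p :: "'a pmf"
  assumes B: "0 < B" "\<And>x. \<bar>f x\<bar> \<le> B" and t: "0 < t"
  defines "\<mu> \<equiv> measure_pmf.expectation p f"
  shows "measure_pmf.prob (replicate_pmf n p) {xs. real n * t \<le> (\<Sum>x\<leftarrow>xs. f x - \<mu>)} \<le> exp (- real n * t\<^sup>2 / (2 * B\<^sup>2))"
proof -
  interpret interval_bounded_random_variable "measure_pmf p" f "-B" B
    by unfold_locales (use B(2) in \<open>auto simp: abs_le_iff minus_le_iff\<close>)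
  \<comment> \<open>Minimises the exponent per sample,
    \<open>- l * t + l\<^sup>2 * B\<^sup>2 / 2\<close>.\<close>
  define l where "l = t / B\<^sup>2"
  have l: "0 < l" using t B by (simp add: l_def)
  have m: "(\<integral>\<^sup>+ x. ennreal (exp (l * (f x - \<mu>))) \<partial>measure_pmf p) \<le> ennreal (exp (l\<^sup>2 * (2 * B)\<^sup>2 / 8))"
    using Hoeffdings_lemma_nn_integral[OF l] by (simp add: \<mu>_def)
  have pr: "(\<Prod>x\<leftarrow>xs. ennreal (exp (l * (f x - \<mu>)))) = ennreal (exp (l * (\<Sum>x\<leftarrow>xs. f x - \<mu>)))" for xs
    by (induction xs) (simp_all add: distrib_left exp_add ennreal_mult)
  let ?R = "measure_pmf (replicate_pmf n p)" and ?S = "{xs. real n * t \<le> (\<Sum>x\<leftarrow>xs. f x - \<mu>)}"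
  have "emeasure ?R ?S = (\<integral>\<^sup>+ xs. indicator ?S xs \<partial>?R)" by simp
  also have "\<dots> \<le> (\<integral>\<^sup>+ xs. ennreal (exp (- l * (n * t))) * (\<Prod>x\<leftarrow>xs. ennreal (exp (l * (f x - \<mu>)))) \<partial>?R)"
  proof (rule nn_integral_mono)
    fix xs :: "'a list"
    show "indicator ?S xs \<le> ennreal (exp (- l * (n * t))) * (\<Prod>x\<leftarrow>xs. ennreal (exp (l * (f x - \<mu>))))"
    proof (cases "xs \<in> ?S")
      case True
      have "0 \<le> - l * (n * t) + l * (\<Sum>x\<leftarrow>xs. f x - \<mu>)"
        using True l by (simp add: mult_left_mono)
      then have "1 \<le> exp (- l * (n * t)) * exp (l * (\<Sum>x\<leftarrow>xs. f x - \<mu>))"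
        unfolding exp_add[symmetric] by (simp only: one_le_exp_iff)
      then show ?thesis using True unfolding pr by (simp add: ennreal_mult[symmetric])
    qed simp
  qed
  also have "\<dots> = ennreal (exp (- l * (n * t))) * (\<integral>\<^sup>+ xs. (\<Prod>x\<leftarrow>xs. ennreal (exp (l * (f x - \<mu>)))) \<partial>?R)"
    by (simp add: nn_integral_cmult)
  also have "\<dots> \<le> ennreal (exp (- l * (n * t))) * ennreal (exp (l\<^sup>2 * (2 * B)\<^sup>2 / 8)) ^ n"
    by (intro mult_left_mono nn_integral_replicate_pmf m) simp
  also have "\<dots> = ennreal (exp (- l * (n * t) + n * (l\<^sup>2 * (2 * B)\<^sup>2 / 8)))"
    by (simp add: ennreal_power ennreal_mult[symmetric] exp_of_nat_mult[symmetric]) (simp flip: exp_add)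
  also have "- l * (n * t) + n * (l\<^sup>2 * (2 * B)\<^sup>2 / 8) = - real n * t\<^sup>2 / (2 * B\<^sup>2)"
    using B(1) by (simp add: l_def field_simps power2_eq_square)
  finally show ?thesis by (simp add: measure_pmf.emeasure_eq_measure)
qed

lemma sum_list_diff_const: "(\<Sum>x\<leftarrow>xs. f x - (c::complex)) = (\<Sum>x\<leftarrow>xs. f x) - of_nat (length xs) * c"
  by (induction xs) (simp_all add: algebra_simps)

lemma Re_sum_list: "Re (sum_list xs) = (\<Sum>x\<leftarrow>xs. Re x)" by (induction xs) simp_all
lemma Im_sum_list: "Im (sum_list xs) = (\<Sum>x\<leftarrow>xs. Im x)" by (induction xs) simp_all

text \<open>The modulus is at most the sum of the absolute real and imaginary parts, so a deviation
  above twice the threshold puts one of four signed parts above the threshold. This accounts for the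
  factors \<open>2\<close> and \<open>4\<close>.\<close>

lemma replicate_pmf_tail_complex:
  fixes z :: "'a \<Rightarrow> complex" and p :: "'a pmf"
  assumes B: "0 < B" "\<And>x. cmod (z x) \<le> B" and t: "0 < t" and fin: "finite (set_pmf p)"
  defines "\<zeta> \<equiv> measure_pmf.expectation p z"
  shows "measure_pmf.prob (replicate_pmf n p) {xs. 2 * (real n * t) < cmod (\<Sum>x\<leftarrow>xs. z x - \<zeta>)}
    \<le> 4 * exp (- real n * t\<^sup>2 / (2 * B\<^sup>2))"
proof -
  let ?T = "\<lambda>f. {xs. real n * t \<le> (\<Sum>x\<leftarrow>xs. f x - measure_pmf.expectation p f)}"
  let ?E = "exp (- real n * t\<^sup>2 / (2 * B\<^sup>2))"
  let ?P = "measure_pmf.prob (replicate_pmf n p)"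
  have int: "integrable (measure_pmf p) z" using fin by (rule integrable_measure_pmf_finite)
  have re: "measure_pmf.expectation p (\<lambda>x. Re (z x)) = Re \<zeta>" and im: "measure_pmf.expectation p (\<lambda>x. Im (z x)) = Im \<zeta>"
    unfolding \<zeta>_def using int by (auto simp: integral_Re integral_Im)
  have b: "\<bar>Re (z x)\<bar> \<le> B" "\<bar>Im (z x)\<bar> \<le> B" for x
    using B(2)[of x] abs_Re_le_cmod[of "z x"] abs_Im_le_cmod[of "z x"] by linarith+
  have neg: "(\<Sum>x\<leftarrow>xs. - f x - - c) = - (\<Sum>x\<leftarrow>xs. f x - (c::real))" for f :: "'a \<Rightarrow> real" and c xs
    by (induction xs) auto
  have "{xs. 2 * (real n * t) < cmod (\<Sum>x\<leftarrow>xs. z x - \<zeta>)}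
      \<subseteq> (?T (\<lambda>x. Re (z x)) \<union> ?T (\<lambda>x. - Re (z x))) \<union> (?T (\<lambda>x. Im (z x)) \<union> ?T (\<lambda>x. - Im (z x)))"
  proof
    fix xs assume "xs \<in> {xs. 2 * (real n * t) < cmod (\<Sum>x\<leftarrow>xs. z x - \<zeta>)}"
    then have "2 * (real n * t) < \<bar>Re (\<Sum>x\<leftarrow>xs. z x - \<zeta>)\<bar> + \<bar>Im (\<Sum>x\<leftarrow>xs. z x - \<zeta>)\<bar>"
      using cmod_le[of "\<Sum>x\<leftarrow>xs. z x - \<zeta>"] by simp
    then have "2 * (real n * t) < \<bar>\<Sum>x\<leftarrow>xs. Re (z x) - Re \<zeta>\<bar> + \<bar>\<Sum>x\<leftarrow>xs. Im (z x) - Im \<zeta>\<bar>"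
      by (simp add: Re_sum_list Im_sum_list o_def)
    then show "xs \<in> (?T (\<lambda>x. Re (z x)) \<union> ?T (\<lambda>x. - Re (z x))) \<union> (?T (\<lambda>x. Im (z x)) \<union> ?T (\<lambda>x. - Im (z x)))"
      using neg[of "\<lambda>x. Re (z x)" "Re \<zeta>" xs] neg[of "\<lambda>x. Im (z x)" "Im \<zeta>" xs] by (auto simp: re im)
  qed
  then have "?P {xs. 2 * (real n * t) < cmod (\<Sum>x\<leftarrow>xs. z x - \<zeta>)}
      \<le> ?P ((?T (\<lambda>x. Re (z x)) \<union> ?T (\<lambda>x. - Re (z x))) \<union> (?T (\<lambda>x. Im (z x)) \<union> ?T (\<lambda>x. - Im (z x))))"
    by (intro measure_pmf.finite_measure_mono) auto
  also have "\<dots> \<le> (?P (?T (\<lambda>x. Re (z x))) + ?P (?T (\<lambda>x. - Re (z x)))) + (?P (?T (\<lambda>x. Im (z x))) + ?P (?T (\<lambda>x. - Im (z x))))"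
    by (intro order_trans[OF measure_Un_le] add_mono) auto
  also have "\<dots> \<le> (?E + ?E) + (?E + ?E)"
    by (intro add_mono replicate_pmf_tail B t) (use b in auto)
  finally show ?thesis by simp
qed

lemma replicate_pmf_tail_family:
  fixes z :: "nat \<Rightarrow> 'a \<Rightarrow> complex"
  assumes B: "0 < B" "\<And>j x. cmod (z j x) \<le> B" and t: "0 < t" and fin: "finite (set_pmf p)"
  shows "1 - 4 * real d * exp (- real n * t\<^sup>2 / (2 * B\<^sup>2)) \<le> measure_pmf.prob (replicate_pmf n p)
    {xs. \<forall>j<d. cmod ((\<Sum>x\<leftarrow>xs. z j x) - of_nat n * measure_pmf.expectation p (z j)) \<le> 2 * (real n * t)}"
proof -
  let ?R = "replicate_pmf n p" and ?E = "exp (- real n * t\<^sup>2 / (2 * B\<^sup>2))"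
  let ?bad = "\<lambda>j. {xs. 2 * (real n * t) < cmod (\<Sum>x\<leftarrow>xs. z j x - measure_pmf.expectation p (z j))}"
  let ?G = "{xs. \<forall>j<d. cmod ((\<Sum>x\<leftarrow>xs. z j x) - of_nat n * measure_pmf.expectation p (z j)) \<le> 2 * (real n * t)}"
  have "measure_pmf.prob ?R (\<Union>j<d. ?bad j) \<le> (\<Sum>j<d. measure_pmf.prob ?R (?bad j))"
    by (rule measure_pmf.finite_measure_subadditive_finite) auto
  also have "\<dots> \<le> (\<Sum>j<d. 4 * ?E)"
    by (intro sum_mono replicate_pmf_tail_complex[OF B(1) _ t fin]) (rule B(2))
  finally have 1: "measure_pmf.prob ?R (\<Union>j<d. ?bad j) \<le> 4 * real d * ?E" by simp
  \<comment> \<open>Subtracting the mean from every sample, or \<open>n\<close> times from the sum,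
    agrees for lists of length \<open>n\<close>, and almost surely no others occur.\<close>
  have "measure_pmf.prob ?R (- (\<Union>j<d. ?bad j)) \<le> measure_pmf.prob ?R ?G"
  proof (rule measure_pmf.finite_measure_mono_AE)
    show "AE x in measure_pmf ?R. x \<in> - (\<Union>j<d. ?bad j) \<longrightarrow> x \<in> ?G"
      by (auto simp: AE_measure_pmf_iff set_replicate_pmf sum_list_diff_const not_less)
  qed auto
  moreover have "measure_pmf.prob ?R (- (\<Union>j<d. ?bad j)) = 1 - measure_pmf.prob ?R (\<Union>j<d. ?bad j)"
    using measure_pmf.prob_compl[of "\<Union>j<d. ?bad j" ?R] by (simp add: Compl_eq_Diff_UNIV)
  ultimately show ?thesis using 1 by linarith
qed

lemma prob_bind_pmf_ge:
  assumes "x \<le> measure_pmf.prob M G" "\<And>g. g \<in> G \<Longrightarrow> y \<le> measure_pmf.prob (N g) S" "0 \<le> x" "0 \<le> y"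
  shows "x * y \<le> measure_pmf.prob (M \<bind> N) S"
proof -
  have "ennreal (x * y) \<le> emeasure (measure_pmf M) G * ennreal y"
    using assms by (simp add: ennreal_mult measure_pmf.emeasure_eq_measure mult_right_mono ennreal_leI)
  also have "\<dots> = (\<integral>\<^sup>+ g. ennreal y * indicator G g \<partial>measure_pmf M)"
    by (simp add: nn_integral_cmult_indicator mult.commute)
  also have "\<dots> \<le> (\<integral>\<^sup>+ g. emeasure (measure_pmf (N g)) S \<partial>measure_pmf M)"
    using assms(2) by (intro nn_integral_mono) (auto simp: measure_pmf.emeasure_eq_measure ennreal_leI split: split_indicator)
  also have "\<dots> = emeasure (measure_pmf (M \<bind> N)) S" by (rule emeasure_bind_pmf[symmetric])
  finally show ?thesis by (simp add: measure_pmf.emeasure_eq_measure)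
qed

section \<open>Iterative refinement in the supremum norm\<close>

lemma achievable_return:
  assumes "0 < d"
  shows "achievable d 1 [] (\<lambda>_. return_pmf x)"
  unfolding achievable_def
  by (intro exI[of _ "\<lparr>anc = 1, Vs = [1\<^sub>m (2*d)], qs = [], out = \<lambda>_ _. 0\<rparr>"] exI[of _ "\<lambda>_. x"])
    (auto simp: valid_qalg_def qdim_def unitary_mat_one map_pmf_const)

lemma achievable_replicate:
  assumes d: "0 < d"
  shows "\<exists>m. \<forall>P :: complex mat \<Rightarrow> 'a pmf. achievable d b ql P \<longrightarrow>
    achievable d m (concat (replicate n ql)) (\<lambda>U. replicate_pmf n (P U))"
proof (induction n)
  case 0
  show ?case by (intro exI[of _ 1] allI impI) (simp add: achievable_return[OF d, unfolded One_nat_def])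
next
  case (Suc n)
  then obtain m where m: "\<And>P :: complex mat \<Rightarrow> 'a pmf. achievable d b ql P \<Longrightarrow>
    achievable d m (concat (replicate n ql)) (\<lambda>U. replicate_pmf n (P U))" by auto
  have "achievable d (m * (2 * d * b)) (ql @ concat (replicate n ql))
      (\<lambda>U. P U \<bind> (\<lambda>x. map_pmf (\<lambda>xs. x # xs) (replicate_pmf n (P U))))" if "achievable d b ql P" for P :: "complex mat \<Rightarrow> 'a pmf"
    by (rule achievable_bind[OF d that achievable_map[OF m[OF that]]])
  then show ?case by (intro exI[of _ "m * (2 * d * b)"]) (simp add: map_pmf_def)
qed

section \<open>One round of refinement\<close>

definition sup_close :: "nat \<Rightarrow> real \<Rightarrow> (nat \<Rightarrow> complex) \<Rightarrow> (nat \<Rightarrow> complex) set" where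
  "sup_close d s \<alpha> = {b. unit_amp d b \<and> (\<forall>j<d. cmod (b j - \<alpha> j) \<le> s)}"

lemma unit_amp_delta0: "0 < d \<Longrightarrow> unit_amp d delta0"
proof -
  assume "0 < d"
  moreover have "(\<Sum>j<d. (cmod (delta0 j))\<^sup>2) = (\<Sum>j<d. if j = 0 then 1 else 0)"
    by (intro sum.cong) (auto simp: delta0_def)
  ultimately show ?thesis by (simp add: unit_amp_def)
qed

lemma unit_amp_le_1:
  assumes "unit_amp d a" "j < d" shows "cmod (a j) \<le> 1"
proof -
  have "(cmod (a j))\<^sup>2 \<le> (\<Sum>j<d. (cmod (a j))\<^sup>2)" using assms(2) by (intro member_le_sum) auto
  then have "(cmod (a j))\<^sup>2 \<le> 1" using assms(1) by (simp add: unit_amp_def)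
  then show ?thesis by (simp add: power_le_one_iff abs_le_square_iff[symmetric, of _ 1, simplified])
qed

text \<open>Estimates are turned back into unit vectors, which the preparation in
  \<open>exp_alg\<close> and the identity \<open>one_minus_overlap\<close> require. The choice
  depends on the estimate \<open>x\<close> alone; if \<open>x\<close> is within \<open>e\<close> of
  the true amplitudes, these witness that a candidate exists, and the triangle inequality costs a
  factor \<open>2\<close>. The default is again a unit vector for positive \<open>d\<close>.\<close>

definition round_amp :: "nat \<Rightarrow> real \<Rightarrow> (nat \<Rightarrow> complex) \<Rightarrow> nat \<Rightarrow> complex" where
  "round_amp d e x = (if \<exists>b. unit_amp d b \<and> (\<forall>j<d. cmod (b j - x j) \<le> e)
     then SOME b. unit_amp d b \<and> (\<forall>j<d. cmod (b j - x j) \<le> e) else delta0)"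

lemma round_amp_close:
  assumes "unit_amp d \<alpha>" "\<forall>j<d. cmod (\<alpha> j - x j) \<le> e"
  shows "round_amp d e x \<in> sup_close d (2 * e) \<alpha>"
proof -
  let ?P = "\<lambda>b. unit_amp d b \<and> (\<forall>j<d. cmod (b j - x j) \<le> e)"
  have ex: "\<exists>b. ?P b" using assms by blast
  then have r: "?P (round_amp d e x)"
    unfolding round_amp_def if_P[OF ex] by (rule someI_ex)
  have "cmod (round_amp d e x j - \<alpha> j) \<le> 2 * e" if "j < d" for j
  proof -
    have "cmod (round_amp d e x j - \<alpha> j) \<le> cmod (round_amp d e x j - x j) + cmod (\<alpha> j - x j)"
      using norm_triangle_ineq4[of "round_amp d e x j - x j" "\<alpha> j - x j"] by simp
    then show ?thesis using r assms(2) that by fastforce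
  qed
  then show ?thesis using r by (simp add: sup_close_def)
qed

text \<open>\<open>achievable_bind\<close> asks for a continuation at every value of the first
  outcome, including vectors that are not normalised; those are replaced by
  \<open>delta0\<close>.\<close>

definition unit_or_delta0 :: "nat \<Rightarrow> (nat \<Rightarrow> complex) \<Rightarrow> nat \<Rightarrow> complex" where
  "unit_or_delta0 d a = (if unit_amp d a then a else delta0)"

text \<open>The sum is divided by the ideal factor \<open>2 * k + 1\<close> because the true gain
  depends on the unknown overlap.\<close>

definition refine_pmf :: "nat \<Rightarrow> nat \<Rightarrow> nat \<Rightarrow> real \<Rightarrow> (nat \<Rightarrow> complex) \<Rightarrow> complex mat \<Rightarrow> (nat \<Rightarrow> complex) pmf" where
  "refine_pmf d k n e a U = map_pmf
     (\<lambda>ms. round_amp d e (\<lambda>j. unit_or_delta0 d a j - (\<Sum>m\<leftarrow>ms. amp_est d j m) / of_nat (n * (2 * k + 1))))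
     (replicate_pmf n (exp_pmf d (unit_or_delta0 d a) k U))"

definition refine_queries :: "nat \<Rightarrow> nat \<Rightarrow> bool list" where
  "refine_queries k n = concat (replicate n (amp_queries k))"

lemma length_refine_queries: "length (refine_queries k n) = n * (2 * k + 1)"
  by (induction n) (simp_all add: refine_queries_def length_amp_queries)

lemma refine_achievable:
  assumes "0 < d"
  shows "\<exists>m. \<forall>a. achievable d m (refine_queries k n) (refine_pmf d k n e a)"
proof -
  obtain m where m: "\<And>P :: complex mat \<Rightarrow> nat pmf. achievable d 3 (amp_queries k) P \<Longrightarrow>
    achievable d m (refine_queries k n) (\<lambda>U. replicate_pmf n (P U))"
    using achievable_replicate[OF assms] unfolding refine_queries_def by blast
  have "achievable d m (refine_queries k n) (refine_pmf d k n e a)" for a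
  proof -
    have "unit_amp d (unit_or_delta0 d a)" using unit_amp_delta0[OF assms] by (simp add: unit_or_delta0_def)
    from achievable_map[OF m[OF exp_achievable[OF this assms]]]
    show ?thesis unfolding refine_pmf_def .
  qed
  then show ?thesis by blast
qed

text \<open>Polarisation for unit vectors. It turns a supremum bound \<open>s\<close> into the bound
  \<open>d * s\<^sup>2 / 2\<close> on the parameter \<open>\<rho>\<close> that governs the
  gain.\<close>

lemma one_minus_overlap:
  assumes "unit_amp d a" "unit_amp d b"
  shows "1 - overlap d a b = (\<Sum>j<d. (cmod (a j - b j))\<^sup>2) / 2"
proof -
  have e: "(cmod (x - y))\<^sup>2 = (cmod x)\<^sup>2 + (cmod y)\<^sup>2 - 2 * Re (cnj x * y)" for x y
    unfolding cmod_power2 by (simp add: power2_eq_square algebra_simps)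
  show ?thesis using assms
    by (simp add: e sum.distrib sum_subtractf unit_amp_def overlap_def sum_distrib_left[symmetric])
qed

text \<open>
  The gain is linear up to the relative error \<open>d s\<^sup>2 k\<^sup>2 / 2\<close>, and it multiplies a deviation that is
  already at most \<open>s\<close> in every coordinate.
\<close>

lemma refine_pmf_close:
  assumes U: "unitary_mat d U" and d: "0 < d" and a: "a \<in> sup_close d s (amps d U)"
    and s: "0 \<le> s" "d * s\<^sup>2 * (real k)\<^sup>2 \<le> 1" and t: "0 < t" and n: "0 < n"
    and e: "2 * t / (2 * k + 1) + s * (d * s\<^sup>2 * (real k)\<^sup>2) / 2 \<le> e"
  shows "1 - 4 * real d * exp (- real n * t\<^sup>2 / 72) \<le> measure_pmf.prob (refine_pmf d k n e a U) (sup_close d (2 * e) (amps d U))"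
proof -
  let ?\<alpha> = "amps d U"
  define \<rho> where "\<rho> = 1 - overlap d a ?\<alpha>"
  define w where "w = amp_gain (overlap d a ?\<alpha>) k"
  define N where "N = real (2 * k + 1)"
  have N: "0 < N" by (simp add: N_def)
  have ua: "unit_amp d a" and ca: "\<And>j. j < d \<Longrightarrow> cmod (a j - ?\<alpha> j) \<le> s" using a by (auto simp: sup_close_def)
  have uoa: "unit_or_delta0 d a = a" using ua by (simp add: unit_or_delta0_def)
  note u\<alpha> = unit_amp_amps[OF U d]
  have \<rho>: "\<rho> = (\<Sum>j<d. (cmod (a j - ?\<alpha> j))\<^sup>2) / 2" unfolding \<rho>_def by (rule one_minus_overlap[OF ua u\<alpha>])
  have "(\<Sum>j<d. (cmod (a j - ?\<alpha> j))\<^sup>2) \<le> (\<Sum>j<d. s\<^sup>2)" using ca by (intro sum_mono power_mono) auto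
  then have \<rho>1: "\<rho> \<le> d * s\<^sup>2 / 2" unfolding \<rho> by simp
  have \<rho>0: "0 \<le> \<rho>" unfolding \<rho> by (simp add: sum_nonneg)
  have rk: "\<rho> * (real k)\<^sup>2 \<le> d * s\<^sup>2 * (real k)\<^sup>2 / 2" using mult_right_mono[OF \<rho>1, of "(real k)\<^sup>2"] by simp
  have wN: "\<bar>1 - w / N\<bar> \<le> d * s\<^sup>2 * (real k)\<^sup>2 / 2"
  proof -
    have "\<rho> * (real k)\<^sup>2 \<le> 1/2" using rk s(2) by linarith
    from amp_gain_bound[OF \<rho>0 this] rk show ?thesis by (simp add: w_def N_def \<rho>_def)
  qed
  let ?G = "{ms. \<forall>j<d. cmod ((\<Sum>m\<leftarrow>ms. amp_est d j m)
      - of_nat n * measure_pmf.expectation (exp_pmf d a k U) (amp_est d j)) \<le> 2 * (real n * t)}"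
  have "1 - 4 * real d * exp (- real n * t\<^sup>2 / (2 * 6\<^sup>2)) \<le> measure_pmf.prob (replicate_pmf n (exp_pmf d a k U)) ?G"
    by (rule replicate_pmf_tail_family) (use norm_amp_est t finite_set_exp_pmf[OF U ua d] in auto)
  also have "\<dots> \<le> measure_pmf.prob (refine_pmf d k n e a U) (sup_close d (2 * e) ?\<alpha>)"
    unfolding refine_pmf_def uoa measure_map_pmf
  proof (rule measure_pmf.finite_measure_mono)
    show "?G \<subseteq> (\<lambda>ms. round_amp d e (\<lambda>j. a j - (\<Sum>m\<leftarrow>ms. amp_est d j m) / of_nat (n * (2 * k + 1)))) -` sup_close d (2 * e) ?\<alpha>"
    proof
      fix ms assume ms: "ms \<in> ?G"
      let ?x = "\<lambda>j. a j - (\<Sum>m\<leftarrow>ms. amp_est d j m) / of_nat (n * (2 * k + 1))"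
      have "cmod (?\<alpha> j - ?x j) \<le> e" if j: "j < d" for j
      proof -
        define S where "S = (\<Sum>m\<leftarrow>ms. amp_est d j m)"
        define y where "y = a j - ?\<alpha> j"
        have S: "cmod (S - of_nat n * (of_real w * y)) \<le> 2 * (real n * t)"
          using ms j unfolding S_def y_def w_def expectation_amp_est[OF U ua d j, symmetric] by simp
        have nN: "of_nat (n * (2 * k + 1)) = complex_of_real (real n * N)" by (simp add: N_def algebra_simps)
        \<comment> \<open>Sampling error of the average, and bias from dividing by \<open>N\<close>
          instead of the true gain \<open>w\<close>.\<close>
        have "?\<alpha> j - ?x j = (S - of_nat n * (of_real w * y)) / of_real (real n * N) - of_real (1 - w / N) * y"
          using n N unfolding nN S_def[symmetric] y_def by (simp add: field_simps)
        then have "cmod (?\<alpha> j - ?x j) \<le> cmod (S - of_nat n * (of_real w * y)) / (real n * N) + \<bar>1 - w / N\<bar> * cmod y"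
          using norm_triangle_ineq4[of "(S - of_nat n * (of_real w * y)) / of_real (real n * N)" "of_real (1 - w / N) * y"] n N
          by (simp only: norm_divide norm_mult norm_of_real) (simp add: abs_mult)
        also have "\<dots> \<le> 2 * (real n * t) / (real n * N) + (d * s\<^sup>2 * (real k)\<^sup>2 / 2) * s"
          using S wN ca[OF j] n N by (intro add_mono divide_right_mono mult_mono) (auto simp: y_def)
        also have "\<dots> = 2 * t / N + s * (d * s\<^sup>2 * (real k)\<^sup>2) / 2" using n by simp
        also have "\<dots> \<le> e" using e by (simp add: N_def add.commute)
        finally show ?thesis .
      qed
      then show "ms \<in> (\<lambda>ms. round_amp d e (\<lambda>j. a j - (\<Sum>m\<leftarrow>ms. amp_est d j m) / of_nat (n * (2 * k + 1)))) -` sup_close d (2 * e) ?\<alpha>"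
        using round_amp_close[OF u\<alpha>, of ?x e] by simp
    qed
  qed simp
  finally show ?thesis by simp
qed

lemma failure_le:
  assumes "0 < d" "0 < \<delta>" "0 < t" "72 * ln (4 * real d / \<delta>) / t\<^sup>2 \<le> real n"
  shows "4 * real d * exp (- real n * t\<^sup>2 / 72) \<le> \<delta>"
proof -
  have "ln (4 * real d / \<delta>) \<le> real n * t\<^sup>2 / 72" using assms(3,4) by (simp add: field_simps)
  then have "exp (- real n * t\<^sup>2 / 72) \<le> exp (- ln (4 * real d / \<delta>))" by simp
  also have "\<dots> = \<delta> / (4 * real d)" using assms(1,2) by (simp add: exp_minus)
  finally show ?thesis using assms(1) by (simp add: field_simps)
qed

text \<open>The \<open>4\<close> from the four signed tails keeps the logarithm at least
  \<open>1\<close> even for \<open>d = 1\<close> and \<open>\<delta>\<close> near \<open>1\<close>,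
  so that rounding up a number of samples only adds one unit to a constant.\<close>

lemma one_le_ln_4:
  assumes "0 < d" "0 < \<delta>" "\<delta> < 1"
  shows "1 \<le> ln (4 * real d / \<delta>)"
proof -
  have "exp 1 \<le> (3::real)" by (rule exp_le)
  also have "3 \<le> 4 * real d" using assms(1) by simp
  also have "\<dots> \<le> 4 * real d / \<delta>" using assms by (simp add: field_simps)
  finally show ?thesis using assms by (subst ln_ge_iff) auto
qed

lemma sup_close_mono: "s \<le> s' \<Longrightarrow> sup_close d s \<alpha> \<subseteq> sup_close d s' \<alpha>"
  by (auto simp: sup_close_def intro: order_trans)

lemma delta0_sup_close:
  assumes "0 < d" "unit_amp d \<alpha>" shows "delta0 \<in> sup_close d 2 \<alpha>"
proof -
  have "cmod (delta0 j - \<alpha> j) \<le> 2" if "j < d" for j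
    using norm_triangle_ineq4[of "delta0 j" "\<alpha> j"] unit_amp_le_1[OF unit_amp_delta0[OF assms(1)] that]
      unit_amp_le_1[OF assms(2) that] by linarith
  then show ?thesis using unit_amp_delta0[OF assms(1)] by (simp add: sup_close_def)
qed

section \<open>Query cost of accuracy in the supremum norm\<close>

definition learns :: "nat \<Rightarrow> real \<Rightarrow> real \<Rightarrow> real \<Rightarrow> bool" where
  "learns d T s \<delta> \<longleftrightarrow> (\<exists>m ql P. achievable d m ql P \<and> real (length ql) \<le> T \<and>
     (\<forall>U. unitary_mat d U \<longrightarrow> 1 - \<delta> \<le> measure_pmf.prob (P U) (sup_close d s (amps d U))))"

text \<open>With \<open>k = 0\<close> the bias term vanishes, so the trivial start
  \<open>delta0\<close> of accuracy \<open>2\<close> suffices. The choices \<open>t = s/4\<close>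
  and \<open>e = s/2\<close> give \<open>72 * 16 = 1152\<close>, and \<open>1153\<close> absorbs the
  ceiling.\<close>

lemma learns_direct:
  assumes d: "0 < d" and s: "0 < s" "s \<le> 1" and \<delta>: "0 < \<delta>" "\<delta> < 1"
  shows "learns d (1153 * ln (4 * real d / \<delta>) / s\<^sup>2) s \<delta>"
proof -
  define l where "l = ln (4 * real d / \<delta>)"
  define n where "n = nat \<lceil>1152 * l / s\<^sup>2\<rceil>"
  have l: "1 \<le> l" unfolding l_def by (rule one_le_ln_4[OF d \<delta>])
  have "s\<^sup>2 \<le> 1" using s by (simp add: power_le_one)
  then have ls: "1 \<le> l / s\<^sup>2" using l s by (simp add: field_simps)
  have n1: "1152 * l / s\<^sup>2 \<le> real n" unfolding n_def by (rule real_nat_ceiling_ge)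
  have n2: "real n \<le> 1153 * l / s\<^sup>2"
  proof -
    have "real n \<le> 1152 * l / s\<^sup>2 + 1" using l s unfolding n_def by simp
    then show ?thesis using ls by simp
  qed
  have n0: "0 < n" using n1 ls by (metis less_numeral_extra(1) mult.commute mult_eq_0_iff not_gr_zero of_nat_0 order_less_le_trans times_divide_eq_right zero_less_mult_iff not_less zero_less_numeral)
  obtain m where m: "\<And>a. achievable d m (refine_queries 0 n) (refine_pmf d 0 n (s/2) a)"
    using refine_achievable[OF d] by blast
  show ?thesis unfolding learns_def l_def[symmetric]
  proof (intro exI conjI allI impI)
    show "achievable d m (refine_queries 0 n) (refine_pmf d 0 n (s/2) delta0)" by (rule m)
    show "real (length (refine_queries 0 n)) \<le> 1153 * l / s\<^sup>2" using n2 by (simp add: length_refine_queries)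
    fix U assume U: "unitary_mat d U"
    have "1 - 4 * real d * exp (- real n * (s/4)\<^sup>2 / 72) \<le> measure_pmf.prob (refine_pmf d 0 n (s/2) delta0 U) (sup_close d (2 * (s/2)) (amps d U))"
      by (rule refine_pmf_close[OF U d delta0_sup_close[OF d unit_amp_amps[OF U d]]]) (use s n0 in auto)
    moreover have "4 * real d * exp (- real n * (s/4)\<^sup>2 / 72) \<le> \<delta>"
      using n1 s by (intro failure_le d \<delta>) (auto simp: l_def power2_eq_square)
    ultimately show "1 - \<delta> \<le> measure_pmf.prob (refine_pmf d 0 n (s/2) delta0 U) (sup_close d s (amps d U))" by simp
  qed
qed

text \<open>The induction peels off the last round with failure \<open>\<delta>/2\<close> and leaves
  \<open>\<delta>/2\<close> to the earlier ones. This raises the logarithm \<open>L\<close> by at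
  most \<open>1\<close>, and \<open>2 ^ K * (2 * (L + 1) + 4) + 2 ^ K * 2 * (L + 1) = 2 ^ (K + 1) *
  (2 * L + 4)\<close>; the summand \<open>4\<close> pays for the growing logarithms.\<close>

lemma learns_refined:
  assumes d: "0 < d" and \<delta>: "0 < \<delta>" "\<delta> < 1"
  shows "learns d (73729 * real d * 2 ^ K * (2 * ln (4 * real d / \<delta>) + 4)) (1 / (2 ^ K * sqrt d)) \<delta>"
  using \<delta>
proof (induction K arbitrary: \<delta>)
  case 0
  have l: "1 \<le> ln (4 * real d / \<delta>)" by (rule one_le_ln_4[OF d 0])
  have "learns d (1153 * ln (4 * real d / \<delta>) / (1 / sqrt d)\<^sup>2) (1 / sqrt d) \<delta>"
    using d 0 by (intro learns_direct) auto
  moreover have "1153 * ln (4 * real d / \<delta>) / (1 / sqrt d)\<^sup>2 \<le> 73729 * real d * (2 * ln (4 * real d / \<delta>) + 4)"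
  proof -
    have "1153 * ln (4 * real d / \<delta>) / (1 / sqrt d)\<^sup>2 = real d * (1153 * ln (4 * real d / \<delta>))"
      by (simp add: power_divide)
    also have "\<dots> \<le> real d * (73729 * (2 * ln (4 * real d / \<delta>) + 4))" using l by (intro mult_left_mono) auto
    also have "\<dots> = 73729 * real d * (2 * ln (4 * real d / \<delta>) + 4)" by (simp add: algebra_simps)
    finally show ?thesis .
  qed
  ultimately show ?case unfolding learns_def by (auto intro: order_trans)
next
  case (Suc K)
  define x where "x = (2::real) ^ K"
  define l where "l = ln (4 * real d / (\<delta>/2))"
  define s where "s = 1 / (x * sqrt d)"
  \<comment> \<open>The sampling error becomes at most \<open>3/16 * s\<close>; with the bias of at
    most \<open>s/32\<close> it stays below \<open>e = s/4\<close>, and rounding gives radius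
    \<open>s/2\<close>. The sample size has the factor
    \<open>72 * 32\<^sup>2 = 73728\<close>.\<close>
  define t where "t = 1 / (32 * sqrt d)"
  \<comment> \<open>Gives \<open>k * s * sqrt d \<le> 1/4\<close> by \<open>k4\<close>; in the first
    rounds it is \<open>0\<close>, where \<open>k3\<close> still holds.\<close>
  define k where "k = (2::nat) ^ K div 4"
  define n where "n = nat \<lceil>73728 * real d * l\<rceil>"
  have x: "1 \<le> x" by (simp add: x_def)
  have d1: "1 \<le> real d" using d by simp
  have l: "1 \<le> l" unfolding l_def by (rule one_le_ln_4[OF d]) (use Suc.prems in auto)
  have l': "l \<le> ln (4 * real d / \<delta>) + 1"
  proof -
    have "l = ln (4 * real d / \<delta> * 2)" by (simp add: l_def)
    also have "\<dots> = ln (4 * real d / \<delta>) + ln 2" using d Suc.prems by (intro ln_mult_pos) auto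
    finally show ?thesis using ln_2_less_1 by simp
  qed
  have dl: "1 \<le> real d * l" using mult_mono[OF d1 l] by simp
  have k4: "4 * real k \<le> x"
  proof -
    have "4 * k \<le> 2 ^ K" by (simp add: k_def)
    then have "real (4 * k) \<le> real (2 ^ K)" by (rule of_nat_mono)
    then show ?thesis by (simp add: x_def)
  qed
  have k3: "x \<le> 3 * (2 * real k + 1)"
  proof -
    have "(2::nat) ^ K \<le> 4 * k + 3" by (simp add: k_def)
    then have "real (2 ^ K) \<le> real (4 * k + 3)" by (rule of_nat_mono)
    then show ?thesis by (simp add: x_def)
  qed
  have n1: "73728 * real d * l \<le> real n" unfolding n_def by (rule real_nat_ceiling_ge)
  have n2: "real n \<le> 73729 * (real d * l)"
  proof -
    have "real n \<le> 73728 * real d * l + 1" using dl unfolding n_def by simp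
    then show ?thesis using dl by simp
  qed
  have n0: "0 < n"
  proof -
    have "73728 * (real d * l) \<le> real n" using n1 by (simp only: mult.assoc)
    then have "0 < real n" using dl by linarith
    then show ?thesis by simp
  qed
  have s0: "0 < s" and t0: "0 < t" using x d by (auto simp: s_def t_def)
  have dsk: "d * s\<^sup>2 * (real k)\<^sup>2 \<le> 1/16"
  proof -
    have "d * s\<^sup>2 * (real k)\<^sup>2 = (real k / x)\<^sup>2"
      using d by (simp add: s_def power_divide power_mult_distrib)
    also have "\<dots> \<le> (1/4)\<^sup>2" using k4 x by (intro power_mono) (auto simp: field_simps)
    finally show ?thesis by (simp add: power2_eq_square)
  qed
  define e where "e = s / 4"
  have eb: "2 * t / (2 * real k + 1) + s * (d * s\<^sup>2 * (real k)\<^sup>2) / 2 \<le> e"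
  proof -
    have "2 * t / (2 * real k + 1) \<le> 6 * t / x"
      using k3 x t0 by (simp add: divide_simps)
    also have "\<dots> = 3/16 * s" using x d by (simp add: s_def t_def field_simps)
    finally have "2 * t / (2 * real k + 1) \<le> 3/16 * s" .
    moreover have "s * (d * s\<^sup>2 * (real k)\<^sup>2) / 2 \<le> s * (1/16) / 2"
      using dsk s0 by (intro divide_right_mono mult_left_mono) auto
    ultimately show ?thesis unfolding e_def using s0 by linarith
  qed
  obtain m1 ql1 P1 where 1: "achievable d m1 ql1 P1" "real (length ql1) \<le> 73729 * real d * x * (2 * l + 4)"
    "\<And>U. unitary_mat d U \<Longrightarrow> 1 - \<delta>/2 \<le> measure_pmf.prob (P1 U) (sup_close d s (amps d U))"
    using Suc.IH[of "\<delta>/2"] Suc.prems unfolding learns_def x_def[symmetric] l_def[symmetric] s_def[symmetric] by auto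
  obtain m2 where m2: "\<And>a. achievable d m2 (refine_queries k n) (refine_pmf d k n e a)"
    using refine_achievable[OF d] by blast
  show ?case unfolding learns_def
  proof (intro exI conjI allI impI)
    show "achievable d (m2 * (2 * d * m1)) (ql1 @ refine_queries k n) (\<lambda>U. P1 U \<bind> (\<lambda>a. refine_pmf d k n e a U))"
      by (rule achievable_bind[OF d 1(1) m2])
    have "real (n * (2 * k + 1)) = real n * (2 * real k + 1)" by (simp add: algebra_simps)
    also have "\<dots> \<le> 73729 * (real d * l) * (2 * x)"
      using n2 k4 x dl by (intro mult_mono) auto
    finally have "real (length (ql1 @ refine_queries k n)) \<le> 73729 * real d * x * (2 * l + 4) + 73729 * (real d * l) * (2 * x)"
      using 1(2) by (simp add: length_refine_queries)
    also have "\<dots> = 73729 * real d * x * (4 * l + 4)" by (simp add: algebra_simps)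
    also have "\<dots> \<le> 73729 * real d * x * (2 * (2 * ln (4 * real d / \<delta>) + 4))"
      using l' x d by (intro mult_left_mono) auto
    also have "\<dots> = 73729 * real d * 2 ^ Suc K * (2 * ln (4 * real d / \<delta>) + 4)" by (simp add: x_def)
    finally show "real (length (ql1 @ refine_queries k n)) \<le> 73729 * real d * 2 ^ Suc K * (2 * ln (4 * real d / \<delta>) + 4)" .
    fix U assume U: "unitary_mat d U"
    have r: "1 - \<delta>/2 \<le> measure_pmf.prob (refine_pmf d k n e a U) (sup_close d (2 * e) (amps d U))"
      if a: "a \<in> sup_close d s (amps d U)" for a
    proof -
      have "4 * real d * exp (- real n * t\<^sup>2 / 72) \<le> \<delta> / 2"
        using n1 d Suc.prems t0
        by (intro failure_le) (auto simp: l_def t_def power_divide power_mult_distrib algebra_simps)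
      moreover have "1 - 4 * real d * exp (- real n * t\<^sup>2 / 72) \<le> measure_pmf.prob (refine_pmf d k n e a U) (sup_close d (2 * e) (amps d U))"
        by (rule refine_pmf_close[OF U d a _ _ t0 n0 eb]) (use s0 dsk in auto)
      ultimately show ?thesis by linarith
    qed
    have "1 - \<delta> \<le> (1 - \<delta>/2) * (1 - \<delta>/2)" by (simp add: algebra_simps)
    also have "\<dots> \<le> measure_pmf.prob (P1 U \<bind> (\<lambda>a. refine_pmf d k n e a U)) (sup_close d (2 * e) (amps d U))"
      using prob_bind_pmf_ge[OF 1(3)[OF U] r] Suc.prems by simp
    also have "2 * e = 1 / (2 ^ Suc K * sqrt d)" using x by (simp add: e_def s_def x_def)
    finally show "1 - \<delta> \<le> measure_pmf.prob (P1 U \<bind> (\<lambda>a. refine_pmf d k n e a U)) (sup_close d (1 / (2 ^ Suc K * sqrt d)) (amps d U))" .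
  qed
qed

lemma learns_mono:
  assumes "learns d T s \<delta>" "T \<le> T'" "s \<le> s'"
  shows "learns d T' s' \<delta>"
proof -
  obtain m ql P where 1: "achievable d m ql P" "real (length ql) \<le> T"
    "\<And>U. unitary_mat d U \<Longrightarrow> 1 - \<delta> \<le> measure_pmf.prob (P U) (sup_close d s (amps d U))"
    using assms(1) unfolding learns_def by auto
  have "1 - \<delta> \<le> measure_pmf.prob (P U) (sup_close d s' (amps d U))" if "unitary_mat d U" for U
    using 1(3)[OF that] measure_pmf.finite_measure_mono[OF sup_close_mono[OF assms(3)], of d "amps d U" "P U"] by simp
  then show ?thesis unfolding learns_def using 1 assms(2) by (meson order_trans)
qed

text \<open>For \<open>s * sqrt d \<ge> 1\<close> plain sampling is the cheaper choice. Otherwise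
  the least sufficient power of two overshoots by at most a factor \<open>2\<close>, and
  \<open>2 * l + 4 \<le> 6 * l\<close>; hence \<open>884748 = 73729 * 2 * 6\<close>.\<close>

theorem learns_sup_norm:
  assumes d: "0 < d" and s: "0 < s" "s \<le> 1" and \<delta>: "0 < \<delta>" "\<delta> < 1"
  shows "learns d (884748 * min (1 / s\<^sup>2) (sqrt d / s) * ln (4 * real d / \<delta>)) s \<delta>"
proof -
  define l where "l = ln (4 * real d / \<delta>)"
  have l: "1 \<le> l" unfolding l_def by (rule one_le_ln_4[OF d \<delta>])
  have sd: "0 < s * sqrt d" using s d by simp
  show ?thesis
  proof (cases "1 \<le> s * sqrt d")
    case True
    have "1 / s\<^sup>2 \<le> sqrt d / s" using True s by (simp add: field_simps power2_eq_square)
    then have m: "min (1 / s\<^sup>2) (sqrt d / s) = 1 / s\<^sup>2" by simp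
    have "1153 * l / s\<^sup>2 \<le> 884748 * (1 / s\<^sup>2) * l" using l s by (simp add: divide_right_mono)
    then show ?thesis unfolding m
      using learns_mono[OF learns_direct[OF d s \<delta>]] unfolding l_def by simp
  next
    case False
    define K where "K = (LEAST K. 1 / (s * sqrt d) \<le> (2::real) ^ K)"
    have "\<exists>K. 1 / (s * sqrt d) \<le> (2::real) ^ K"
      using real_arch_pow[of 2 "1 / (s * sqrt d)"] by (auto intro: less_imp_le)
    then have K1: "1 / (s * sqrt d) \<le> 2 ^ K" unfolding K_def by (rule LeastI_ex)
    have K2: "2 ^ K \<le> 2 / (s * sqrt d)"
    proof (cases K)
      case 0
      then show ?thesis using False sd by (simp add: field_simps)
    next
      case (Suc K')
      then have "\<not> 1 / (s * sqrt d) \<le> (2::real) ^ K'" using not_less_Least[of K' "\<lambda>K. 1 / (s * sqrt d) \<le> (2::real) ^ K"] by (simp add: K_def)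
      then show ?thesis using Suc by simp
    qed
    have "sqrt d / s \<le> 1 / s\<^sup>2" using False s by (simp add: field_simps power2_eq_square)
    then have m: "min (1 / s\<^sup>2) (sqrt d / s) = sqrt d / s" by simp
    have "73729 * real d * 2 ^ K * (2 * l + 4) \<le> 73729 * real d * (2 / (s * sqrt d)) * (6 * l)"
      using K2 l s by (intro mult_mono) auto
    also have "\<dots> = 884748 * (real d / sqrt d / s) * l" by (simp add: field_simps)
    also have "real d / sqrt d = sqrt d" by (rule real_div_sqrt) simp
    finally have T: "73729 * real d * 2 ^ K * (2 * l + 4) \<le> 884748 * (sqrt d / s) * l" .
    have "1 / (2 ^ K * sqrt d) \<le> s" using K1 sd d by (simp add: field_simps)
    from learns_mono[OF learns_refined[OF d \<delta>, of K] _ this] T show ?thesis unfolding m l_def by simp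
  qed
qed


section \<open>Random guessing on a circle\<close>

text \<open>
  For \<open>d = 1\<close> and \<open>\<delta>\<close> close to \<open>1\<close> the query bound \<open>ln (1/\<delta>)/\<epsilon>\<close> is below the cost of any estimate of
  accuracy \<open>\<epsilon>\<close>; a coarser estimate followed by a random guess in its neighbourhood still succeeds
  with probability \<open>1 - \<delta>\<close>.
\<close>

lemma achievable_uniform:
  assumes d: "0 < d" and M: "0 < M"
  shows "\<exists>P. achievable d M [] P \<and>
    (\<forall>U i. unitary_mat d U \<longrightarrow> i < 2*d*M \<longrightarrow> pmf (P U) i = 1 / real (2*d*M))"
proof -
  let ?N = "2*d*M"
  have N: "0 < ?N" using d M by simp
  let ?A = "\<lparr>anc = M, Vs = [dft_mat ?N], qs = [], out = \<lambda>_ _. 0\<rparr>"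
  have v: "valid_qalg d ?A" using M unitary_dft_mat[OF N] by (simp add: valid_qalg_def qdim_def)
  have "pmf (outcome_pmf d ?A U) i = 1 / real ?N" if "unitary_mat d U" and i: "i < ?N" for U i
  proof -
    have "final_state d ?A U $ i = (dft_mat ?N *\<^sub>v unit_vec ?N 0) $ i"
      by (simp add: final_state_def qdim_def)
    also have "\<dots> = (\<Sum>p<?N. root1 ?N (i * p) * unit_vec ?N 0 $ p) / sqrt ?N"
      by (rule dft_mult_vec[OF unit_vec_carrier i])
    also have "(\<Sum>p<?N. root1 ?N (i * p) * unit_vec ?N 0 $ p) = (\<Sum>p<?N. if p = 0 then 1 else 0)"
      using N by (intro sum.cong) (auto simp: root1_def)
    finally have "final_state d ?A U $ i = 1 / sqrt ?N" using N by simp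
    then show ?thesis using pmf_outcome_pmf[OF v that(1) d, of i] i
      by (simp add: norm_divide power_divide)
  qed
  moreover have "achievable d M [] (outcome_pmf d ?A)"
    unfolding achievable_def by (intro exI[of _ ?A] exI[of _ id]) (use v in simp)
  ultimately show ?thesis by blast
qed

section \<open>Angles and chords on the unit circle\<close>

lemma third_le_abs_sin:
  assumes "\<bar>x\<bar> \<le> pi / 2"
  shows "\<bar>x\<bar> / 3 \<le> \<bar>sin x\<bar>"
proof -
  have "\<bar>sin x - (\<Sum>m<3. sin_coeff m * x ^ m)\<bar> \<le> inverse (fact 3) * \<bar>x\<bar> ^ 3"
    by (rule Maclaurin_sin_bound)
  then have 1: "\<bar>sin x - x\<bar> \<le> \<bar>x\<bar> ^ 3 / 6"
    by (simp add: numeral_3_eq_3 sin_coeff_def fact_numeral field_simps)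
  \<comment> \<open>In this range the cubic Taylor remainder is at most \<open>2/3 * |x|\<close>,
    which leaves a third.\<close>
  have "\<bar>x\<bar> \<le> 2" using assms pi_less_4 by linarith
  then have "\<bar>x\<bar>\<^sup>2 \<le> 2\<^sup>2" by (intro power_mono) auto
  then have "\<bar>x\<bar> * \<bar>x\<bar>\<^sup>2 \<le> \<bar>x\<bar> * 4" by (intro mult_left_mono) auto
  then have "\<bar>x\<bar> ^ 3 / 6 \<le> 2 / 3 * \<bar>x\<bar>" by (simp add: power3_eq_cube power2_eq_square)
  then show ?thesis using 1 by linarith
qed

lemma cmod_cis_minus_1: "cmod (cis x - 1) = 2 * \<bar>sin (x / 2)\<bar>"
proof -
  have "(cmod (cis x - 1))\<^sup>2 = (cos x - 1)\<^sup>2 + (sin x)\<^sup>2" by (simp add: cmod_power2)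
  also have "\<dots> = 2 - 2 * cos x"
    using sin_cos_squared_add[of x] by (simp add: power2_eq_square algebra_simps)
  also have "\<dots> = (2 * \<bar>sin (x / 2)\<bar>)\<^sup>2"
    using cos_double_sin[of "x / 2"] by (simp add: power_mult_distrib)
  finally show ?thesis by (rule power2_eq_imp_eq) auto
qed

lemma cmod_cis_diff_le: "cmod (cis x - cis y) \<le> \<bar>x - y\<bar>"
proof -
  have "cis x - cis y = cis y * (cis (x - y) - 1)" by (simp add: cis_mult algebra_simps)
  then have "cmod (cis x - cis y) = 2 * \<bar>sin ((x - y) / 2)\<bar>" by (simp add: norm_mult cmod_cis_minus_1)
  also have "\<dots> \<le> 2 * \<bar>(x - y) / 2\<bar>" by (intro mult_left_mono abs_sin_x_le_abs_x) simp
  finally show ?thesis by simp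
qed

text \<open>The chord has length \<open>2 * |sin (\<phi> / 2)|\<close>, and taking
  \<open>\<phi>\<close> as a principal argument keeps \<open>\<phi> / 2\<close> in the range of
  \<open>third_le_abs_sin\<close>.\<close>

lemma circle_angle:
  assumes "cmod z = 1" "cmod w = 1" "cmod (z - w) \<le> s"
  obtains \<phi> where "w = z * cis \<phi>" "\<bar>\<phi>\<bar> \<le> 3 * s"
proof
  let ?\<phi> = "Arg (w / z)"
  have u: "cmod (w / z) = 1" using assms by (simp add: norm_divide)
  have z: "z \<noteq> 0" using assms(1) by auto
  have wz: "w / z \<noteq> 0" using u by force
  have "cis ?\<phi> = sgn (w / z)" by (rule cis_Arg[OF wz])
  also have "\<dots> = w / z" unfolding sgn_div_norm u by simp
  finally have c: "cis ?\<phi> = w / z" .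
  then show w: "w = z * cis ?\<phi>" using z by simp
  have "w - z = z * (cis ?\<phi> - 1)" using w by (simp add: algebra_simps)
  then have "cmod (w - z) = 2 * \<bar>sin (?\<phi> / 2)\<bar>"
    using assms(1) by (simp add: norm_mult cmod_cis_minus_1)
  then have "cmod (z - w) = 2 * \<bar>sin (?\<phi> / 2)\<bar>" by (simp only: norm_minus_commute)
  moreover have "\<bar>?\<phi> / 2\<bar> / 3 \<le> \<bar>sin (?\<phi> / 2)\<bar>"
    using Arg_bounded[of "w / z"] by (intro third_le_abs_sin) auto
  ultimately show "\<bar>?\<phi>\<bar> \<le> 3 * s" using assms(3) by linarith
qed

lemma nat_cell:
  fixes y :: real
  assumes "0 \<le> y" "y \<le> real N" "0 < N"
  obtains i where "i < N" "\<bar>y - (real i + 1/2)\<bar> \<le> 1/2"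
proof (cases "y = real N")
  case True
  then show ?thesis using that[of "N - 1"] assms(3) by (simp add: of_nat_diff)
next
  case False
  let ?i = "nat \<lfloor>y\<rfloor>"
  have "real ?i \<le> y" "y < real ?i + 1" using assms(1) by linarith+
  moreover have "?i < N" using assms False \<open>real ?i \<le> y\<close> by linarith
  moreover have "\<bar>y - (real ?i + 1/2)\<bar> \<le> 1/2" using \<open>real ?i \<le> y\<close> \<open>y < real ?i + 1\<close> by linarith
  ultimately show ?thesis using that by blast
qed

lemma random_guess:
  assumes P: "achievable 1 m ql P" and s: "0 < s" and M: "0 < M" "3 * s \<le> real (2 * M) * \<epsilon>" and r: "0 \<le> r"
    and close: "\<And>U. unitary_mat 1 U \<Longrightarrow> r \<le> measure_pmf.prob (P U) (sup_close 1 s (amps 1 U))"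
  shows "\<exists>m' P'. achievable 1 m' ql P' \<and>
    (\<forall>U. unitary_mat 1 U \<longrightarrow> r / real (2 * M) \<le> measure_pmf.prob (P' U) (sup_close 1 \<epsilon> (amps 1 U)))"
proof -
  define N where "N = 2 * M"
  have N: "0 < N" using M by (simp add: N_def)
  obtain R where R: "achievable 1 M [] R" "\<And>U i. unitary_mat 1 U \<Longrightarrow> i < N \<Longrightarrow> pmf (R U) i = 1 / real N"
    using achievable_uniform[of 1 M] M by (auto simp: N_def)
  define \<theta> where "\<theta> = (\<lambda>i. - 3 * s + (real i + 1/2) * (6 * s / real N))"
  define Q where "Q = (\<lambda>(a :: nat \<Rightarrow> complex) U. map_pmf (\<lambda>i j. a j * cis (\<theta> i)) (R U))"
  have aQ: "achievable 1 M [] (Q a)" for a :: "nat \<Rightarrow> complex"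
    unfolding Q_def by (rule achievable_map[OF R(1)])
  have guess: "1 / real N \<le> measure_pmf.prob (Q a U) (sup_close 1 \<epsilon> (amps 1 U))"
    if U: "unitary_mat 1 U" and a: "a \<in> sup_close 1 s (amps 1 U)" for a U
  proof -
    have n: "cmod (a 0) = 1" "cmod (amps 1 U 0) = 1" and d: "cmod (a 0 - amps 1 U 0) \<le> s"
      using a unit_amp_amps[OF U] power2_eq_imp_eq[of "cmod _" 1] by (auto simp: sup_close_def unit_amp_def)
    obtain \<phi> where \<phi>: "amps 1 U 0 = a 0 * cis \<phi>" "\<bar>\<phi>\<bar> \<le> 3 * s" using circle_angle[OF n d] .
    define y where "y = (\<phi> + 3 * s) * real N / (6 * s)"
    have \<phi>s: "0 \<le> \<phi> + 3 * s" "\<phi> + 3 * s \<le> 6 * s" using \<phi>(2) by linarith+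
    have "0 \<le> y" unfolding y_def using \<phi>s(1) s by (intro divide_nonneg_pos mult_nonneg_nonneg) auto
    moreover have "y \<le> real N" using mult_right_mono[OF \<phi>s(2), of "real N"] s by (simp add: y_def field_simps)
    ultimately obtain i where i: "i < N" "\<bar>y - (real i + 1/2)\<bar> \<le> 1/2" using nat_cell N by blast
    have "\<phi> = - 3 * s + y * (6 * s / real N)" using s N by (simp add: y_def)
    then have "\<theta> i - \<phi> = - (y - (real i + 1/2)) * (6 * s / real N)" by (simp add: \<theta>_def algebra_simps)
    then have "\<bar>\<theta> i - \<phi>\<bar> = \<bar>y - (real i + 1/2)\<bar> * (6 * s / real N)" using s by (simp add: abs_mult abs_minus_commute[of y])
    also have "\<dots> \<le> 1/2 * (6 * s / real N)" using i(2) s by (intro mult_right_mono) auto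
    also have "\<dots> \<le> \<epsilon>" using M(2) N by (simp add: N_def field_simps)
    finally have t: "\<bar>\<theta> i - \<phi>\<bar> \<le> \<epsilon>" .
    have "cmod (a 0 * cis (\<theta> i) - amps 1 U 0) = cmod (cis (\<theta> i) - cis \<phi>)"
      using n unfolding \<phi>(1) by (simp add: norm_mult flip: right_diff_distrib)
    also have "\<dots> \<le> \<epsilon>" using cmod_cis_diff_le[of "\<theta> i" \<phi>] t by linarith
    finally have "(\<lambda>j. a j * cis (\<theta> i)) \<in> sup_close 1 \<epsilon> (amps 1 U)"
      using n by (simp add: sup_close_def unit_amp_def norm_mult)
    then have "measure_pmf.prob (R U) {i} \<le> measure_pmf.prob (Q a U) (sup_close 1 \<epsilon> (amps 1 U))"
      unfolding Q_def measure_map_pmf by (intro measure_pmf.finite_measure_mono) auto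
    then show ?thesis using R(2)[OF U i(1)] by (simp add: measure_pmf_single)
  qed
  have "achievable 1 (M * (2 * 1 * m)) (ql @ []) (\<lambda>U. P U \<bind> (\<lambda>a. Q a U))"
    by (rule achievable_bind[OF _ P aQ]) simp
  moreover have "r / real (2 * M) \<le> measure_pmf.prob (P U \<bind> (\<lambda>a. Q a U)) (sup_close 1 \<epsilon> (amps 1 U))"
    if U: "unitary_mat 1 U" for U
    using prob_bind_pmf_ge[OF close[OF U] guess[OF U] r] by (simp add: N_def)
  ultimately show ?thesis by auto
qed

text \<open>Only success probability \<open>p = 1 - \<delta>\<close> is demanded. Accuracy
  \<open>s = \<epsilon> / (16 * p)\<close> with failure \<open>1/2\<close> costs
  \<open>O(p / \<epsilon>)\<close>, and then about \<open>1 / (4 * p)\<close> cells succeed with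
  probability about \<open>2 * p\<close>, which leaves room for rounding. For tiny \<open>p\<close>
  guessing around \<open>delta0\<close> needs no query. The constant is
  \<open>884748 * 7 * 16\<close>, with \<open>ln 8 \<le> 7\<close>.\<close>

lemma learns_phase_high_failure:
  assumes \<epsilon>: "0 < \<epsilon>" "\<epsilon> < 1" and \<delta>: "7/8 < \<delta>" "\<delta> < 1"
  shows "learns 1 (99091776 * ((1 - \<delta>) / \<epsilon>)) \<epsilon> \<delta>"
proof -
  define p where "p = 1 - \<delta>"
  have p: "0 < p" "p < 1/8" using \<delta> by (auto simp: p_def)
  define s where "s = (if p \<le> \<epsilon> / 16 then 2 else \<epsilon> / (16 * p))"
  define r where "r = (if p \<le> \<epsilon> / 16 then 1 else (1/2 :: real))"
  have s0: "0 < s" using \<epsilon> p by (simp add: s_def)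
  have "\<exists>m ql P. achievable 1 m ql (P :: complex mat \<Rightarrow> (nat \<Rightarrow> complex) pmf) \<and> real (length ql) \<le> 99091776 * (p / \<epsilon>) \<and>
    (\<forall>U. unitary_mat 1 U \<longrightarrow> r \<le> measure_pmf.prob (P U) (sup_close 1 s (amps 1 U)))"
  proof (cases "p \<le> \<epsilon> / 16")
    case True
    have "measure_pmf.prob (return_pmf delta0) (sup_close 1 2 (amps 1 U)) = 1" if "unitary_mat 1 U" for U
      using delta0_sup_close[OF _ unit_amp_amps[OF that]] by (simp add: measure_return)
    then show ?thesis using achievable_return[of 1 delta0] True \<epsilon> p
      by (intro exI[of _ 1] exI[of _ "[]"] exI[of _ "\<lambda>_. return_pmf delta0"]) (simp add: s_def r_def)
  next
    case False
    have s1: "s \<le> 1" using False \<epsilon> p by (simp add: s_def field_simps)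
    have l8: "ln (8::real) \<le> 7" using ln_le_minus_one[of 8] by simp
    have "learns 1 (884748 * min (1 / s\<^sup>2) (sqrt (real 1) / s) * ln (4 * real 1 / (1/2))) s (1/2)"
      by (rule learns_sup_norm) (use s0 s1 in auto)
    moreover have "884748 * min (1 / s\<^sup>2) (sqrt (real 1) / s) * ln (4 * real 1 / (1/2)) \<le> 884748 * (1 / s) * 7"
      using l8 s0 by (intro mult_mono) auto
    moreover have "884748 * (1 / s) * 7 = 99091776 * (p / \<epsilon>)" using False by (simp add: s_def)
    ultimately have "learns 1 (99091776 * (p / \<epsilon>)) s (1/2)" using learns_mono by simp
    then show ?thesis using False by (simp add: learns_def r_def)
  qed
  then obtain m ql P where P: "achievable 1 m ql (P :: complex mat \<Rightarrow> (nat \<Rightarrow> complex) pmf)"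
    "real (length ql) \<le> 99091776 * (p / \<epsilon>)"
    "\<And>U. unitary_mat 1 U \<Longrightarrow> r \<le> measure_pmf.prob (P U) (sup_close 1 s (amps 1 U))" by blast
  define M where "M = nat \<lceil>2 * s / \<epsilon>\<rceil>"
  have se: "0 < 2 * s / \<epsilon>" using s0 \<epsilon> by simp
  have M1: "2 * s / \<epsilon> \<le> real M" unfolding M_def by (rule real_nat_ceiling_ge)
  have M2: "real M \<le> 2 * s / \<epsilon> + 1" using se unfolding M_def by simp
  have M0: "0 < M" using M1 se by (cases M) auto
  have M3: "3 * s \<le> real (2 * M) * \<epsilon>"
  proof -
    have "2 * s \<le> real M * \<epsilon>" using M1 \<epsilon> by (simp add: field_simps)
    then show ?thesis using s0 by simp
  qed
  have r0: "0 \<le> r" by (simp add: r_def)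
  obtain m' P' where P': "achievable 1 m' ql P'"
    "\<And>U. unitary_mat 1 U \<Longrightarrow> r / real (2 * M) \<le> measure_pmf.prob (P' U) (sup_close 1 \<epsilon> (amps 1 U))"
    using random_guess[OF P(1) s0 M0 M3 r0 P(3)] by blast
  have "p * real (2 * M) \<le> r"
  proof (cases "p \<le> \<epsilon> / 16")
    case True
    have "p * real (2 * M) \<le> \<epsilon> / 16 * (2 * (2 * s / \<epsilon> + 1))" using M2 True \<epsilon> by (intro mult_mono) auto
    also have "\<dots> \<le> 1" using True \<epsilon> by (simp add: s_def field_simps)
    finally show ?thesis using True by (simp add: r_def)
  next
    case False
    have "p * real (2 * M) \<le> p * (2 * (2 * s / \<epsilon> + 1))" using M2 p by (intro mult_left_mono) auto
    also have "\<dots> \<le> 1/2" using False \<epsilon> p by (simp add: s_def field_simps)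
    finally show ?thesis using False by (simp add: r_def)
  qed
  then have "p \<le> r / real (2 * M)" using M0 by (simp add: field_simps)
  then show ?thesis unfolding learns_def p_def[symmetric] using P(2) P' order_trans by blast
qed

section \<open>From the supremum norm to the \<open>\<ell>\<^sub>q\<close>-norm\<close>

lemma inv_q_bounds:
  assumes "2 \<le> q" shows "0 \<le> inv_q q" "inv_q q \<le> 1/2" "q \<noteq> 2 \<Longrightarrow> inv_q q < 1/2"
proof -
  have "0 \<le> inv_q q \<and> inv_q q \<le> 1/2 \<and> (q \<noteq> 2 \<longrightarrow> inv_q q < 1/2)"
    using assms by (cases q) (auto simp: inv_q_def field_simps)
  then show "0 \<le> inv_q q" "inv_q q \<le> 1/2" "q \<noteq> 2 \<Longrightarrow> inv_q q < 1/2" by auto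
qed

lemma lq_norm_le_sup:
  assumes q: "2 \<le> q" and d: "0 < d" and s: "0 \<le> s" and x: "\<And>j. j < d \<Longrightarrow> cmod (x j) \<le> s"
  shows "lq_norm q d x \<le> real d powr inv_q q * s"
proof (cases "q = \<infinity>")
  case True
  then show ?thesis using x s d by (auto simp: lq_norm_def inv_q_def)
next
  case False
  then obtain r where r: "q = ereal r" "2 \<le> r" using q by (cases q) auto
  have "(\<Sum>j<d. cmod (x j) powr r) \<le> (\<Sum>j<d. s powr r)" using x r by (intro sum_mono powr_mono2) auto
  then have "(\<Sum>j<d. cmod (x j) powr r) powr (1 / r) \<le> (real d * s powr r) powr (1 / r)"
    using r by (intro powr_mono2) (auto intro: sum_nonneg)
  also have "\<dots> = real d powr (1 / r) * s" using r s by (simp add: powr_mult powr_powr)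
  finally show ?thesis using r by (simp add: lq_norm_def inv_q_def)
qed

text \<open>\<open>\<parallel>x\<parallel>\<^sub>q \<le> \<parallel>x\<parallel>\<^sub>\<infinity>\<^bsup>1-2/q\<^esup> \<parallel>x\<parallel>\<^sub>2\<^bsup>2/q\<^esup>\<close> with \<open>\<parallel>x\<parallel>\<^sub>2 \<le> 3\<close>.\<close>

lemma lq_norm_interpolation:
  assumes q: "2 \<le> q" "q \<noteq> 2" and s: "0 < s" and x: "\<And>j. j < d \<Longrightarrow> cmod (x j) \<le> s"
    and x2: "(\<Sum>j<d. (cmod (x j))\<^sup>2) \<le> 9"
  shows "lq_norm q d x \<le> 3 * s powr (1 - 2 * inv_q q)"
proof (cases "q = \<infinity>")
  case True
  then show ?thesis using x s by (fastforce simp: lq_norm_def inv_q_def)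
next
  case False
  then obtain r where r: "q = ereal r" "2 < r" using q by (cases q) auto
  have "(\<Sum>j<d. cmod (x j) powr r) \<le> (\<Sum>j<d. s powr (r - 2) * (cmod (x j))\<^sup>2)"
  proof (rule sum_mono)
    fix j assume "j \<in> {..<d}"
    then have "cmod (x j) powr (r - 2) \<le> s powr (r - 2)" using x r by (intro powr_mono2) auto
    moreover have "cmod (x j) powr r = cmod (x j) powr (r - 2) * (cmod (x j))\<^sup>2"
      using r by (cases "x j = 0") (auto simp: powr_diff)
    ultimately show "cmod (x j) powr r \<le> s powr (r - 2) * (cmod (x j))\<^sup>2" by (simp add: mult_right_mono)
  qed
  also have "\<dots> \<le> s powr (r - 2) * 9" using x2 by (simp add: mult_left_mono flip: sum_distrib_left)
  finally have "(\<Sum>j<d. cmod (x j) powr r) powr (1 / r) \<le> (s powr (r - 2) * 9) powr (1 / r)"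
    using r by (intro powr_mono2) (auto intro: sum_nonneg)
  also have "\<dots> = s powr ((r - 2) / r) * 9 powr (1 / r)" by (simp add: powr_mult powr_powr)
  also have "\<dots> \<le> s powr ((r - 2) / r) * 9 powr (1 / 2)" using r by (intro mult_left_mono powr_mono) (auto simp: field_simps)
  also have "9 powr (1 / 2) = (3::real)" by (simp add: powr_half_sqrt)
  also have "(r - 2) / r = 1 - 2 * (1 / r)" using r by (simp add: field_simps)
  finally show ?thesis using r by (simp add: lq_norm_def inv_q_def mult.commute)
qed

lemma learns_imp_qalg:
  assumes d: "0 < d" and l: "learns d T s \<delta>"
    and lq: "\<And>x. (\<And>j. j < d \<Longrightarrow> cmod (x j) \<le> s) \<Longrightarrow> (\<Sum>j<d. (cmod (x j))\<^sup>2) \<le> 9 \<Longrightarrow> lq_norm q d x \<le> \<epsilon>"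
  shows "\<exists>A. valid_qalg d A \<and> real (num_queries A) \<le> T \<and>
    (\<forall>U. unitary_mat d U \<longrightarrow> 1 - \<delta> \<le> success_prob d q \<epsilon> A U)"
proof -
  obtain m ql P where P: "achievable d m ql P" "real (length ql) \<le> T"
    "\<And>U. unitary_mat d U \<Longrightarrow> 1 - \<delta> \<le> measure_pmf.prob (P U) (sup_close d s (amps d U))"
    using l unfolding learns_def by auto
  obtain A where A: "valid_qalg d A" "num_queries A = length ql"
    "\<And>U. unitary_mat d U \<Longrightarrow> success_prob d q \<epsilon> A U = measure_pmf.prob (P U) {x. lq_norm q d (\<lambda>j. amps d U j - x j) \<le> \<epsilon>}"
    using achievable_qalg[OF d P(1)] by blast
  have "1 - \<delta> \<le> success_prob d q \<epsilon> A U" if U: "unitary_mat d U" for U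
  proof -
    have "lq_norm q d (\<lambda>j. amps d U j - x j) \<le> \<epsilon>" if x: "x \<in> sup_close d s (amps d U)" for x
    proof (rule lq)
      show "cmod (amps d U j - x j) \<le> s" if "j < d" for j
        using x that by (simp add: sup_close_def norm_minus_commute)
      \<comment> \<open>By the parallelogram identity two unit vectors have squared distance at most
        \<open>4\<close>, within the \<open>9\<close> that matches the constant \<open>3\<close> of
        the query bound.\<close>
      have "(cmod (u - v))\<^sup>2 \<le> 2 * (cmod u)\<^sup>2 + 2 * (cmod v)\<^sup>2" for u v
      proof -
        have "(cmod (u - v))\<^sup>2 + (cmod (u + v))\<^sup>2 = 2 * (cmod u)\<^sup>2 + 2 * (cmod v)\<^sup>2"
          unfolding cmod_power2 by (simp add: power2_eq_square algebra_simps)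
        then show ?thesis using zero_le_power2[of "cmod (u + v)"] by linarith
      qed
      then have "(\<Sum>j<d. (cmod (amps d U j - x j))\<^sup>2) \<le> (\<Sum>j<d. 2 * (cmod (amps d U j))\<^sup>2 + 2 * (cmod (x j))\<^sup>2)"
        by (intro sum_mono)
      also have "\<dots> = 4"
        using unit_amp_amps[OF U d] x
        by (simp add: sum.distrib unit_amp_def sup_close_def flip: sum_distrib_left)
      finally show "(\<Sum>j<d. (cmod (amps d U j - x j))\<^sup>2) \<le> 9" by simp
    qed
    then have "measure_pmf.prob (P U) (sup_close d s (amps d U)) \<le> success_prob d q \<epsilon> A U"
      unfolding A(3)[OF U] by (intro measure_pmf.finite_measure_mono) auto
    then show ?thesis using P(3)[OF U] by linarith
  qed
  then show ?thesis using A(1,2) P(2) by auto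
qed

text \<open>\<open>s1\<close> solves \<open>3 * s powr (1 - 2 * i) = \<epsilon>\<close>
  (interpolation), \<open>s2\<close> solves \<open>real d powr i * s = \<epsilon>\<close> (direct
  comparison). Either accuracy suffices, so the larger and cheaper one is taken; being at least
  \<open>s1\<close> and at least \<open>s2\<close>, it meets both terms of the minimum. At
  \<open>q = 2\<close> only \<open>s2\<close> is available.\<close>

lemma qalg_exists_general:
  assumes d: "0 < d" and q: "2 \<le> q" and \<epsilon>: "0 < \<epsilon>" "\<epsilon> < 1" and \<delta>: "0 < \<delta>" "\<delta> < 1"
    and L: "1/8 \<le> ln (real d / \<delta>)"
  shows "\<exists>A. valid_qalg d A \<and> real (num_queries A) \<le> 99091776 * query_bound q d \<epsilon> \<delta> \<and>
    (\<forall>U. unitary_mat d U \<longrightarrow> 1 - \<delta> \<le> success_prob d q \<epsilon> A U)"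
proof -
  define i where "i = inv_q q"
  define s1 where "s1 = (\<epsilon> / 3) powr (1 / (1 - 2 * i))"
  define s2 where "s2 = \<epsilon> / real d powr i"
  define s where "s = (if q = 2 then s2 else max s1 s2)"
  note i = inv_q_bounds[OF q, folded i_def]
  have di: "1 \<le> real d powr i" using d i by (intro ge_one_powr_ge_zero) auto
  have s2: "0 < s2" "s2 \<le> 1" using di \<epsilon> d by (auto simp: s2_def field_simps)
  have s1: "0 < s1" "s1 \<le> 1" if "q \<noteq> 2"
    using \<epsilon> i(3)[OF that] by (auto simp: s1_def intro!: powr_le1)
  have s: "0 < s" "s \<le> 1" using s1 s2 by (auto simp: s_def)
  have b2: "sqrt (real d) / s \<le> real d powr (1/2 + i) / \<epsilon>"
  proof -
    have "s2 \<le> s" by (simp add: s_def)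
    then have "sqrt (real d) / s \<le> sqrt (real d) / s2" using s2 by (intro divide_left_mono) auto
    also have "\<dots> = real d powr (1/2 + i) / \<epsilon>" using d by (simp add: s2_def powr_add powr_half_sqrt)
    finally show ?thesis .
  qed
  have b1: "1 / s\<^sup>2 \<le> (3 / \<epsilon>) powr (1 / (1/2 - i))" if "q \<noteq> 2"
  proof -
    have "s1\<^sup>2 \<le> s\<^sup>2" using s1[OF that] that by (intro power_mono) (auto simp: s_def)
    then have "1 / s\<^sup>2 \<le> 1 / s1\<^sup>2" using s1[OF that] s by (intro divide_left_mono) auto
    also have "s1\<^sup>2 = (\<epsilon> / 3) powr (2 * (1 / (1 - 2 * i)))"
      using s1[OF that] unfolding s1_def by (simp add: powr_powr mult.commute flip: powr_numeral)
    also have "2 * (1 / (1 - 2 * i)) = 1 / (1/2 - i)" using i(3)[OF that] by (simp add: field_simps)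
    also have "1 / (\<epsilon> / 3) powr (1 / (1/2 - i)) = (3 / \<epsilon>) powr (1 / (1/2 - i))"
      using \<epsilon> by (simp add: powr_divide)
    finally show ?thesis .
  qed
  define B where "B = (if q = 2 then real d powr (1/2 + i) / \<epsilon>
      else min ((3 / \<epsilon>) powr (1 / (1/2 - i))) (real d powr (1/2 + i) / \<epsilon>))"
  have B: "query_bound q d \<epsilon> \<delta> = B * ln (real d / \<delta>)" by (simp add: query_bound_def B_def i_def)
  have mB: "min (1 / s\<^sup>2) (sqrt (real d) / s) \<le> B" using b1 b2 by (auto simp: B_def min_def)
  have m0: "0 \<le> min (1 / s\<^sup>2) (sqrt (real d) / s)" using s by simp
  have B0: "0 \<le> B" using mB m0 by linarith
  \<comment> \<open>From \<open>ln 4 \<le> 3 \<le> 24 * ln (d / \<delta>)\<close>; the lower bound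
    \<open>1/8\<close> enters here.\<close>
  have l: "ln (4 * real d / \<delta>) \<le> 25 * ln (real d / \<delta>)"
  proof -
    have "ln (4 * (real d / \<delta>)) = ln 4 + ln (real d / \<delta>)" using d \<delta> by (intro ln_mult_pos) auto
    moreover have "ln 4 \<le> (3::real)" using ln_le_minus_one[of 4] by simp
    ultimately show ?thesis using L by simp
  qed
  have "learns d (99091776 * query_bound q d \<epsilon> \<delta>) s \<delta>"
  proof (rule learns_mono[OF learns_sup_norm[OF d s \<delta>] _ order_refl])
    have "884748 * min (1 / s\<^sup>2) (sqrt (real d) / s) * ln (4 * real d / \<delta>) \<le> 884748 * B * (25 * ln (real d / \<delta>))"
      using mB B0 l one_le_ln_4[OF d \<delta>] by (intro mult_mono mult_left_mono mult_nonneg_nonneg) auto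
    also have "\<dots> \<le> 99091776 * (B * ln (real d / \<delta>))"
      using mult_nonneg_nonneg[of B "ln (real d / \<delta>)"] B0 L by simp
    finally show "884748 * min (1 / s\<^sup>2) (sqrt (real d) / s) * ln (4 * real d / \<delta>) \<le> 99091776 * query_bound q d \<epsilon> \<delta>"
      unfolding B .
  qed
  then show ?thesis
  proof (rule learns_imp_qalg[OF d])
    fix x :: "nat \<Rightarrow> complex"
    assume x: "\<And>j. j < d \<Longrightarrow> cmod (x j) \<le> s" and x2: "(\<Sum>j<d. (cmod (x j))\<^sup>2) \<le> 9"
    show "lq_norm q d x \<le> \<epsilon>"
    proof (cases "s = s2")
      case True
      have "lq_norm q d x \<le> real d powr i * s2"
        using lq_norm_le_sup[OF q d _ x] s by (simp add: True i_def)
      then show ?thesis using d by (simp add: s2_def)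
    next
      case False
      then have q2: "q \<noteq> 2" and ss: "s = s1" by (auto simp: s_def max_def split: if_splits)
      have "lq_norm q d x \<le> 3 * s1 powr (1 - 2 * i)"
        using lq_norm_interpolation[OF q q2 s(1) x x2] by (simp add: ss i_def)
      also have "s1 powr (1 - 2 * i) = \<epsilon> / 3" using i(3)[OF q2] \<epsilon> by (simp add: s1_def powr_powr)
      finally show ?thesis by simp
    qed
  qed
qed

text \<open>For \<open>d = 1\<close> both terms of the minimum are at least
  \<open>1 / \<epsilon>\<close>, the first because its exponent is at least \<open>1\<close>, and
  \<open>ln (1 / \<delta>) \<ge> 1 - \<delta>\<close>; the bound thus dominates the cost in
  \<open>learns_phase_high_failure\<close>.\<close>

lemma qalg_exists_high_failure:
  assumes q: "2 \<le> q" and \<epsilon>: "0 < \<epsilon>" "\<epsilon> < 1" and \<delta>: "7/8 < \<delta>" "\<delta> < 1"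
  shows "\<exists>A. valid_qalg 1 A \<and> real (num_queries A) \<le> 99091776 * query_bound q 1 \<epsilon> \<delta> \<and>
    (\<forall>U. unitary_mat 1 U \<longrightarrow> 1 - \<delta> \<le> success_prob 1 q \<epsilon> A U)"
proof (rule learns_imp_qalg)
  have B: "1 / \<epsilon> \<le> (if q = 2 then real 1 powr (1/2 + inv_q q) / \<epsilon>
      else min ((3 / \<epsilon>) powr (1 / (1/2 - inv_q q))) (real 1 powr (1/2 + inv_q q) / \<epsilon>))"
  proof -
    have "1 / \<epsilon> \<le> (3 / \<epsilon>) powr (1 / (1/2 - inv_q q))" if "q \<noteq> 2"
    proof -
      have "1 \<le> 1 / (1/2 - inv_q q)" using inv_q_bounds[OF q] that by (simp add: field_simps)
      then have "(3 / \<epsilon>) powr 1 \<le> (3 / \<epsilon>) powr (1 / (1/2 - inv_q q))"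
        using \<epsilon> by (intro powr_mono) auto
      moreover have "1 / \<epsilon> \<le> 3 / \<epsilon>" using \<epsilon> by (intro divide_right_mono) auto
      ultimately show ?thesis using \<epsilon> by simp
    qed
    then show ?thesis by simp
  qed
  have "1 - \<delta> \<le> ln (1 / \<delta>)" using ln_le_minus_one[of \<delta>] \<delta> by (simp add: ln_div)
  then have "1 / \<epsilon> * (1 - \<delta>) \<le> query_bound q 1 \<epsilon> \<delta>"
    unfolding query_bound_def using B \<epsilon> \<delta> by (intro mult_mono) (auto intro: order_trans[of 0 "1 / \<epsilon>"])
  then have "99091776 * ((1 - \<delta>) / \<epsilon>) \<le> 99091776 * query_bound q 1 \<epsilon> \<delta>"
    by (intro mult_left_mono) simp_all
  then show "learns 1 (99091776 * query_bound q 1 \<epsilon> \<delta>) \<epsilon> \<delta>"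
    by (rule learns_mono[OF learns_phase_high_failure[OF \<epsilon> \<delta>] _ order_refl])
  fix x :: "nat \<Rightarrow> complex"
  assume "\<And>j. j < 1 \<Longrightarrow> cmod (x j) \<le> \<epsilon>"
  then show "lq_norm q 1 x \<le> \<epsilon>" using lq_norm_le_sup[OF q, of 1 \<epsilon> x] \<epsilon> by simp
qed simp

theorem mainTheorem7:
  shows "\<exists>C>0. \<forall>(d::nat) (q::ereal) (\<epsilon>::real) (\<delta>::real).
     d \<ge> 1 \<longrightarrow> 2 \<le> q \<longrightarrow> 0 < \<epsilon> \<longrightarrow> \<epsilon> < 1 \<longrightarrow> 0 < \<delta> \<longrightarrow> \<delta> < 1 \<longrightarrow>
     (\<exists>A. valid_qalg d A \<and> real (num_queries A) \<le> C * query_bound q d \<epsilon> \<delta> \<and>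
          (\<forall>U. unitary_mat d U \<longrightarrow> success_prob d q \<epsilon> A U \<ge> 1 - \<delta>))"
proof (intro exI[of _ 99091776] conjI allI impI)
  fix d :: nat and q :: ereal and \<epsilon> \<delta> :: real
  assume d: "d \<ge> 1" and q: "2 \<le> q" and \<epsilon>: "0 < \<epsilon>" "\<epsilon> < 1" and \<delta>: "0 < \<delta>" "\<delta> < 1"
  show "\<exists>A. valid_qalg d A \<and> real (num_queries A) \<le> 99091776 * query_bound q d \<epsilon> \<delta> \<and>
          (\<forall>U. unitary_mat d U \<longrightarrow> success_prob d q \<epsilon> A U \<ge> 1 - \<delta>)"
  \<comment> \<open>Outside this corner the logarithm is at least \<open>1/8\<close>: at least
    \<open>ln 2\<close> for \<open>d \<ge> 2\<close>, and at least \<open>1 - \<delta>\<close> for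
    \<open>d = 1\<close> with \<open>\<delta> \<le> 7/8\<close>.\<close>
  proof (cases "d = 1 \<and> 7/8 < \<delta>")
    case True
    then show ?thesis using qalg_exists_high_failure[OF q \<epsilon> _ \<delta>(2)] by simp
  next
    case False
    have "1/8 \<le> ln (real d / \<delta>)"
    proof (cases "d = 1")
      case True
      then have "\<delta> \<le> 7/8" using False by simp
      then have "1/8 \<le> 1 - \<delta>" by simp
      also have "\<dots> \<le> ln (1 / \<delta>)" using ln_le_minus_one[of \<delta>] \<delta> by (simp add: ln_div)
      finally show ?thesis using True by simp
    next
      case False
      then have "2 \<le> real d" using d by simp
      also have "real d \<le> real d / \<delta>" using \<delta> d by (simp add: field_simps)
      finally have "ln 2 \<le> ln (real d / \<delta>)" by simp
      moreover have "1/2 \<le> ln (2::real)" using ln_le_minus_one[of "1/2"] by (simp add: ln_div)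
      ultimately show ?thesis by simp
    qed
    then show ?thesis using qalg_exists_general[OF _ q \<epsilon> \<delta>] d by simp
  qed
qed simp

end
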